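(* Let $\mathbb{F}$ be a field of prime characteristic $p>2$, let $m$ be a positive integer, and let $\lambda\in\mathbb{F}_p$. Then the following statements hold: (1) If $p=3$, then $$\dim_{\mathbb{F}}H^1(W(m),S(\lambda))=\begin{cases}0 & \text{if }\lambda=0\\ m-1 & \text{if }\lambda=1\\ 2 & \text{if }\lambda=2.\end{cases}$$ (2) If $p>3$, then $$\dim_{\mathbb{F}}H^1(W(m),S(\lambda))=\begin{cases}1 & \text{if }\lambda=1\\ m-1 & \text{if }\lambda=p-2\\ 2 & \text{if }\lambda=p-1\\ 0 & \text{if }\lambda\ne 1,p-2,p-1.\end{cases}$$
   Context: $H^1$ is ordinary (Chevalley-Eilenberg) Lie algebra cohomology. $\mathbb{F}_p$ denotes the prime field, viewed inside $\mathbb{F}$; integers are regarded as elements of $\mathbb{F}$ where appropriate. Zassenhaus algebra: let $A(m)$ be the truncated divided power algebra over $\mathbb{F}$ with basis $\{x^{(a)}\mid 0\le a\le p^m-1\}$ and product $x^{(a)}x^{(b)}=\binom{a+b}{a}x^{(a+b)}$ (zero if $a+b\ge p^m$). Let $\partial$ be the derivation with $\partial(x^{(0)})=0$ and $\partial(x^{(a)})=x^{(a-1)}$ for $1\le a\le p^m-1$. Then $W(m)=A(m)\partial\subseteq\mathrm{Der}_{\mathbb{F}}(A(m))$ is the Lie algebra with basis $e_i:=x^{(i+1)}\partial$, $-1\le i\le p^m-2$, and bracket $[e_i,e_j]=\left(\binom{i+j+1}{j}-\binom{i+j+1}{i}\right)e_{i+j}$ if $-1\le i+j\le p^m-2$ and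 $[e_i,e_j]=0$ otherwise. Simple modules: for $\lambda\in\mathbb{F}_p$, $S(\lambda)$ denotes the simple $W(m)$-module (up to isomorphism) that has a non-zero element $v\in S(\lambda)$ such that $e_{-1}^{p^m}\cdot v=0$, $e_0\cdot v=\lambda v$, and $e_i\cdot v=0$ for every $1\le i\le p^m-2$. *)

theory Defs
  imports
    "HOL-Computational_Algebra.Primes"
    "HOL-Library.Function_Algebras"
    "HOL-Algebra.AbelCoset"
    "Jordan_Normal_Form.VS_Connect"
begin

section \<open>Quotient vector spaces\<close>

text \<open>Scaling adds \<open>U\<close> back because the pointwise multiple of a coset by \<open>0\<close> is only \<open>{0}\<close>.\<close>

definition quotient_space :: "('a, 'c, 'd) module_scheme \<Rightarrow> 'c set \<Rightarrow> ('a, 'c set) module"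
  where "quotient_space V U =
    \<lparr>carrier = a_rcosets\<^bsub>V\<^esub> U, mult = undefined, one = undefined, zero = U, add = set_add V,
     smult = (\<lambda>c X. set_add V U ((\<lambda>x. c \<odot>\<^bsub>V\<^esub> x) ` X))\<rparr>"

lemma quotient_space_vectorspace:
  fixes V (structure)
  assumes "subspace K U V"
  shows "vectorspace K (quotient_space V U)"
proof -
  interpret V: vectorspace K V using assms by (simp add: subspace_def)
  have sm: "submodule K U V" using assms by (simp add: subspace_def)
  have sub: "subgroup U (add_monoid V)"
  proof (rule V.add.subgroupI, goal_cases)
    case (3 a)
    have "\<ominus>\<^bsub>K\<^esub> \<one>\<^bsub>K\<^esub> \<odot> a \<in> U"
      using sm 3 by (simp add: LinearCombinations.submodule.smult_closed)
    moreover have "a \<in> carrier V" using sm 3 by (auto dest: LinearCombinations.submodule.subset)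
    ultimately show ?case using V.smult_minus_1 by metis
  qed (use sm in \<open>auto simp: LinearCombinations.submodule_def\<close>)
  interpret U: abelian_subgroup U V
    using sub V.a_comm_group by (intro abelian_subgroupI2)
  have Uc: "U \<subseteq> carrier V" using U.a_subset .
  have car: "X \<in> a_rcosets U \<longleftrightarrow> (\<exists>x\<in>carrier V. X = U +> x)" for X
    by (auto simp: A_RCOSETS_def')
  have zero: "U = U +> \<zero>" using U.a_rcos_const U.zero_closed by auto
  have sc: "set_add V U ((\<lambda>x. c \<odot> x) ` (U +> x)) = U +> (c \<odot> x)"
    if c: "c \<in> carrier K" and x: "x \<in> carrier V" for c x
  proof -
    have "(\<lambda>x. c \<odot> x) ` (U +> x) \<subseteq> U +> (c \<odot> x)"
    proof
      fix y assume "y \<in> (\<lambda>x. c \<odot> x) ` (U +> x)"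
      then obtain u where u: "u \<in> U" "y = c \<odot> (u \<oplus> x)"
        by (auto simp: a_r_coset_def')
      then have "y = c \<odot> u \<oplus> c \<odot> x" using c x Uc by (auto simp: V.smult_r_distr)
      moreover have "c \<odot> u \<in> U" using sm c u by (simp add: LinearCombinations.submodule.smult_closed)
      ultimately show "y \<in> U +> (c \<odot> x)" by (auto simp: a_r_coset_def')
    qed
    then have "set_add V U ((\<lambda>x. c \<odot> x) ` (U +> x)) \<subseteq> set_add V U (U +> (c \<odot> x))"
      by (auto simp: set_add_def')
    also have "\<dots> = U +> (c \<odot> x)"
      using c x V.smult_closed by (intro U.rcosets_add_eq) (auto simp: car)
    finally have 1: "set_add V U ((\<lambda>x. c \<odot> x) ` (U +> x)) \<subseteq> U +> (c \<odot> x)" .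
    have x': "x \<in> U +> x" using U.a_rcos_self x .
    have 2: "U +> (c \<odot> x) \<subseteq> set_add V U ((\<lambda>x. c \<odot> x) ` (U +> x))"
    proof
      fix y assume "y \<in> U +> (c \<odot> x)"
      then obtain u where "u \<in> U" "y = u \<oplus> c \<odot> x" by (auto simp: a_r_coset_def')
      with x' show "y \<in> set_add V U ((\<lambda>x. c \<odot> x) ` (U +> x))"
        unfolding set_add_def' by blast
    qed
    from 1 2 show ?thesis by blast
  qed
  have ad: "set_add V (U +> x) (U +> y) = U +> (x \<oplus> y)" if "x \<in> carrier V" "y \<in> carrier V" for x y
    using that by (rule U.a_rcos_sum)
  have fld: "field K" ..
  have ex: "(\<exists>x\<in>carrier V. U +> y = U +> x)" if "y \<in> carrier V" for y
    using that by blast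
  show ?thesis
  proof (rule vs_criteria[OF fld], unfold quotient_space_def, simp_all only: partial_object.simps
      monoid.simps ring.simps module.simps car, goal_cases)
    case 1
    show ?case using zero V.zero_closed by blast
  next
    case 2
    show ?case by (auto simp: ad intro!: ex)
  next
    case 3
    show ?case
    proof (rule ballI)
      fix X assume "X \<in> a_rcosets U"
      then obtain x where x: "x \<in> carrier V" "X = U +> x" by (auto simp: car)
      then have "set_add V X (U +> \<ominus> x) = U" by (simp add: ad V.r_neg flip: zero)
      moreover have "U +> \<ominus> x \<in> a_rcosets U" using x by (auto simp: car)
      ultimately show "\<exists>Y\<in>a_rcosets U. set_add V X Y = U" by blast
    qed
  next
    case 4
    show ?case by (auto simp: sc intro!: ex)
  next
    case 5
    show ?case by (auto simp: ad V.a_comm)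
  next
    case 6
    show ?case by (auto simp: ad V.a_assoc)
  next
    case 7
    show ?case
    proof (rule ballI)
      fix X assume "X \<in> a_rcosets U"
      then obtain x where x: "x \<in> carrier V" "X = U +> x" by (auto simp: car)
      have "set_add V X (U +> \<zero>) = X" using x by (simp add: ad)
      then show "set_add V X U = X" by (simp flip: zero)
    qed
  next
    case 8
    show ?case by (auto simp: sc V.smult_assoc1)
  next
    case 9
    show ?case by (auto simp: sc car)
  next
    case 10
    show ?case by (auto simp: sc ad V.smult_l_distr)
  next
    case 11
    show ?case by (auto simp: sc ad V.smult_r_distr)
  qed
qed

text \<open>In VectorSpace, \<open>dim\<close> is the least size of a finite generating set, so it carries
  no information unless \<open>fin_dim\<close> holds as well.\<close>

definition has_dim :: "('a::field, 'c, 'd) module_scheme \<Rightarrow> nat \<Rightarrow> bool"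
  where "has_dim V n \<longleftrightarrow>
    vectorspace class_ring V \<and>
    vectorspace.fin_dim class_ring V \<and> vectorspace.dim class_ring V = n"


section \<open>Modules over a Lie algebra\<close>

definition fun_scale :: "('a \<Rightarrow> 'v \<Rightarrow> 'v) \<Rightarrow> 'a \<Rightarrow> ('x \<Rightarrow> 'v) \<Rightarrow> ('x \<Rightarrow> 'v)"
  where "fun_scale scale c f = (\<lambda>x. scale c (f x))"

text \<open>A Lie algebra is given by its carrier \<open>L\<close> inside an ambient vector space
  \<open>(+), sL\<close>, together with its bracket; the module is the whole type \<open>'v\<close>.
  Only the values \<open>act x\<close> for \<open>x \<in> L\<close> matter.\<close>

locale lie_module = L: vector_space sL + V: vector_space sV
  for L :: "'g::ab_group_add set"
    and sL :: "'a::field \<Rightarrow> 'g \<Rightarrow> 'g"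
    and bracket :: "'g \<Rightarrow> 'g \<Rightarrow> 'g"
    and sV :: "'a \<Rightarrow> 'v::ab_group_add \<Rightarrow> 'v"
    and act :: "'g \<Rightarrow> 'v \<Rightarrow> 'v" +
  assumes act_add_left: "x \<in> L \<Longrightarrow> y \<in> L \<Longrightarrow> act (x + y) v = act x v + act y v"
    and act_scale_left: "x \<in> L \<Longrightarrow> act (sL c x) v = sV c (act x v)"
    and act_add_right: "x \<in> L \<Longrightarrow> act x (v + w) = act x v + act x w"
    and act_scale_right: "x \<in> L \<Longrightarrow> act x (sV c v) = sV c (act x v)"
    and act_bracket:
      "x \<in> L \<Longrightarrow> y \<in> L \<Longrightarrow> act (bracket x y) v = act x (act y v) - act y (act x v)"

locale simple_lie_module = lie_module L sL bracket sV act
  for L :: "'g::ab_group_add set"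
    and sL :: "'a::field \<Rightarrow> 'g \<Rightarrow> 'g"
    and bracket :: "'g \<Rightarrow> 'g \<Rightarrow> 'g"
    and sV :: "'a \<Rightarrow> 'v::ab_group_add \<Rightarrow> 'v"
    and act :: "'g \<Rightarrow> 'v \<Rightarrow> 'v" +
  assumes nonzero: "\<exists>v::'v. v \<noteq> 0"
    and irreducible:
      "V.subspace U \<Longrightarrow> (\<And>x u. x \<in> L \<Longrightarrow> u \<in> U \<Longrightarrow> act x u \<in> U) \<Longrightarrow> U = {0} \<or> U = UNIV"


section \<open>Chevalley--Eilenberg cohomology in degree one\<close>

text \<open>A cochain is defined on \<open>L\<close> only; it is represented by its extension by zero to the
  ambient type.\<close>

definition ce_C1 :: "'g::ab_group_add set \<Rightarrow> ('a \<Rightarrow> 'g \<Rightarrow> 'g) \<Rightarrow> ('a::field \<Rightarrow> 'v \<Rightarrow> 'v) \<Rightarrow>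
    ('g \<Rightarrow> 'v::ab_group_add) set"
  where "ce_C1 L sL sV = {\<phi>.
    (\<forall>x\<in>L. \<forall>y\<in>L. \<phi> (x + y) = \<phi> x + \<phi> y) \<and>
    (\<forall>c. \<forall>x\<in>L. \<phi> (sL c x) = sV c (\<phi> x)) \<and>
    (\<forall>x. x \<notin> L \<longrightarrow> \<phi> x = 0)}"

definition ce_d0 :: "'g set \<Rightarrow> ('g \<Rightarrow> 'v \<Rightarrow> 'v) \<Rightarrow> 'v \<Rightarrow> ('g \<Rightarrow> 'v::ab_group_add)"
  where "ce_d0 L act v = (\<lambda>x. if x \<in> L then act x v else 0)"

definition ce_d1 :: "('g \<Rightarrow> 'g \<Rightarrow> 'g) \<Rightarrow> ('g \<Rightarrow> 'v \<Rightarrow> 'v) \<Rightarrow> ('g \<Rightarrow> 'v::ab_group_add) \<Rightarrow>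
    'g \<Rightarrow> 'g \<Rightarrow> 'v"
  where "ce_d1 bracket act \<phi> x y = act x (\<phi> y) - act y (\<phi> x) - \<phi> (bracket x y)"

definition ce_Z1 :: "'g::ab_group_add set \<Rightarrow> ('a \<Rightarrow> 'g \<Rightarrow> 'g) \<Rightarrow> ('g \<Rightarrow> 'g \<Rightarrow> 'g) \<Rightarrow>
    ('a::field \<Rightarrow> 'v \<Rightarrow> 'v) \<Rightarrow> ('g \<Rightarrow> 'v \<Rightarrow> 'v) \<Rightarrow> ('g \<Rightarrow> 'v::ab_group_add) set"
  where "ce_Z1 L sL bracket sV act =
    {\<phi> \<in> ce_C1 L sL sV. \<forall>x\<in>L. \<forall>y\<in>L. ce_d1 bracket act \<phi> x y = 0}"

definition ce_B1 :: "'g set \<Rightarrow> ('g \<Rightarrow> 'v \<Rightarrow> 'v) \<Rightarrow> ('g \<Rightarrow> 'v::ab_group_add) set"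
  where "ce_B1 L act = range (ce_d0 L act)"

definition ce_Z1_space :: "'g::ab_group_add set \<Rightarrow> ('a \<Rightarrow> 'g \<Rightarrow> 'g) \<Rightarrow> ('g \<Rightarrow> 'g \<Rightarrow> 'g) \<Rightarrow>
    ('a::field \<Rightarrow> 'v \<Rightarrow> 'v) \<Rightarrow> ('g \<Rightarrow> 'v \<Rightarrow> 'v) \<Rightarrow> ('a, 'g \<Rightarrow> 'v::ab_group_add) module"
  where "ce_Z1_space L sL bracket sV act =
    \<lparr>carrier = ce_Z1 L sL bracket sV act, mult = undefined, one = undefined, zero = 0,
     add = (+), smult = fun_scale sV\<rparr>"

definition ce_H1 :: "'g::ab_group_add set \<Rightarrow> ('a \<Rightarrow> 'g \<Rightarrow> 'g) \<Rightarrow> ('g \<Rightarrow> 'g \<Rightarrow> 'g) \<Rightarrow>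
    ('a::field \<Rightarrow> 'v \<Rightarrow> 'v) \<Rightarrow> ('g \<Rightarrow> 'v \<Rightarrow> 'v) \<Rightarrow> ('a, ('g \<Rightarrow> 'v::ab_group_add) set) module"
  where "ce_H1 L sL bracket sV act =
    quotient_space (ce_Z1_space L sL bracket sV act) (ce_B1 L act)"

context lie_module begin

lemma ce_Z1_iff:
  "\<phi> \<in> ce_Z1 L sL bracket sV act \<longleftrightarrow>
    (\<forall>x\<in>L. \<forall>y\<in>L. \<phi> (x + y) = \<phi> x + \<phi> y) \<and>
    (\<forall>c. \<forall>x\<in>L. \<phi> (sL c x) = sV c (\<phi> x)) \<and>
    (\<forall>x. x \<notin> L \<longrightarrow> \<phi> x = 0) \<and>
    (\<forall>x\<in>L. \<forall>y\<in>L. \<phi> (bracket x y) = act x (\<phi> y) - act y (\<phi> x))"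
  unfolding ce_Z1_def ce_C1_def ce_d1_def by auto

lemma act_zero_right [simp]: "x \<in> L \<Longrightarrow> act x 0 = 0"
  using act_add_right[of x 0 0] by simp

lemma ce_Z1_add:
  assumes "\<phi> \<in> ce_Z1 L sL bracket sV act" "\<psi> \<in> ce_Z1 L sL bracket sV act"
  shows "\<phi> + \<psi> \<in> ce_Z1 L sL bracket sV act"
  using assms by (simp add: ce_Z1_iff act_add_right V.scale_right_distrib)

lemma ce_Z1_scale:
  assumes "\<phi> \<in> ce_Z1 L sL bracket sV act"
  shows "fun_scale sV c \<phi> \<in> ce_Z1 L sL bracket sV act"
  using assms by (auto simp add: ce_Z1_iff fun_scale_def act_scale_right V.scale_right_distrib
    V.scale_right_diff_distrib V.scale_left_commute)

lemma ce_Z1_zero: "0 \<in> ce_Z1 L sL bracket sV act"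
  by (simp add: ce_Z1_iff)

lemma ce_Z1_space_vectorspace: "vectorspace class_ring (ce_Z1_space L sL bracket sV act)"
proof (rule vs_criteria[OF class_field], goal_cases)
  case 3
  show ?case
  proof (intro ballI)
    fix v assume "v \<in> carrier (ce_Z1_space L sL bracket sV act)"
    then have v: "v \<in> ce_Z1 L sL bracket sV act" by (simp add: ce_Z1_space_def)
    have "v + fun_scale sV (- 1) v = 0" by (simp add: fun_eq_iff fun_scale_def)
    then show "\<exists>w\<in>carrier (ce_Z1_space L sL bracket sV act).
        v \<oplus>\<^bsub>ce_Z1_space L sL bracket sV act\<^esub> w = \<zero>\<^bsub>ce_Z1_space L sL bracket sV act\<^esub>"
      using ce_Z1_scale[OF v, of "- 1"] by (intro bexI) (simp_all add: ce_Z1_space_def)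
  qed
next
  case 5
  then show ?case by (simp add: ce_Z1_space_def add.commute)
next
  case 6
  then show ?case by (simp add: ce_Z1_space_def add.assoc)
qed (simp_all add: ce_Z1_space_def class_ring_simps ce_Z1_add ce_Z1_scale[unfolded fun_scale_def] ce_Z1_zero
    fun_scale_def fun_eq_iff V.scale_right_distrib V.scale_left_distrib)

lemma ce_B1_subset:
  assumes "L.subspace L" and "\<And>x y. x \<in> L \<Longrightarrow> y \<in> L \<Longrightarrow> bracket x y \<in> L"
  shows "ce_B1 L act \<subseteq> ce_Z1 L sL bracket sV act"
  using assms L.subspace_add L.subspace_scale
  by (auto simp: ce_B1_def ce_d0_def ce_Z1_iff act_add_left act_scale_left act_bracket)

lemma ce_B1_subspace:
  assumes "L.subspace L" and "\<And>x y. x \<in> L \<Longrightarrow> y \<in> L \<Longrightarrow> bracket x y \<in> L"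
  shows "subspace class_ring (ce_B1 L act) (ce_Z1_space L sL bracket sV act)"
proof -
  interpret Z: vectorspace class_ring "ce_Z1_space L sL bracket sV act"
    by (rule ce_Z1_space_vectorspace)
  have "\<phi> + \<psi> \<in> ce_B1 L act" if "\<phi> \<in> ce_B1 L act" "\<psi> \<in> ce_B1 L act" for \<phi> \<psi>
  proof -
    obtain v w where "\<phi> = ce_d0 L act v" "\<psi> = ce_d0 L act w" using \<open>\<phi> \<in> _\<close> \<open>\<psi> \<in> _\<close>
      by (auto simp: ce_B1_def)
    then have "\<phi> + \<psi> = ce_d0 L act (v + w)" by (auto simp: fun_eq_iff ce_d0_def act_add_right)
    then show ?thesis by (auto simp: ce_B1_def)
  qed
  moreover have "fun_scale sV c \<phi> \<in> ce_B1 L act" if "\<phi> \<in> ce_B1 L act" for c \<phi>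
  proof -
    obtain v where "\<phi> = ce_d0 L act v" using \<open>\<phi> \<in> _\<close> by (auto simp: ce_B1_def)
    then have "fun_scale sV c \<phi> = ce_d0 L act (sV c v)"
      by (auto simp: fun_eq_iff ce_d0_def fun_scale_def act_scale_right)
    then show ?thesis by (auto simp: ce_B1_def)
  qed
  moreover have "0 = ce_d0 L act 0" by (auto simp: fun_eq_iff ce_d0_def)
  then have "0 \<in> ce_B1 L act" unfolding ce_B1_def by blast
  ultimately show ?thesis
    using ce_B1_subset[OF assms] Z.vectorspace_axioms Z.module_axioms
    by (auto simp: subspace_def submodule_def ce_Z1_space_def)
qed

lemma ce_H1_vectorspace:
  assumes "L.subspace L" and "\<And>x y. x \<in> L \<Longrightarrow> y \<in> L \<Longrightarrow> bracket x y \<in> L"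
  shows "vectorspace class_ring (ce_H1 L sL bracket sV act)"
  unfolding ce_H1_def by (rule quotient_space_vectorspace[OF ce_B1_subspace[OF assms]])

end


section \<open>The Zassenhaus algebra\<close>

text \<open>An element of the divided power algebra \<open>A(m)\<close> is the function sending
  \<open>a\<close> to its coefficient at \<open>x\<^sup>(\<^sup>a\<^sup>)\<close>; it vanishes from \<open>CHAR('a) ^ m\<close> on.\<close>

definition dp_carrier :: "nat \<Rightarrow> (nat \<Rightarrow> 'a::field) set"
  where "dp_carrier m = {f. \<forall>n. CHAR('a) ^ m \<le> n \<longrightarrow> f n = 0}"

definition dp_basis :: "nat \<Rightarrow> nat \<Rightarrow> 'a::field"
  where "dp_basis a = (\<lambda>n. if n = a then 1 else 0)"

definition dp_mult :: "nat \<Rightarrow> (nat \<Rightarrow> 'a::field) \<Rightarrow> (nat \<Rightarrow> 'a) \<Rightarrow> (nat \<Rightarrow> 'a)"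
  where "dp_mult m f g = (\<lambda>n. if n < CHAR('a) ^ m
    then (\<Sum>a\<le>n. of_nat (n choose a) * f a * g (n - a)) else 0)"

definition dp_deriv :: "nat \<Rightarrow> (nat \<Rightarrow> 'a::field) \<Rightarrow> (nat \<Rightarrow> 'a)"
  where "dp_deriv m f = (\<lambda>n. if Suc n < CHAR('a) ^ m then f (Suc n) else 0)"

text \<open>\<open>dp_vf m f\<close> is the derivation \<open>f \<partial>\<close>. Both \<open>dp_mult m\<close> and \<open>dp_deriv m\<close> disregard
  coefficients outside the range, so operators on \<open>A(m)\<close> can be compared as operators on the whole
  function type.\<close>

definition dp_vf :: "nat \<Rightarrow> (nat \<Rightarrow> 'a::field) \<Rightarrow> (nat \<Rightarrow> 'a) \<Rightarrow> (nat \<Rightarrow> 'a)"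
  where "dp_vf m f = (\<lambda>g. dp_mult m f (dp_deriv m g))"

definition commutator :: "('x \<Rightarrow> 'x) \<Rightarrow> ('x \<Rightarrow> 'x) \<Rightarrow> ('x \<Rightarrow> 'x::ab_group_add)"
  where "commutator D E = (\<lambda>g. D (E g) - E (D g))"

definition zass :: "nat \<Rightarrow> ((nat \<Rightarrow> 'a::field) \<Rightarrow> (nat \<Rightarrow> 'a)) set"
  where "zass m = dp_vf m ` dp_carrier m"

definition zass_scale :: "'a::field \<Rightarrow> ((nat \<Rightarrow> 'a) \<Rightarrow> (nat \<Rightarrow> 'a)) \<Rightarrow> ((nat \<Rightarrow> 'a) \<Rightarrow> (nat \<Rightarrow> 'a))"
  where "zass_scale = fun_scale (fun_scale (*))"

text \<open>Meaningful for \<open>-1 \<le> i \<le> p ^ m - 2\<close>.\<close>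

definition zass_e :: "nat \<Rightarrow> int \<Rightarrow> (nat \<Rightarrow> 'a::field) \<Rightarrow> (nat \<Rightarrow> 'a)"
  where "zass_e m i = dp_vf m (dp_basis (nat (i + 1)))"

lemma dp_mult_basis:
  assumes "a < CHAR('a) ^ m" and "b < CHAR('a) ^ m"
  shows "dp_mult m (dp_basis a) (dp_basis b :: nat \<Rightarrow> 'a::field) =
    (if a + b < CHAR('a) ^ m
     then fun_scale (*) (of_nat ((a + b) choose a)) (dp_basis (a + b)) else 0)"
proof
  fix n
  have "(\<Sum>k\<le>n. of_nat (n choose k) * dp_basis a k * dp_basis b (n - k) :: 'a) =
      (\<Sum>k\<in>{a} \<inter> {..n}. of_nat (n choose k) * dp_basis b (n - k))"
    by (rule sum.mono_neutral_cong_right) (auto simp: dp_basis_def)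
  then have "(\<Sum>k\<le>n. of_nat (n choose k) * dp_basis a k * dp_basis b (n - k) :: 'a) =
      (if n = a + b then of_nat (n choose a) else 0)"
    by (cases "a \<le> n") (auto simp: dp_basis_def)
  then show "dp_mult m (dp_basis a) (dp_basis b :: nat \<Rightarrow> 'a) n =
    (if a + b < CHAR('a) ^ m
     then fun_scale (*) (of_nat ((a + b) choose a)) (dp_basis (a + b)) else 0) n"
    by (auto simp: dp_mult_def fun_scale_def dp_basis_def)
qed

lemma dp_deriv_basis_0: "dp_deriv m (dp_basis 0) = 0"
  by (auto simp: dp_deriv_def dp_basis_def fun_eq_iff)

lemma dp_deriv_basis_Suc:
  "Suc a < CHAR('a) ^ m \<Longrightarrow> dp_deriv m (dp_basis (Suc a)) = (dp_basis a :: nat \<Rightarrow> 'a::field)"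
  by (auto simp: dp_deriv_def dp_basis_def fun_eq_iff)

lemma dp_mult_add_left: "dp_mult m (f + g) h = dp_mult m f h + dp_mult m g h"
  by (simp add: dp_mult_def fun_eq_iff algebra_simps sum.distrib)

lemma dp_mult_add_right: "dp_mult m h (f + g) = dp_mult m h f + dp_mult m h g"
  by (simp add: dp_mult_def fun_eq_iff algebra_simps sum.distrib)

lemma dp_mult_diff_left: "dp_mult m (f - g) h = dp_mult m f h - dp_mult m g h"
  by (simp add: dp_mult_def fun_eq_iff algebra_simps sum_subtractf)

lemma dp_mult_commute: "dp_mult m f g = dp_mult m g f"
proof
  fix n
  have "(\<Sum>a\<le>n. of_nat (n choose a) * f a * g (n - a)) =
      (\<Sum>a\<le>n. of_nat (n choose a) * g a * f (n - a))"
    by (rule sum.reindex_bij_witness[of _ "\<lambda>a. n - a" "\<lambda>a. n - a"])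
      (auto simp: mult_ac simp flip: binomial_symmetric)
  then show "dp_mult m f g n = dp_mult m g f n" by (simp add: dp_mult_def)
qed

lemma dp_mult_assoc: "dp_mult m (dp_mult m f g) h = dp_mult m f (dp_mult m g h)"
proof
  fix n
  show "dp_mult m (dp_mult m f g) h n = dp_mult m f (dp_mult m g h) n"
  proof (cases "n < CHAR('a) ^ m")
    case True
    have "(\<Sum>j\<le>n. of_nat (n choose j) * (\<Sum>i\<le>j. of_nat (j choose i) * f i * g (j - i)) * h (n - j))
        = (\<Sum>j\<le>n. \<Sum>i\<le>j. of_nat ((n choose j) * (j choose i)) * f i * g (j - i) * h (n - j))"
      by (simp add: sum_distrib_left sum_distrib_right mult_ac)
    also have "\<dots> = (\<Sum>j\<le>n. \<Sum>i\<le>j. of_nat ((n choose i) * ((n - i) choose (j - i))) * f i * g (j - i) * h (n - j))"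
      by (intro sum.cong refl) (simp add: choose_mult)
    also have "\<dots> = (\<Sum>(j,i)\<in>Sigma {..n} (\<lambda>j. {..j}). of_nat ((n choose i) * ((n - i) choose (j - i))) * f i * g (j - i) * h (n - j))"
      by (rule sum.Sigma) auto
    also have "\<dots> = (\<Sum>(i,k)\<in>Sigma {..n} (\<lambda>i. {..n - i}). of_nat ((n choose i) * ((n - i) choose k)) * f i * g k * h (n - i - k))"
      by (rule sum.reindex_bij_witness[of _ "\<lambda>(i,k). (i + k, i)" "\<lambda>(j,i). (i, j - i)"]) auto
    also have "\<dots> = (\<Sum>i\<le>n. \<Sum>k\<le>n - i. of_nat ((n choose i) * ((n - i) choose k)) * f i * g k * h (n - i - k))"
      by (rule sum.Sigma[symmetric]) auto
    also have "\<dots> = (\<Sum>i\<le>n. of_nat (n choose i) * f i * (\<Sum>k\<le>n - i. of_nat ((n - i) choose k) * g k * h (n - i - k)))"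
      by (simp add: sum_distrib_left sum_distrib_right mult_ac)
    finally show ?thesis using True by (simp add: dp_mult_def less_imp_diff_less cong: sum.cong_simp)
  qed (simp add: dp_mult_def)
qed

lemma dp_deriv_mult:
  fixes f g :: "nat \<Rightarrow> 'a::field"
  assumes p: "prime CHAR('a)"
  shows "dp_deriv m (dp_mult m f g) = dp_mult m (dp_deriv m f) g + dp_mult m f (dp_deriv m g)"
proof
  fix n
  let ?q = "CHAR('a) ^ m"
  consider "n \<ge> ?q" | "Suc n < ?q" | "Suc n = ?q" by linarith
  then show "dp_deriv m (dp_mult m f g) n =
      (dp_mult m (dp_deriv m f) g + dp_mult m f (dp_deriv m g)) n"
  proof cases
    case 1
    then show ?thesis by (simp add: dp_mult_def dp_deriv_def)
  next
    case 2
    have "(\<Sum>a\<le>Suc n. of_nat (Suc n choose a) * f a * g (Suc n - a)) =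
      f 0 * g (Suc n) + (\<Sum>a\<le>n. of_nat (Suc n choose Suc a) * f (Suc a) * g (n - a))"
      by (subst sum.atMost_Suc_shift) simp
    also have "\<dots> = (\<Sum>a\<le>n. of_nat (n choose a) * f (Suc a) * g (n - a)) +
      (f 0 * g (Suc n) + (\<Sum>a\<le>n. of_nat (n choose Suc a) * f (Suc a) * g (n - a)))"
      by (simp add: algebra_simps sum.distrib)
    also have "f 0 * g (Suc n) + (\<Sum>a\<le>n. of_nat (n choose Suc a) * f (Suc a) * g (n - a)) =
       (\<Sum>a\<le>Suc n. of_nat (n choose a) * f a * g (Suc n - a))"
      by (subst sum.atMost_Suc_shift) simp
    also have "\<dots> = (\<Sum>a\<le>n. of_nat (n choose a) * f a * g (Suc (n - a)))"
      by (simp add: Suc_diff_le binomial_eq_0)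
    finally have "(\<Sum>a\<le>Suc n. of_nat (Suc n choose a) * f a * g (Suc n - a)) =
        (\<Sum>a\<le>n. of_nat (n choose a) * f (Suc a) * g (n - a)) +
        (\<Sum>a\<le>n. of_nat (n choose a) * f a * g (Suc (n - a)))" .
    moreover have "Suc (n - a) < ?q" for a using 2 by linarith
    ultimately show ?thesis using 2
      by (simp add: dp_mult_def dp_deriv_def del: sum.atMost_Suc binomial_Suc_Suc cong: sum.cong_simp)
  next
    case 3
    have dv: "of_nat (?q choose k) = (0 :: 'a)" if "0 < k" "k < ?q" for k
    proof -
      have "CHAR('a) dvd (?q choose k)"
      proof (rule ccontr)
        assume "\<not> CHAR('a) dvd (?q choose k)"
        then have "coprime ?q (?q choose k)"
          using p by (simp add: prime_imp_coprime)
        moreover have "?q dvd k * (?q choose k)"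
          using that by (simp add: times_binomial_minus1_eq)
        ultimately have "?q dvd k" by (simp add: coprime_dvd_mult_left_iff)
        then show False using that by (auto dest: dvd_imp_le)
      qed
      then show ?thesis by (simp add: of_nat_eq_0_iff_char_dvd)
    qed
    have "(\<Sum>a\<le>n. of_nat (n choose a) * dp_deriv m f a * g (n - a)) =
        (\<Sum>a<n. of_nat (n choose a) * f (Suc a) * g (n - a))"
      using 3 by (cases n) (auto simp: dp_deriv_def lessThan_Suc_atMost intro!: sum.cong)
    moreover have "(\<Sum>a\<le>n. of_nat (n choose a) * f a * dp_deriv m g (n - a)) =
        (\<Sum>a<n. of_nat (n choose Suc a) * f (Suc a) * g (n - a))"
    proof -
      have "(\<Sum>a\<le>n. of_nat (n choose a) * f a * dp_deriv m g (n - a)) =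
        (\<Sum>a\<in>{1..n}. of_nat (n choose a) * f a * g (Suc n - a))"
        by (rule sum.mono_neutral_cong_right) (auto simp: dp_deriv_def Suc_diff_le 3[symmetric])
      also have "\<dots> = (\<Sum>a<n. of_nat (n choose Suc a) * f (Suc a) * g (n - a))"
        by (rule sum.reindex_bij_witness[of _ Suc "\<lambda>a. a - 1"]) auto
      finally show ?thesis .
    qed
    moreover have "(\<Sum>a<n. of_nat (n choose a) * f (Suc a) * g (n - a)) +
        (\<Sum>a<n. of_nat (n choose Suc a) * f (Suc a) * g (n - a)) =
        (\<Sum>a<n. of_nat (?q choose Suc a) * f (Suc a) * g (n - a))"
      by (simp add: sum.distrib algebra_simps flip: 3)
    moreover have "\<dots> = 0"
      by (rule sum.neutral) (use 3 dv in \<open>auto simp del: binomial_Suc_Suc\<close>)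
    ultimately show ?thesis using 3 by (simp add: dp_mult_def) (simp add: dp_deriv_def)
  qed
qed

lemma dp_vf_commutator:
  fixes f g :: "nat \<Rightarrow> 'a::field"
  assumes "prime CHAR('a)"
  shows "commutator (dp_vf m f) (dp_vf m g) =
    dp_vf m (dp_mult m f (dp_deriv m g) - dp_mult m g (dp_deriv m f))"
proof -
  have *: "dp_mult m f (dp_mult m g h) = dp_mult m g (dp_mult m f h)" for h
    using dp_mult_assoc[of m f g h] dp_mult_assoc[of m g f h] dp_mult_commute[of m f g] by metis
  show ?thesis
  proof
    fix h
    show "commutator (dp_vf m f) (dp_vf m g) h =
        dp_vf m (dp_mult m f (dp_deriv m g) - dp_mult m g (dp_deriv m f)) h"
      unfolding commutator_def dp_vf_def dp_deriv_mult[OF assms] dp_mult_add_right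
        dp_mult_diff_left dp_mult_assoc
      using *[of "dp_deriv m (dp_deriv m h)"] by simp
  qed
qed

lemma dp_vf_diff: "dp_vf m (f - g) = dp_vf m f - dp_vf m g"
  by (simp add: dp_vf_def dp_mult_diff_left fun_eq_iff)

lemma dp_vf_add: "dp_vf m (f + g) = dp_vf m f + dp_vf m g"
  by (simp add: dp_vf_def dp_mult_add_left fun_eq_iff)

lemma dp_vf_scale: "dp_vf m (fun_scale (*) c f) = zass_scale c (dp_vf m f)"
  by (simp add: dp_vf_def zass_scale_def fun_scale_def dp_mult_def fun_eq_iff sum_distrib_left mult_ac)

lemma vector_space_zass_scale: "vector_space zass_scale"
  by unfold_locales (auto simp: zass_scale_def fun_scale_def fun_eq_iff algebra_simps)

lemma zass_subspace: "Modules.module.subspace (zass_scale :: 'a::field \<Rightarrow> _) (zass m)"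
proof -
  interpret vector_space "zass_scale :: 'a \<Rightarrow> _" by (rule vector_space_zass_scale)
  have "dp_vf m 0 = (0 :: (nat \<Rightarrow> 'a) \<Rightarrow> _)" by (simp add: dp_vf_def dp_mult_def fun_eq_iff)
  then have "(0 :: (nat \<Rightarrow> 'a) \<Rightarrow> _) \<in> zass m" by (force simp: zass_def dp_carrier_def)
  moreover have "x + y \<in> zass m" if xy: "x \<in> zass m" "y \<in> zass m" for x y :: "(nat \<Rightarrow> 'a) \<Rightarrow> _"
  proof -
    obtain f g where "x = dp_vf m f" "y = dp_vf m g" "f \<in> dp_carrier m" "g \<in> dp_carrier m"
      using xy by (auto simp: zass_def)
    then have "x + y = dp_vf m (f + g)" "f + g \<in> dp_carrier m"
      by (auto simp: dp_vf_add dp_carrier_def)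
    then show ?thesis by (auto simp: zass_def)
  qed
  moreover have "zass_scale c x \<in> zass m" if x: "x \<in> zass m" for c and x :: "(nat \<Rightarrow> 'a) \<Rightarrow> _"
  proof -
    obtain f where "x = dp_vf m f" "f \<in> dp_carrier m"
      using x by (auto simp: zass_def)
    then have "zass_scale c x = dp_vf m (fun_scale (*) c f)" "fun_scale (*) c f \<in> dp_carrier m"
      by (simp only: dp_vf_scale) (use \<open>f \<in> _\<close> in \<open>simp add: dp_carrier_def fun_scale_def\<close>)
    then show ?thesis by (auto simp: zass_def)
  qed
  ultimately show ?thesis by (simp add: subspace_def)
qed

lemma zass_bracket_closed:
  fixes D E :: "(nat \<Rightarrow> 'a::field) \<Rightarrow> nat \<Rightarrow> 'a"
  assumes "prime CHAR('a)" and "D \<in> zass m" and "E \<in> zass m"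
  shows "commutator D E \<in> zass m"
proof -
  obtain f g where "D = dp_vf m f" "E = dp_vf m g" using assms by (auto simp: zass_def)
  then have "commutator D E = dp_vf m (dp_mult m f (dp_deriv m g) - dp_mult m g (dp_deriv m f))"
    by (simp only: dp_vf_commutator[OF assms(1)])
  moreover have "dp_mult m f (dp_deriv m g) - dp_mult m g (dp_deriv m f) \<in> dp_carrier m"
    by (auto simp: dp_carrier_def dp_mult_def)
  ultimately show ?thesis unfolding zass_def by blast
qed

lemma zass_e_bracket:
  fixes m :: nat
  defines "q \<equiv> int (CHAR('a::field) ^ m)"
  defines "C \<equiv> \<lambda>n k :: int. if 0 \<le> k then nat n choose nat k else 0"
  assumes p: "prime CHAR('a)" and i: "-1 \<le> i" "i \<le> q - 2" and j: "-1 \<le> j" "j \<le> q - 2"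
  shows "commutator (zass_e m i) (zass_e m j) =
    (if -1 \<le> i + j \<and> i + j \<le> q - 2
     then zass_scale (of_nat (C (i + j + 1) j) - of_nat (C (i + j + 1) i))
       (zass_e m (i + j) :: (nat \<Rightarrow> 'a) \<Rightarrow> _)
     else 0)"
proof -
  have T: "dp_mult m (dp_basis a) (dp_deriv m (dp_basis b)) =
     (if b > 0 \<and> a + b - 1 < CHAR('a) ^ m
      then fun_scale (*) (of_nat ((a + b - 1) choose a)) (dp_basis (a + b - 1) :: nat \<Rightarrow> 'a) else 0)"
    if "a < CHAR('a) ^ m" "b < CHAR('a) ^ m" for a b
  proof (cases b)
    case 0
    then show ?thesis by (simp add: dp_deriv_basis_0) (simp add: dp_mult_def fun_eq_iff)
  next
    case (Suc c)
    then show ?thesis using that by (simp add: dp_deriv_basis_Suc dp_mult_basis)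
  qed
  define a b where "a = nat (i + 1)" and "b = nat (j + 1)"
  have ab: "i = int a - 1" "j = int b - 1" using i j by (auto simp: a_def b_def)
  have nab: "nat i = a - 1" "nat j = b - 1" using ab by auto
  have aq: "a < CHAR('a) ^ m" "b < CHAR('a) ^ m" using i j ab unfolding q_def by linarith+
  have comm: "commutator (zass_e m i) (zass_e m j) =
    dp_vf m (dp_mult m (dp_basis a) (dp_deriv m (dp_basis b)) -
      dp_mult m (dp_basis b) (dp_deriv m (dp_basis a :: nat \<Rightarrow> 'a)))"
    by (simp add: zass_e_def dp_vf_commutator[OF p] flip: a_def b_def)
  have z: "dp_vf m 0 = (0 :: (nat \<Rightarrow> 'a) \<Rightarrow> _)"
    by (simp add: dp_vf_def dp_mult_def fun_eq_iff)
  show ?thesis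
  proof (cases "0 < a + b \<and> a + b - 1 < CHAR('a) ^ m")
    case False
    then have "\<not> (-1 \<le> i + j \<and> i + j \<le> q - 2)" unfolding ab q_def by linarith
    moreover have "dp_mult m (dp_basis a) (dp_deriv m (dp_basis b)) =
      dp_mult m (dp_basis b) (dp_deriv m (dp_basis a :: nat \<Rightarrow> 'a))"
      using False aq by (auto simp: T add.commute)
    ultimately show ?thesis using comm z by auto
  next
    case True
    have cond: "-1 \<le> i + j \<and> i + j \<le> q - 2" using True unfolding ab q_def by linarith
    have n: "nat (i + j + 1) = a + b - 1" "nat (i + j + 1) = b + a - 1" by (auto simp: ab)
    have Cj: "C (i + j + 1) j = (if b > 0 then (a + b - 1) choose a else 0)"
      unfolding C_def n(1) using binomial_symmetric[of a "a + b - 1"]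
      by (auto simp: nab) (auto simp: ab)
    have Ci: "C (i + j + 1) i = (if a > 0 then (b + a - 1) choose b else 0)"
      unfolding C_def n(2) using binomial_symmetric[of b "b + a - 1"]
      by (auto simp: nab) (auto simp: ab)
    have e: "zass_e m (i + j) = dp_vf m (dp_basis (a + b - 1) :: nat \<Rightarrow> 'a)"
      by (simp add: zass_e_def n)
    have "dp_mult m (dp_basis a) (dp_deriv m (dp_basis b)) -
        dp_mult m (dp_basis b) (dp_deriv m (dp_basis a)) =
        fun_scale (*) (of_nat (C (i + j + 1) j) - of_nat (C (i + j + 1) i))
          (dp_basis (a + b - 1) :: nat \<Rightarrow> 'a)"
      unfolding Ci Cj using True aq
      by (auto simp: T fun_eq_iff fun_scale_def algebra_simps add.commute)
    then show ?thesis using cond by (simp only: comm e dp_vf_scale simp_thms if_True)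
  qed
qed

text \<open>\<open>(sV, act)\<close> is a copy of the module \<open>S(\<lambda>)\<close>, which is determined by these
  conditions up to isomorphism.\<close>

definition zass_simple ::
    "nat \<Rightarrow> 'a::field \<Rightarrow> ('a \<Rightarrow> 'v::ab_group_add \<Rightarrow> 'v) \<Rightarrow>
     (((nat \<Rightarrow> 'a) \<Rightarrow> (nat \<Rightarrow> 'a)) \<Rightarrow> 'v \<Rightarrow> 'v) \<Rightarrow> bool"
  where "zass_simple m lam sV act \<longleftrightarrow>
    simple_lie_module (zass m) zass_scale commutator sV act \<and>
    (\<exists>v. v \<noteq> 0 \<and>
      (act (zass_e m (-1)) ^^ (CHAR('a) ^ m)) v = 0 \<and>
      act (zass_e m 0) v = sV lam v \<and>
      (\<forall>i. 1 \<le> i \<and> i \<le> int (CHAR('a) ^ m) - 2 \<longrightarrow> act (zass_e m i) v = 0))"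

definition zass_H1 ::
    "nat \<Rightarrow> ('a::field \<Rightarrow> 'v::ab_group_add \<Rightarrow> 'v) \<Rightarrow>
     (((nat \<Rightarrow> 'a) \<Rightarrow> (nat \<Rightarrow> 'a)) \<Rightarrow> 'v \<Rightarrow> 'v) \<Rightarrow>
     ('a, (((nat \<Rightarrow> 'a) \<Rightarrow> (nat \<Rightarrow> 'a)) \<Rightarrow> 'v) set) module"
  where "zass_H1 m sV act = ce_H1 (zass m) zass_scale commutator sV act"

lemma zass_H1_vectorspace:
  fixes sV :: "'a::field \<Rightarrow> 'v::ab_group_add \<Rightarrow> 'v"
  assumes "prime CHAR('a)" and "zass_simple m lam sV act"
  shows "vectorspace class_ring (zass_H1 m sV act)"
proof -
  interpret lie_module "zass m" zass_scale commutator sV act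
    using assms(2) by (simp add: zass_simple_def simple_lie_module_def)
  show ?thesis unfolding zass_H1_def
    by (rule ce_H1_vectorspace[OF zass_subspace zass_bracket_closed[OF assms(1)]])
qed

text \<open>The one-dimensional trivial module is \<open>S(0)\<close>.\<close>

lemma zass_simple_trivial:
  assumes "CHAR('a) > 0"
  shows "zass_simple m (0 :: 'a::field) (*) (\<lambda>_ _. 0)"
proof -
  interpret vector_space "(*) :: 'a \<Rightarrow> 'a \<Rightarrow> 'a" by unfold_locales (auto simp: algebra_simps)
  have "simple_lie_module (zass m) zass_scale commutator ((*) :: 'a \<Rightarrow> 'a \<Rightarrow> 'a) (\<lambda>_ _. 0)"
  proof (intro simple_lie_module.intro lie_module.intro lie_module_axioms.intro
      simple_lie_module_axioms.intro vector_space_zass_scale vector_space_axioms)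
    show "\<exists>v::'a. v \<noteq> 0" by (rule exI[of _ 1]) simp
    fix U :: "'a set" assume U: "subspace U"
    have "x \<in> U" if "u \<in> U" "u \<noteq> 0" for x u
      using subspace_scale[OF U that(1), of "x / u"] that(2) by simp
    then show "U = {0} \<or> U = UNIV" using subspace_0[OF U] by blast
  qed auto
  moreover have "((\<lambda>_::'a. 0::'a) ^^ (CHAR('a) ^ m)) 1 = 0"
    using \<open>CHAR('a) > 0\<close> by (cases "CHAR('a) ^ m") auto
  ultimately show ?thesis unfolding zass_simple_def by (auto intro!: exI[of _ 1])
qed

end

theory Submission
  imports Defs "HOL-Algebra.Exponent"
begin

text \<open>
  Write \<open>q = p\<^sup>m\<close> and let \<open>V(\<mu>)\<close> be \<open>A(m)\<close> with \<open>f \<partial>\<close> acting by \<open>h \<mapsto> f h' + \<mu> f' h\<close>. Sending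
  \<open>x\<^sup>(\<^sup>q\<^sup>-\<^sup>1\<^sup>-\<^sup>k\<^sup>)\<close> to \<open>e\<^sub>-\<^sub>1\<^sup>k v\<close> is a surjection \<open>V(\<lambda> + 1) \<rightarrow> S(\<lambda>)\<close>. It is bijective unless \<open>\<lambda> = 0\<close>, where
  \<open>S(0)\<close> is trivial, or \<open>\<lambda> = -1\<close>, where its kernel is the constants and \<open>h \<mapsto> h'\<close> identifies
  \<open>S(-1)\<close> with the derivatives inside \<open>V(1)\<close>. So apart from \<open>\<lambda> = 0\<close>, where the cohomology vanishes
  because \<open>W(m)\<close> is perfect, it suffices to know the cocycles with values in \<open>V(\<mu>)\<close> for \<open>\<mu> \<noteq> 0\<close>.

  Modulo coboundaries such a cocycle vanishes on \<open>e\<^sub>-\<^sub>1\<close> and \<open>e\<^sub>0\<close>. It then commutes with \<open>\<partial>\<close>, hence is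
  determined by the constant terms of its values on the \<open>e\<^sub>k\<close>, and these vanish unless \<open>k = \<mu>\<close> in
  the field and \<open>e\<^sub>k\<close> is not a bracket of \<open>e\<^sub>i\<close>, \<open>e\<^sub>j\<close> with \<open>i, j \<ge> 1\<close>. The remaining degrees are \<open>1\<close>,
  \<open>2\<close> and \<open>p\<^sup>j - 1\<close>, realised by the cocycles \<open>\<partial>\<^sup>2\<close>, \<open>\<partial>\<^sup>3\<close> and the derivations \<open>\<partial>\<close> to the power \<open>p\<^sup>j\<close>.
  For \<open>S(-1)\<close> there is one more class, the coboundary in \<open>V(1)\<close> of \<open>x\<^sup>(\<^sup>q\<^sup>-\<^sup>1\<^sup>)\<close>, which is not a derivative.
\<close>

section \<open>The dimension of a quotient space\<close>

text \<open>The library measures dimension through sets of vectors, while cohomology classes come as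
  an indexed family. Independence of the family makes the indexing injective, so its image is a
  basis with \<open>card I\<close> elements.\<close>

lemma has_dimI:
  fixes W (structure)
  assumes W: "vectorspace (class_ring :: 'a::field ring) W"
    and finI: "finite I" and w: "\<And>i. i \<in> I \<Longrightarrow> w i \<in> carrier W"
    and spanning: "\<And>x. x \<in> carrier W \<Longrightarrow> \<exists>c. x = (\<Oplus>i\<in>I. c i \<odot> w i)"
    and indep: "\<And>c i. (\<Oplus>i\<in>I. c i \<odot> w i) = \<zero> \<Longrightarrow> i \<in> I \<Longrightarrow> c i = (0 :: 'a)"
  shows "has_dim W (card I)"
proof -
  interpret vectorspace "class_ring :: 'a ring" W by (rule W)
  have delta: "(\<Oplus>i\<in>I. (if i = j then 1 else 0 :: 'a) \<odot> w i) = w j" if "j \<in> I" for j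
  proof -
    have "(\<Oplus>i\<in>I. (if i = j then 1 else 0 :: 'a) \<odot> w i) = (\<Oplus>i\<in>I. if j = i then w i else \<zero>)"
      using w lmult_0 smult_one by (intro M.finsum_cong') (auto simp: class_ring_simps)
    then show ?thesis using that finI w by (simp add: M.finsum_singleton)
  qed
  have inj: "inj_on w I"
  proof (rule inj_onI, rule ccontr)
    fix i j assume ij: "i \<in> I" "j \<in> I" "w i = w j" "i \<noteq> j"
    \<comment> \<open>If \<open>w i = w j\<close>, the difference of the two unit coefficient
      families gives zero although its coefficient at \<open>i\<close> is 1.\<close>
    let ?d = "\<lambda>j i. if i = j then 1 else 0 :: 'a"
    have "(\<Oplus>k\<in>I. (?d i k - ?d j k) \<odot> w k) =
        (\<Oplus>k\<in>I. ?d i k \<odot> w k \<oplus> (- 1 \<odot> (?d j k \<odot> w k)))"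
      using w smult_l_distr[of "?d i _" "- ?d j _"] smult_assoc1[of "- 1" "?d j _"]
      by (intro M.finsum_cong') (auto simp: class_ring_simps)
    also have "\<dots> = w i \<oplus> - 1 \<odot> w j"
      using w ij by (subst M.finsum_addf) (auto simp: delta finsum_smult[symmetric] class_ring_simps)
    also have "\<dots> = (1 + - 1) \<odot> w j"
      using w[OF ij(2)] smult_l_distr[of 1 "- 1" "w j"] smult_one[of "w j"] ij
      by (simp add: class_ring_simps)
    also have "\<dots> = \<zero>" using w[OF ij(2)] lmult_0[of "w j"] by (simp add: class_ring_simps)
    finally show False using indep[of "\<lambda>k. ?d i k - ?d j k" i] ij by simp
  qed
  have lc: "lincomb a (w ` I) = (\<Oplus>i\<in>I. a (w i) \<odot> w i)" for a
    unfolding lincomb_def using w inj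
    by (subst M.finsum_reindex) (auto simp: class_ring_simps)
  have sub: "w ` I \<subseteq> carrier W" using w by auto
  have "lin_indpt (w ` I)"
    by (rule finite_lin_indpt2) (use finI sub indep in \<open>auto simp: lc class_ring_simps\<close>)
  moreover have "span (w ` I) = carrier W"
  proof
    show "span (w ` I) \<subseteq> carrier W" using sub by (rule span_is_subset2)
    show "carrier W \<subseteq> span (w ` I)"
    proof
      fix x assume "x \<in> carrier W"
      then obtain c where c: "x = (\<Oplus>i\<in>I. c i \<odot> w i)" using spanning by blast
      have "lincomb (c \<circ> the_inv_into I w) (w ` I) = x"
        unfolding lc c using w inj
        by (intro M.finsum_cong') (auto simp: class_ring_simps the_inv_into_f_f)
      then show "x \<in> span (w ` I)"
        using finI sub by (auto simp: finite_span class_ring_simps)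
    qed
  qed
  ultimately have "basis (w ` I)" using sub by (simp add: basis_def)
  then have "dim = card I" "fin_dim"
    using dim_basis[of "w ` I"] finI inj sub
    by (auto simp: card_image fin_dim_def basis_def)
  then show ?thesis using W by (simp add: has_dim_def)
qed

text \<open>Reduces counting in the quotient to representatives in \<open>V\<close>: the
  \<open>v i\<close> form a basis modulo \<open>U\<close>, and no coset appears in the
  hypotheses.\<close>

lemma has_dim_quotient_spaceI:
  fixes V (structure)
  assumes sub: "subspace (class_ring :: 'a::field ring) U V"
    and finI: "finite I" and v: "\<And>i. i \<in> I \<Longrightarrow> v i \<in> carrier V"
    and spanning: "\<And>x. x \<in> carrier V \<Longrightarrow> \<exists>c. \<exists>u\<in>U. x = u \<oplus> (\<Oplus>i\<in>I. c i \<odot> v i)"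
    and indep: "\<And>c i. (\<Oplus>i\<in>I. c i \<odot> v i) \<in> U \<Longrightarrow> i \<in> I \<Longrightarrow> c i = (0 :: 'a)"
  shows "has_dim (quotient_space V U) (card I)"
proof -
  let ?Q = "quotient_space V U"
  interpret V: vectorspace "class_ring :: 'a ring" V using sub by (simp add: subspace_def)
  have sm: "submodule (class_ring :: 'a ring) U V" using sub by (simp add: subspace_def)
  have "subgroup U (add_monoid V)"
  proof (rule V.add.subgroupI, goal_cases)
    case (3 a)
    have "- 1 \<odot> a \<in> U"
      using sm 3 LinearCombinations.submodule.smult_closed[of class_ring U V "- 1" a]
      by (simp add: class_ring_simps)
    moreover have "a \<in> carrier V" using sm 3 by (auto dest: LinearCombinations.submodule.subset)
    ultimately show ?case using V.smult_minus_1[of a] by (simp add: class_ring_simps)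
  qed (use sm in \<open>auto simp: LinearCombinations.submodule_def\<close>)
  then interpret U: abelian_subgroup U V
    using V.a_comm_group by (intro abelian_subgroupI2)
  interpret Q: vectorspace "class_ring :: 'a ring" ?Q
    by (rule quotient_space_vectorspace[OF sub])
  have Uc: "U \<subseteq> carrier V" using U.a_subset .
  have car: "carrier ?Q = (\<lambda>x. U +> x) ` carrier V"
    by (auto simp: quotient_space_def A_RCOSETS_def')
  have add: "(U +> x) \<oplus>\<^bsub>?Q\<^esub> (U +> y) = U +> (x \<oplus> y)"
    if "x \<in> carrier V" "y \<in> carrier V" for x y
    using that by (simp add: quotient_space_def U.a_rcos_sum)
  have zero: "\<zero>\<^bsub>?Q\<^esub> = U" by (simp add: quotient_space_def)
  have eq0: "U +> x = U \<longleftrightarrow> x \<in> U" if "x \<in> carrier V" for x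
    using U.a_rcos_self[OF that] U.a_rcos_const by auto
  \<comment> \<open>The quotient is known to be a vector space, so the scaled set is some coset; it
    is identified by the single element \<open>c \<odot> x\<close> that it contains.\<close>
  have smult: "c \<odot>\<^bsub>?Q\<^esub> (U +> x) = U +> (c \<odot> x)" if x: "x \<in> carrier V" for c x
  proof -
    have "c \<odot>\<^bsub>?Q\<^esub> (U +> x) \<in> carrier ?Q"
      using x by (intro Q.smult_closed) (auto simp: car class_ring_simps)
    then obtain y where y: "y \<in> carrier V" "c \<odot>\<^bsub>?Q\<^esub> (U +> x) = U +> y" by (auto simp: car)
    have "c \<odot> x = \<zero> \<oplus> c \<odot> x" using x by (simp add: class_ring_simps)
    then have "c \<odot> x \<in> set_add V U ((\<lambda>x. c \<odot> x) ` (U +> x))"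
      using U.zero_closed U.a_rcos_self[OF x] unfolding set_add_def' by blast
    then have "c \<odot> x \<in> U +> y" using y by (simp add: quotient_space_def)
    then show ?thesis using y(2) U.a_repr_independence'[OF _ y(1)] by simp
  qed
  have comb: "(\<Oplus>\<^bsub>?Q\<^esub>i\<in>J. c i \<odot>\<^bsub>?Q\<^esub> (U +> v i)) = U +> (\<Oplus>i\<in>J. c i \<odot> v i)"
    if "J \<subseteq> I" for J c
    using finite_subset[OF that finI] that
  proof (induction J rule: finite_induct)
    case empty
    then show ?case using eq0[of \<zero>] U.zero_closed by (simp add: zero)
  next
    case (insert j J)
    have "(\<Oplus>\<^bsub>?Q\<^esub>i\<in>insert j J. c i \<odot>\<^bsub>?Q\<^esub> (U +> v i)) =
        c j \<odot>\<^bsub>?Q\<^esub> (U +> v j) \<oplus>\<^bsub>?Q\<^esub> (\<Oplus>\<^bsub>?Q\<^esub>i\<in>J. c i \<odot>\<^bsub>?Q\<^esub> (U +> v i))"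
      using insert v by (intro Q.M.finsum_insert) (auto simp: car smult class_ring_simps)
    also have "\<dots> = U +> (c j \<odot> v j \<oplus> (\<Oplus>i\<in>J. c i \<odot> v i))"
    proof -
      have "c j \<odot> v j \<in> carrier V" "(\<Oplus>i\<in>J. c i \<odot> v i) \<in> carrier V"
        using insert v by (auto simp: class_ring_simps intro!: V.M.finsum_closed)
      then show ?thesis using insert v by (simp add: smult add)
    qed
    also have "c j \<odot> v j \<oplus> (\<Oplus>i\<in>J. c i \<odot> v i) = (\<Oplus>i\<in>insert j J. c i \<odot> v i)"
      using insert v by (intro V.M.finsum_insert[symmetric]) (auto simp: class_ring_simps)
    finally show ?case .
  qed
  have closed: "(\<Oplus>i\<in>I. c i \<odot> v i) \<in> carrier V" for c
    using v by (auto simp: class_ring_simps intro!: V.M.finsum_closed)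
  show ?thesis
  proof (rule has_dimI[where w = "\<lambda>i. U +> v i"])
    fix X assume "X \<in> carrier ?Q"
    then obtain x where x: "x \<in> carrier V" "X = U +> x" by (auto simp: car)
    obtain c u where cu: "u \<in> U" "x = u \<oplus> (\<Oplus>i\<in>I. c i \<odot> v i)"
      using spanning[OF x(1)] by (elim exE bexE) (rule that)
    then have "x \<in> U +> (\<Oplus>i\<in>I. c i \<odot> v i)" by (auto simp: a_r_coset_def')
    then have "X = U +> (\<Oplus>i\<in>I. c i \<odot> v i)"
      using x(2) U.a_repr_independence'[OF _ closed] by simp
    then show "\<exists>c. X = (\<Oplus>\<^bsub>?Q\<^esub>i\<in>I. c i \<odot>\<^bsub>?Q\<^esub> (U +> v i))" by (auto simp: comb)
  qed (use finI v indep closed in \<open>auto simp: Q.vectorspace_axioms car comb zero eq0\<close>)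
qed

section \<open>The divided power algebra\<close>

lemma two_nonzero:
  assumes "CHAR('a::field) > 2"
  shows "(2 :: 'a) \<noteq> 0"
proof -
  have "(of_nat 2 :: 'a) \<noteq> 0"
    unfolding of_nat_eq_0_iff_char_dvd using assms by (auto dest: dvd_imp_le)
  then show ?thesis by simp
qed

lemma dp_carrier_zero: "0 \<in> dp_carrier m"
  by (simp add: dp_carrier_def)

lemma dp_carrier_add: "f \<in> dp_carrier m \<Longrightarrow> g \<in> dp_carrier m \<Longrightarrow> f + g \<in> dp_carrier m"
  by (simp add: dp_carrier_def)

lemma dp_carrier_diff: "f \<in> dp_carrier m \<Longrightarrow> g \<in> dp_carrier m \<Longrightarrow> f - g \<in> dp_carrier m"
  by (simp add: dp_carrier_def)

lemma dp_carrier_scale: "f \<in> dp_carrier m \<Longrightarrow> fun_scale (*) c f \<in> dp_carrier m"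
  by (simp add: dp_carrier_def fun_scale_def)

lemma dp_carrier_basis: "a < CHAR('a) ^ m \<Longrightarrow> (dp_basis a :: nat \<Rightarrow> 'a::field) \<in> dp_carrier m"
  by (auto simp: dp_carrier_def dp_basis_def)

lemma dp_carrier_mult: "dp_mult m f g \<in> dp_carrier m"
  by (simp add: dp_carrier_def dp_mult_def)

lemma dp_carrier_deriv: "dp_deriv m f \<in> dp_carrier m"
  by (simp add: dp_carrier_def dp_deriv_def)

lemma dp_carrier_funpow_deriv: "f \<in> dp_carrier m \<Longrightarrow> (dp_deriv m ^^ n) f \<in> dp_carrier m"
  by (induction n) (auto simp: dp_carrier_deriv)

lemmas dp_carrier_intros = dp_carrier_zero dp_carrier_add dp_carrier_diff dp_carrier_scale
  dp_carrier_basis dp_carrier_mult dp_carrier_deriv dp_carrier_funpow_deriv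

lemma dp_deriv_add: "dp_deriv m (f + g) = dp_deriv m f + dp_deriv m g"
  by (simp add: dp_deriv_def fun_eq_iff)

lemma dp_deriv_diff: "dp_deriv m (f - g) = dp_deriv m f - dp_deriv m g"
  by (simp add: dp_deriv_def fun_eq_iff)

lemma dp_deriv_scale: "dp_deriv m (fun_scale (*) c f) = fun_scale (*) c (dp_deriv m f)"
  by (simp add: dp_deriv_def fun_scale_def fun_eq_iff)

lemma dp_deriv_zero: "dp_deriv m 0 = 0"
  by (simp add: dp_deriv_def fun_eq_iff)

text \<open>On \<open>A(m)\<close> the cut-off in \<open>dp_deriv\<close> only replaces coefficients
  that vanish anyway, so the derivation is a plain shift.\<close>

lemma dp_deriv_apply: "f \<in> dp_carrier m \<Longrightarrow> dp_deriv m f n = f (Suc n)"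
  by (auto simp: dp_deriv_def dp_carrier_def)

text \<open>With \<open>n = 0\<close>, each coefficient is the constant term of an iterated
  derivative; this is how a cocycle commuting with the derivation is recovered from constant
  terms.\<close>

lemma funpow_dp_deriv_apply: "f \<in> dp_carrier m \<Longrightarrow> (dp_deriv m ^^ k) f n = f (n + k)"
  by (induction k arbitrary: n) (auto simp: dp_deriv_apply dp_carrier_funpow_deriv)

lemma funpow_dp_deriv_add:
  "(dp_deriv m ^^ k) (f + g) = (dp_deriv m ^^ k) f + (dp_deriv m ^^ k) g"
  by (induction k) (simp_all only: funpow.simps id_apply comp_apply dp_deriv_add)

lemma funpow_dp_deriv_diff:
  "(dp_deriv m ^^ k) (f - g) = (dp_deriv m ^^ k) f - (dp_deriv m ^^ k) g"
  by (induction k) (simp_all only: funpow.simps id_apply comp_apply dp_deriv_diff)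

lemma funpow_dp_deriv_scale:
  "(dp_deriv m ^^ k) (fun_scale (*) c f) = fun_scale (*) c ((dp_deriv m ^^ k) f)"
  by (induction k) (auto simp: dp_deriv_scale)

lemma dp_mult_diff_right: "dp_mult m h (f - g) = dp_mult m h f - dp_mult m h g"
  by (simp add: dp_mult_def fun_eq_iff algebra_simps sum_subtractf)

lemma dp_mult_scale_left: "dp_mult m (fun_scale (*) c f) g = fun_scale (*) c (dp_mult m f g)"
  by (simp add: dp_mult_def fun_scale_def fun_eq_iff sum_distrib_left mult_ac)

lemma dp_mult_scale_right: "dp_mult m f (fun_scale (*) c g) = fun_scale (*) c (dp_mult m f g)"
  by (simp add: dp_mult_def fun_scale_def fun_eq_iff sum_distrib_left mult_ac)

lemma dp_mult_zero_left: "dp_mult m 0 g = 0"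
  by (simp add: dp_mult_def fun_eq_iff)

lemma dp_mult_zero_right: "dp_mult m g 0 = 0"
  by (simp add: dp_mult_def fun_eq_iff)

lemma dp_mult_left_commute: "dp_mult m f (dp_mult m g h) = dp_mult m g (dp_mult m f h)"
  using dp_mult_assoc[of m f g h] dp_mult_assoc[of m g f h] dp_mult_commute[of m f g] by metis

lemma dp_mult_basis_apply:
  "n < CHAR('a) ^ m \<Longrightarrow> dp_mult m (dp_basis a) (g :: nat \<Rightarrow> 'a::field) n =
    (if a \<le> n then of_nat (n choose a) * g (n - a) else 0)"
proof -
  assume n: "n < CHAR('a) ^ m"
  have "(\<Sum>k\<le>n. of_nat (n choose k) * dp_basis a k * g (n - k)) =
      (\<Sum>k\<in>{a} \<inter> {..n}. of_nat (n choose k) * g (n - k))"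
    by (rule sum.mono_neutral_cong_right) (auto simp: dp_basis_def)
  then show ?thesis using n by (simp add: dp_mult_def)
qed

lemma dp_mult_one: "g \<in> dp_carrier m \<Longrightarrow> dp_mult m (dp_basis 0) g = g"
proof
  fix n assume g: "g \<in> dp_carrier m"
  show "dp_mult m (dp_basis 0) g n = g n"
  proof (cases "n < CHAR('a) ^ m")
    case True
    then show ?thesis by (simp add: dp_mult_basis_apply)
  next
    case False
    then show ?thesis using g by (simp add: dp_mult_def dp_carrier_def)
  qed
qed

lemma dp_mult_apply_0: "CHAR('a) > 0 \<Longrightarrow> dp_mult m f g 0 = f 0 * (g 0 :: 'a::field)"
  by (simp add: dp_mult_def)

section \<open>Higher Leibniz rules\<close>

lemma funpow_dp_deriv_mult:
  fixes f g :: "nat \<Rightarrow> 'a::field"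
  assumes p: "prime CHAR('a)"
  shows "(dp_deriv m ^^ n) (dp_mult m f g) i =
    (\<Sum>k\<le>n. of_nat (n choose k) * dp_mult m ((dp_deriv m ^^ k) f) ((dp_deriv m ^^ (n - k)) g) i)"
proof (induction n arbitrary: f g)
  case 0
  show ?case by simp
next
  case (Suc n)
  define T where "T k = dp_mult m ((dp_deriv m ^^ k) f) ((dp_deriv m ^^ (Suc n - k)) g) i" for k
  have "(dp_deriv m ^^ Suc n) (dp_mult m f g) i =
      (dp_deriv m ^^ n) (dp_mult m (dp_deriv m f) g) i +
      (dp_deriv m ^^ n) (dp_mult m f (dp_deriv m g)) i"
    by (simp add: funpow_Suc_right dp_deriv_mult[OF p] funpow_dp_deriv_add del: funpow.simps)
  also have "(dp_deriv m ^^ n) (dp_mult m (dp_deriv m f) g) i =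
      (\<Sum>k\<le>n. of_nat (n choose k) * T (Suc k))"
    unfolding Suc T_def by (simp add: funpow_Suc_right del: funpow.simps)
  also have "(dp_deriv m ^^ n) (dp_mult m f (dp_deriv m g)) i = (\<Sum>k\<le>n. of_nat (n choose k) * T k)"
    unfolding Suc T_def
    by (intro sum.cong refl) (simp add: Suc_diff_le funpow_Suc_right del: funpow.simps)
  \<comment> \<open>The added term has coefficient \<open>n choose Suc n = 0\<close>; with it,
    shifting the index allows Pascal's rule to merge the two sums.\<close>
  also have "\<dots> = (\<Sum>k\<le>Suc n. of_nat (n choose k) * T k)"
    by (simp add: binomial_eq_0)
  also have "\<dots> = T 0 + (\<Sum>k\<le>n. of_nat (n choose Suc k) * T (Suc k))"
    by (subst sum.atMost_Suc_shift) simp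
  also have "(\<Sum>k\<le>n. of_nat (n choose k) * T (Suc k)) + \<dots> =
      T 0 + (\<Sum>k\<le>n. of_nat (Suc n choose Suc k) * T (Suc k))"
    by (simp add: sum.distrib algebra_simps)
  also have "\<dots> = (\<Sum>k\<le>Suc n. of_nat (Suc n choose k) * T k)"
    by (subst sum.atMost_Suc_shift) simp
  finally show ?case unfolding T_def .
qed

text \<open>By absorption, \<open>p^j\<close> divides \<open>k\<close> times the binomial; were the
  binomial prime to \<open>p\<close>, then \<open>p^j\<close> would divide the smaller positive
  number \<open>k\<close>.\<close>

lemma prime_dvd_prime_power_choose:
  fixes p k :: nat
  assumes "prime p" "0 < k" "k < p ^ j"
  shows "p dvd (p ^ j choose k)"
proof (rule ccontr)
  assume "\<not> p dvd (p ^ j choose k)"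
  then have "coprime (p ^ j) (p ^ j choose k)"
    using assms by (simp add: prime_imp_coprime)
  moreover have "p ^ j dvd k * (p ^ j choose k)"
    using assms by (simp add: times_binomial_minus1_eq)
  ultimately have "p ^ j dvd k" by (simp add: coprime_dvd_mult_left_iff)
  then show False using assms by (auto dest: dvd_imp_le)
qed

text \<open>The inner terms of the Leibniz sum carry binomials divisible by \<open>p\<close>, so
  this power of the derivation is again a derivation of \<open>A(m)\<close>.\<close>

lemma funpow_prime_power_dp_deriv_mult:
  fixes f g :: "nat \<Rightarrow> 'a::field"
  assumes p: "prime CHAR('a)" and n: "n = CHAR('a) ^ j"
  shows "(dp_deriv m ^^ n) (dp_mult m f g) =
    dp_mult m ((dp_deriv m ^^ n) f) g + dp_mult m f ((dp_deriv m ^^ n) g)"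
proof
  fix i
  have n0: "0 < n" using p n by (simp add: prime_gt_0_nat)
  have "(dp_deriv m ^^ n) (dp_mult m f g) i =
    (\<Sum>k\<in>{0, n}. of_nat (n choose k) * dp_mult m ((dp_deriv m ^^ k) f) ((dp_deriv m ^^ (n - k)) g) i)"
    unfolding funpow_dp_deriv_mult[OF p]
    by (rule sum.mono_neutral_right)
      (auto simp: of_nat_eq_0_iff_char_dvd n intro!: prime_dvd_prime_power_choose p)
  then show "(dp_deriv m ^^ n) (dp_mult m f g) i =
    (dp_mult m ((dp_deriv m ^^ n) f) g + dp_mult m f ((dp_deriv m ^^ n) g)) i"
    using n0 by (simp add: add.commute)
qed

section \<open>Tensor densities and their cocycles\<close>

text \<open>The commutator of \<open>W(m)\<close> carried over to \<open>A(m)\<close>, a vector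
  field being represented by its coefficient function.\<close>

definition dp_bracket :: "nat \<Rightarrow> (nat \<Rightarrow> 'a::field) \<Rightarrow> (nat \<Rightarrow> 'a) \<Rightarrow> (nat \<Rightarrow> 'a)"
  where "dp_bracket m f g = dp_mult m f (dp_deriv m g) - dp_mult m g (dp_deriv m f)"

text \<open>The action of \<open>f \<partial>\<close> on the module of tensor densities of weight \<open>\<mu>\<close>.\<close>

definition density :: "nat \<Rightarrow> 'a::field \<Rightarrow> (nat \<Rightarrow> 'a) \<Rightarrow> (nat \<Rightarrow> 'a) \<Rightarrow> (nat \<Rightarrow> 'a)"
  where "density m \<mu> f h = dp_mult m f (dp_deriv m h) + fun_scale (*) \<mu> (dp_mult m (dp_deriv m f) h)"

lemma dp_carrier_bracket: "dp_bracket m f g \<in> dp_carrier m"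
  by (simp add: dp_bracket_def dp_carrier_intros)

lemma dp_carrier_density: "density m \<mu> f h \<in> dp_carrier m"
  by (simp add: density_def dp_carrier_intros)

lemma density_add_left: "density m \<mu> (f + g) h = density m \<mu> f h + density m \<mu> g h"
  by (simp add: density_def dp_deriv_add dp_mult_add_left fun_eq_iff fun_scale_def algebra_simps)

lemma density_add_right: "density m \<mu> f (g + h) = density m \<mu> f g + density m \<mu> f h"
  by (simp add: density_def dp_deriv_add dp_mult_add_right fun_eq_iff fun_scale_def algebra_simps)

lemma density_diff_right: "density m \<mu> f (g - h) = density m \<mu> f g - density m \<mu> f h"
  by (simp add: density_def dp_deriv_diff dp_mult_diff_right fun_eq_iff fun_scale_def algebra_simps)

lemma density_scale_left: "density m \<mu> (fun_scale (*) c f) h = fun_scale (*) c (density m \<mu> f h)"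
  by (simp add: density_def dp_deriv_scale dp_mult_scale_left fun_eq_iff) (simp add: fun_scale_def algebra_simps)

lemma density_scale_right: "density m \<mu> f (fun_scale (*) c h) = fun_scale (*) c (density m \<mu> f h)"
  by (simp add: density_def dp_deriv_scale dp_mult_scale_right fun_eq_iff) (simp add: fun_scale_def algebra_simps)

lemma density_zero_right: "density m \<mu> f 0 = 0"
  by (simp add: density_def dp_deriv_zero dp_mult_zero_right fun_scale_def fun_eq_iff)

lemma density_one_left: "density m \<mu> (dp_basis 0) h = dp_deriv m h"
  by (simp add: density_def dp_mult_one dp_carrier_deriv dp_deriv_basis_0 dp_mult_zero_left)
    (simp add: fun_scale_def fun_eq_iff)

lemma density_one_right: "density m \<mu> f (dp_basis 0) = fun_scale (*) \<mu> (dp_deriv m f)"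
  using dp_mult_commute[of m "dp_deriv m f" "dp_basis 0"]
  by (simp add: density_def dp_mult_one dp_carrier_deriv dp_deriv_basis_0 dp_mult_zero_right)

lemma density_apply_0:
  fixes f h :: "nat \<Rightarrow> 'a::field"
  assumes "CHAR('a) > 0" "f \<in> dp_carrier m" "h \<in> dp_carrier m"
  shows "density m \<mu> f h 0 = f 0 * h 1 + \<mu> * f 1 * h 0"
  using assms by (simp add: density_def dp_mult_apply_0 fun_scale_def dp_deriv_apply)

lemma dp_deriv_x: "1 < CHAR('a) ^ m \<Longrightarrow> dp_deriv m (dp_basis 1 :: nat \<Rightarrow> 'a::field) = dp_basis 0"
  using dp_deriv_basis_Suc[of 0 m] by simp

text \<open>\<open>dp_basis 1\<close> represents \<open>e\<^sub>0\<close>; its diagonal action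
  supplies the weight arguments below.\<close>

lemma density_x_apply:
  fixes h :: "nat \<Rightarrow> 'a::field"
  assumes "1 < CHAR('a) ^ m" "h \<in> dp_carrier m" "n < CHAR('a) ^ m"
  shows "density m \<mu> (dp_basis 1) h n = (of_nat n + \<mu>) * h n"
  using assms
  by (cases n) (auto simp: density_def dp_deriv_basis_Suc dp_mult_one dp_mult_basis_apply fun_scale_def
    dp_deriv_apply algebra_simps)

lemma dp_deriv_bracket:
  fixes f g :: "nat \<Rightarrow> 'a::field"
  assumes p: "prime CHAR('a)"
  shows "dp_deriv m (dp_bracket m f g) =
    dp_mult m f (dp_deriv m (dp_deriv m g)) - dp_mult m g (dp_deriv m (dp_deriv m f))"
  by (simp add: dp_bracket_def dp_deriv_diff dp_deriv_mult[OF p] dp_mult_commute[of m "dp_deriv m f"])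

text \<open>The module law for densities: after expansion by the product rule, all terms symmetric
  in \<open>f\<close> and \<open>g\<close> cancel, among them those with second derivatives of
  \<open>h\<close>.\<close>

lemma density_bracket:
  fixes f g h :: "nat \<Rightarrow> 'a::field"
  assumes p: "prime CHAR('a)"
  shows "density m \<mu> (dp_bracket m f g) h =
    density m \<mu> f (density m \<mu> g h) - density m \<mu> g (density m \<mu> f h)"
  unfolding density_def dp_deriv_bracket[OF p]
  unfolding dp_bracket_def
  by (simp only: dp_deriv_add dp_deriv_scale dp_deriv_mult[OF p] dp_mult_add_left dp_mult_add_right
      dp_mult_diff_left dp_mult_diff_right dp_mult_scale_left dp_mult_scale_right dp_mult_assoc dp_mult_commute dp_mult_left_commute)
    (simp add: fun_scale_def fun_eq_iff algebra_simps)

text \<open>The derivation intertwines weight 0 with weight 1; through it \<open>S(-1)\<close> is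
  realised inside the densities of weight 1.\<close>

lemma dp_deriv_density_1:
  fixes f h :: "nat \<Rightarrow> 'a::field"
  assumes p: "prime CHAR('a)"
  shows "density m 1 f (dp_deriv m h) = dp_deriv m (density m 0 f h)"
  by (simp add: density_def dp_deriv_add dp_deriv_scale dp_deriv_mult[OF p])
    (simp add: fun_scale_def fun_eq_iff)

text \<open>In weight 1 the action produces only total derivatives. Both exceptional cases,
  \<open>lam = -1\<close> and \<open>lam = 0\<close>, rest on this.\<close>

lemma density_1_eq_deriv:
  fixes f h :: "nat \<Rightarrow> 'a::field"
  assumes p: "prime CHAR('a)"
  shows "density m 1 f h = dp_deriv m (dp_mult m f h)"
  by (simp add: density_def dp_deriv_mult[OF p]) (simp add: fun_scale_def fun_eq_iff)

section \<open>Cocycles with values in tensor densities\<close>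

definition density_cocycle :: "nat \<Rightarrow> 'a::field \<Rightarrow> ((nat \<Rightarrow> 'a) \<Rightarrow> (nat \<Rightarrow> 'a)) \<Rightarrow> bool"
  where "density_cocycle m \<mu> \<Phi> \<longleftrightarrow>
    (\<forall>f\<in>dp_carrier m. \<Phi> f \<in> dp_carrier m) \<and>
    (\<forall>f\<in>dp_carrier m. \<forall>g\<in>dp_carrier m. \<Phi> (f + g) = \<Phi> f + \<Phi> g) \<and>
    (\<forall>c. \<forall>f\<in>dp_carrier m. \<Phi> (fun_scale (*) c f) = fun_scale (*) c (\<Phi> f)) \<and>
    (\<forall>f\<in>dp_carrier m. \<forall>g\<in>dp_carrier m.
      \<Phi> (dp_bracket m f g) = density m \<mu> f (\<Phi> g) - density m \<mu> g (\<Phi> f))"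

lemma density_cocycle_coboundary:
  fixes h :: "nat \<Rightarrow> 'a::field"
  assumes p: "prime CHAR('a)"
  shows "density_cocycle m \<mu> (\<lambda>f. density m \<mu> f h)"
  by (simp add: density_cocycle_def dp_carrier_density density_add_left density_scale_left density_bracket[OF p])

lemma density_cocycle_diff:
  "density_cocycle m \<mu> \<Phi> \<Longrightarrow> density_cocycle m \<mu> \<Psi> \<Longrightarrow> density_cocycle m \<mu> (\<lambda>f. \<Phi> f - \<Psi> f)"
  unfolding density_cocycle_def
  by (auto simp: dp_carrier_intros density_diff_right algebra_simps) (auto simp: fun_eq_iff fun_scale_def algebra_simps)

text \<open>The second derivative of the bracket is the derivative of \<open>f g'' - g f''\<close>,
  and in weight 1 the action of \<open>f\<close> on \<open>h\<close> is the derivative of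
  \<open>f h\<close>.\<close>

lemma density_cocycle_deriv2:
  assumes p: "prime CHAR('a::field)"
  shows "density_cocycle m (1 :: 'a) (dp_deriv m ^^ 2)"
  unfolding density_cocycle_def
  by (simp add: numeral_2_eq_2 dp_carrier_intros dp_deriv_add dp_deriv_scale)
    (simp add: density_1_eq_deriv[OF p] dp_deriv_bracket[OF p] dp_deriv_diff)

text \<open>Differentiating \<open>f g'' - g f''\<close> twice, the terms \<open>f'' g''\<close>
  cancel, and the factor 2 in front of \<open>f' g'''\<close> is the weight.\<close>

lemma density_cocycle_deriv3:
  assumes p: "prime CHAR('a::field)"
  shows "density_cocycle m (2 :: 'a) (dp_deriv m ^^ 3)"
  unfolding density_cocycle_def
proof (intro conjI ballI allI)
  fix f g :: "nat \<Rightarrow> 'a"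
  show "(dp_deriv m ^^ 3) (dp_bracket m f g) =
      density m 2 f ((dp_deriv m ^^ 3) g) - density m 2 g ((dp_deriv m ^^ 3) f)"
    by (simp only: numeral_3_eq_3 funpow.simps id_def comp_def density_def dp_deriv_bracket[OF p] dp_deriv_diff dp_deriv_add
        dp_deriv_mult[OF p] dp_mult_commute) (simp add: fun_eq_iff fun_scale_def)
qed (auto intro!: dp_carrier_intros simp: funpow_dp_deriv_add funpow_dp_deriv_scale)

text \<open>Weight -1 is the adjoint module, and a derivation of \<open>A(m)\<close> that commutes
  with \<open>dp_deriv m\<close> induces a derivation of the bracket.\<close>

lemma density_cocycle_prime_power_deriv:
  assumes p: "prime CHAR('a::field)"
  shows "density_cocycle m (- 1 :: 'a) (dp_deriv m ^^ (CHAR('a) ^ j))"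
  unfolding density_cocycle_def
proof (intro conjI ballI allI)
  fix f g :: "nat \<Rightarrow> 'a"
  let ?D = "dp_deriv m ^^ (CHAR('a) ^ j)"
  have c: "?D (dp_deriv m h) = dp_deriv m (?D h)" for h :: "nat \<Rightarrow> 'a"
    by (metis funpow_swap1)
  show "?D (dp_bracket m f g) = density m (- 1) f (?D g) - density m (- 1) g (?D f)"
    unfolding dp_bracket_def density_def funpow_dp_deriv_diff
      funpow_prime_power_dp_deriv_mult[OF p refl] c
    by (simp add: fun_eq_iff fun_scale_def dp_mult_commute[of m _ "?D f"] dp_mult_commute[of m _ "?D g"])
qed (auto intro!: dp_carrier_intros simp: funpow_dp_deriv_add funpow_dp_deriv_scale)

lemma dp_basis_apply: "dp_basis a n = (if n = a then 1 else 0)"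
  by (simp add: dp_basis_def)

lemma density_cocycleD:
  assumes "density_cocycle m \<mu> \<Phi>" and "f \<in> dp_carrier m"
  shows "\<Phi> f \<in> dp_carrier m" and "\<Phi> (fun_scale (*) c f) = fun_scale (*) c (\<Phi> f)"
    and "g \<in> dp_carrier m \<Longrightarrow> \<Phi> (f + g) = \<Phi> f + \<Phi> g"
    and "g \<in> dp_carrier m \<Longrightarrow>
      \<Phi> (dp_bracket m f g) = density m \<mu> f (\<Phi> g) - density m \<mu> g (\<Phi> f)"
  using assms unfolding density_cocycle_def by blast+

text \<open>Linearity is assumed on \<open>A(m)\<close> only, so \<open>f\<close> is built up from
  its truncations, which all stay there.\<close>

lemma dp_linear_expansion:
  fixes \<Phi> :: "(nat \<Rightarrow> 'a::field) \<Rightarrow> 'v::ab_group_add"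
  assumes "vector_space sV"
    and add: "\<And>f g. f \<in> dp_carrier m \<Longrightarrow> g \<in> dp_carrier m \<Longrightarrow> \<Phi> (f + g) = \<Phi> f + \<Phi> g"
    and scale: "\<And>c f. f \<in> dp_carrier m \<Longrightarrow> \<Phi> (fun_scale (*) c f) = sV c (\<Phi> f)"
    and f: "f \<in> dp_carrier m"
  shows "\<Phi> f = (\<Sum>k<CHAR('a) ^ m. sV (f k) (\<Phi> (dp_basis k)))"
proof -
  interpret vector_space sV by fact
  let ?q = "CHAR('a) ^ m"
  have trunc: "\<Phi> (\<lambda>n. if n < N then f n else 0) = (\<Sum>k<N. sV (f k) (\<Phi> (dp_basis k)))"
    if "N \<le> ?q" for N
    using that
  proof (induction N)
    case 0
    have "\<Phi> (\<lambda>n. 0) = sV 0 (\<Phi> 0)"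
      using scale[OF dp_carrier_zero, of 0] by (simp only: fun_scale_def mult_zero_left)
    then show ?case by simp
  next
    case (Suc N)
    let ?t = "\<lambda>n. if n < N then f n else 0"
    have t: "?t \<in> dp_carrier m" using f Suc.prems by (auto simp: dp_carrier_def)
    have b: "(dp_basis N :: nat \<Rightarrow> 'a) \<in> dp_carrier m" using Suc.prems by (simp add: dp_carrier_basis)
    have "(\<lambda>n. if n < Suc N then f n else 0) = ?t + fun_scale (*) (f N) (dp_basis N)"
      by (auto simp: fun_eq_iff fun_scale_def dp_basis_apply less_Suc_eq)
    then have "\<Phi> (\<lambda>n. if n < Suc N then f n else 0) = \<Phi> ?t + sV (f N) (\<Phi> (dp_basis N))"
      using add[OF t dp_carrier_scale[OF b]] scale[OF b] by simp
    then show ?case using Suc by simp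
  qed
  have "(\<lambda>n. if n < ?q then f n else 0) = f" using f by (auto simp: dp_carrier_def fun_eq_iff)
  then show ?thesis using trunc[of ?q] by simp
qed

lemma vector_space_times: "vector_space ((*) :: 'a::field \<Rightarrow> 'a \<Rightarrow> 'a)"
  by unfold_locales (auto simp: algebra_simps)

text \<open>The degrees \<open>k\<close> of weight \<open>\<mu>\<close> for which \<open>e\<^sub>k\<close> is not in \<open>[W\<^sub>\<ge>\<^sub>1, W\<^sub>\<ge>\<^sub>1]\<close>, where
  \<open>W\<^sub>\<ge>\<^sub>1\<close> is spanned by the \<open>e\<^sub>i\<close> with \<open>i \<ge> 1\<close>.\<close>

definition generator_degrees :: "nat \<Rightarrow> 'a::field \<Rightarrow> nat set"
  where "generator_degrees m \<mu> = {k. 1 \<le> k \<and> Suc k < CHAR('a) ^ m \<and> of_nat k = \<mu> \<and>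
    (k = 1 \<or> k = 2 \<or> (\<exists>j\<ge>1. j < m \<and> k = CHAR('a) ^ j - 1))}"

lemma finite_generator_degrees: "finite (generator_degrees m (\<mu> :: 'a::field))"
  by (rule finite_subset[of _ "{..<CHAR('a) ^ m}"]) (auto simp: generator_degrees_def)

section \<open>Structure constants modulo \<open>p\<close>\<close>

lemma not_dvd_prime_power_mult_choose:
  fixes p r :: nat
  assumes "prime p" "\<not> p dvd r"
  shows "\<not> p dvd (p ^ j * r choose p ^ j)"
proof -
  have r: "r > 0" using assms(2) by (intro gr0I) auto
  have "multiplicity p (p ^ j * r choose p ^ j) = multiplicity p r"
    using const_p_fac[OF r assms(1)] .
  then have "multiplicity p (p ^ j * r choose p ^ j) = 0"
    using assms(2) by (simp add: not_dvd_imp_multiplicity_0)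
  moreover have "p ^ j * r choose p ^ j \<noteq> 0" using r by simp
  ultimately show ?thesis
    using assms(1) multiplicity_eq_zero_iff[of "p ^ j * r choose p ^ j" p] prime_gt_1_nat[of p] by auto
qed

text \<open>For \<open>n = k + 1\<close> the difference is the structure constant of
  \<open>[e\<^sub>i, e\<^sub>j]\<close> with \<open>i + j = k\<close> and
  \<open>i, j \<ge> 1\<close>. A suitable \<open>i\<close> is 1, 2 or the exact power of
  \<open>p\<close> in \<open>n\<close>, depending on the residue of \<open>n\<close>.\<close>

lemma bracket_coefficient_nonzero:
  assumes p: "prime CHAR('a::field)" and p2: "CHAR('a) > 2" and n: "4 \<le> n" "n < CHAR('a) ^ m"
    and np: "\<And>j. 1 \<le> j \<Longrightarrow> j < m \<Longrightarrow> n \<noteq> CHAR('a) ^ j"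
  shows "\<exists>i\<ge>1. i + 2 \<le> n \<and> (of_nat (n choose Suc i) - of_nat (n choose i) :: 'a) \<noteq> 0"
proof -
  let ?p = "CHAR('a)"
  have z: "(of_nat k :: 'a) = 0 \<longleftrightarrow> ?p dvd k" for k by (rule of_nat_eq_0_iff_char_dvd)
  have two: "(2 :: 'a) \<noteq> 0" by (rule two_nonzero[OF p2])
  have c2: "2 * (of_nat (n choose 2) :: 'a) = of_nat n * (of_nat n - 1)"
  proof -
    have "2 * (n choose 2) = n * (n - 1)" using times_binomial_minus1_eq[of 2 n] by simp
    then have "(of_nat (2 * (n choose 2)) :: 'a) = of_nat (n * (n - 1))" by simp
    then show ?thesis using n by (simp add: of_nat_diff)
  qed
  consider (a) "\<not> ?p dvd n" "(of_nat n :: 'a) \<noteq> 3" | (b) "\<not> ?p dvd n" "(of_nat n :: 'a) = 3" | (c) "?p dvd n"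
    by blast
  then show ?thesis
  proof cases
    case a
    \<comment> \<open>Here \<open>i = 1\<close>: the difference is
      \<open>n (n - 3) / 2\<close>.\<close>
    have "2 * (of_nat (n choose 2) - of_nat n :: 'a) = of_nat n * (of_nat n - 3)"
      using c2 by (simp add: algebra_simps)
    moreover have "\<dots> \<noteq> 0" using a z[of n] by simp
    ultimately have "(of_nat (n choose Suc 1) - of_nat (n choose 1) :: 'a) \<noteq> 0"
      by (auto simp: numeral_2_eq_2)
    then show ?thesis using n by (intro exI[of _ 1]) auto
  next
    case b
    \<comment> \<open>Here \<open>i = 2\<close>: with \<open>n = 3\<close> in the field the two
      binomials are 1 and 3, once 2 and 3 can be cancelled. For \<open>p = 3\<close> the prime would
      divide \<open>n\<close>.\<close>
    have "?p \<noteq> 3"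
    proof
      assume "?p = 3"
      then have "(3 :: 'a) = 0" using of_nat_CHAR[where 'a = 'a] by simp
      then show False using b z[of n] by simp
    qed
    then have three: "(3 :: 'a) \<noteq> 0" using z[of 3] p p2 by (auto dest: dvd_imp_le)
    have "2 * (3 * (n choose 3)) = n * (2 * (n - 1 choose 2))"
      using times_binomial_minus1_eq[of 3 n] by simp
    also have "2 * (n - 1 choose 2) = (n - 1) * (n - 1 - 1)"
      using times_binomial_minus1_eq[of 2 "n - 1"] by simp
    finally have "(of_nat (2 * (3 * (n choose 3))) :: 'a) = of_nat (n * ((n - 1) * (n - 1 - 1)))"
      by (rule arg_cong)
    then have "(2 * 3) * (of_nat (n choose 3) :: 'a) = 2 * 3"
      using n b by (simp add: of_nat_diff)
    then have "of_nat (n choose 3) = (1 :: 'a)" using two three by (simp only: mult_cancel_left2 mult_eq_0_iff) simp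
    moreover have c2': "(of_nat (n choose 2) :: 'a) = 3"
      using c2 b two mult_left_cancel[of "2 :: 'a" "of_nat (n choose 2)" 3] by simp
    ultimately have "(of_nat (n choose Suc 2) - of_nat (n choose 2) :: 'a) = 1 - 3"
      by (simp add: numeral_3_eq_3)
    then have "(of_nat (n choose Suc 2) - of_nat (n choose 2) :: 'a) \<noteq> 0"
      using two by simp
    then show ?thesis using n by (intro exI[of _ 2]) auto
  next
    case c
    have "n \<noteq> 0" "\<not> is_unit ?p" using n p2 by auto
    \<comment> \<open>Here \<open>i = p^j\<close> is the exact power of \<open>p\<close> in
      \<open>n\<close>: the binomial at \<open>i + 1\<close> vanishes, the one at \<open>i\<close>
      does not. As \<open>n\<close> is not \<open>p^j\<close> itself, \<open>r \<ge> 2\<close>,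
      which leaves room for \<open>i + 2 \<le> n\<close>.\<close>
    then obtain r where r: "n = ?p ^ multiplicity ?p n * r" "\<not> ?p dvd r"
      by (rule multiplicity_decompose')
    define j where "j = multiplicity ?p n"
    have j1: "1 \<le> j" using c n p unfolding j_def by (auto simp: multiplicity_gt_zero_iff Suc_le_eq)
    have p1: "1 < ?p" using p2 by simp
    have r0: "r \<noteq> 0" using r(2) by (intro notI) simp
    have le: "?p ^ j * 1 \<le> n" using r(1) r0 mult_le_mono2[of 1 r "?p ^ j"] unfolding j_def by simp
    then have "?p ^ j < ?p ^ m" using n by simp
    then have jm: "j < m" using p1 by simp
    have "r \<noteq> 1" using np[OF j1 jm] r unfolding j_def by auto
    then have "2 \<le> r" using r0 by simp
    then have le2: "?p ^ j * 2 \<le> n" using r(1) mult_le_mono2[of 2 r "?p ^ j"] unfolding j_def by simp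
    have pj: "?p \<le> ?p ^ j" using j1 p1 by (simp add: self_le_power)
    have "Suc (?p ^ j) * (n choose Suc (?p ^ j)) = n * (n - 1 choose ?p ^ j)"
      using times_binomial_minus1_eq[of "Suc (?p ^ j)" n] by simp
    then have "?p dvd Suc (?p ^ j) * (n choose Suc (?p ^ j))" using c by (metis dvd_mult2)
    moreover have "\<not> ?p dvd Suc (?p ^ j)"
      using j1 p1 dvd_power[of j ?p] dvd_add_right_iff[of ?p "?p ^ j" 1] by simp
    ultimately have "?p dvd (n choose Suc (?p ^ j))" using prime_dvd_multD[OF p] by blast
    then have "(of_nat (n choose Suc (?p ^ j)) :: 'a) = 0" by (simp add: z)
    moreover have "(of_nat (n choose ?p ^ j) :: 'a) \<noteq> 0"
      using not_dvd_prime_power_mult_choose[OF p r(2), of j] r(1) unfolding z j_def by simp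
    ultimately show ?thesis using le2 pj p2 by (intro exI[of _ "?p ^ j"]) auto
  qed
qed

lemma dp_bracket_basis:
  fixes i j m :: nat
  assumes "i + j + 1 < CHAR('a::field) ^ m"
  shows "dp_bracket m (dp_basis (Suc i)) (dp_basis (Suc j) :: nat \<Rightarrow> 'a) =
    fun_scale (*) (of_nat ((i + j + 1) choose Suc i) - of_nat ((i + j + 1) choose i)) (dp_basis (i + j + 1))"
proof -
  have s: "(i + j + 1) choose Suc j = (i + j + 1) choose i"
    using binomial_symmetric[of i "i + j + 1"] by simp
  show ?thesis
    using assms s unfolding dp_bracket_def
    by (simp add: dp_deriv_basis_Suc dp_mult_basis add.commute[of j i] del: binomial_Suc_Suc)
      (simp add: fun_scale_def fun_eq_iff algebra_simps del: binomial_Suc_Suc)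
qed

section \<open>Normal form of cocycles of non-zero weight\<close>

context
  fixes m :: nat and \<mu> :: "'a::field"
  assumes p: "prime CHAR('a)" and p2: "CHAR('a) > 2" and m: "m > 0" and mu: "\<mu> \<noteq> 0"
begin

private lemma q_gt: "2 < CHAR('a) ^ m"
  using p2 m self_le_power[of "CHAR('a)" m] by simp

private lemma char_pos: "CHAR('a) > 0"
  using p2 by simp

private lemma one_carrier:
  "(dp_basis 0 :: nat \<Rightarrow> 'a) \<in> dp_carrier m" "(dp_basis 1 :: nat \<Rightarrow> 'a) \<in> dp_carrier m"
  using q_gt char_pos by (auto intro!: dp_carrier_basis)

text \<open>The bracket with \<open>dp_basis 0\<close>, that is with
  \<open>e\<^sub>-\<^sub>1\<close>, is the derivation; as \<open>\<Phi>\<close> vanishes there, the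
  cocycle identity becomes commutation.\<close>

lemma normalized_cocycle_deriv:
  assumes c: "density_cocycle m \<mu> \<Phi>" and "\<Phi> (dp_basis 0) = 0" and f: "f \<in> dp_carrier m"
  shows "\<Phi> ((dp_deriv m ^^ n) f) = (dp_deriv m ^^ n) (\<Phi> f)"
proof (induction n)
  case 0
  show ?case by simp
next
  case (Suc n)
  let ?g = "(dp_deriv m ^^ n) f"
  have g: "?g \<in> dp_carrier m" using f by (rule dp_carrier_funpow_deriv)
  have "dp_bracket m (dp_basis 0) ?g = dp_deriv m ?g"
    by (simp add: dp_bracket_def dp_mult_one dp_carrier_deriv dp_deriv_basis_0 dp_mult_zero_right)
  then have "\<Phi> (dp_deriv m ?g) = density m \<mu> (dp_basis 0) (\<Phi> ?g) - density m \<mu> ?g (\<Phi> (dp_basis 0))"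
    using density_cocycleD(4)[OF c one_carrier(1) g] by simp
  then show ?case by (simp add: assms(2) density_one_left density_zero_right Suc)
qed

text \<open>The bracket with \<open>e\<^sub>0\<close> forces \<open>of_nat k = \<mu>\<close>. In
  that weight, \<open>bracket_coefficient_nonzero\<close> makes \<open>e\<^sub>k\<close> a multiple
  of a bracket of elements of positive degree, on which the constant term of \<open>\<Phi>\<close>
  vanishes.\<close>

lemma normalized_cocycle_support:
  assumes c: "density_cocycle m \<mu> \<Phi>" and zero: "\<Phi> (dp_basis 0) = 0" "\<Phi> (dp_basis 1) = 0"
    and k: "Suc k < CHAR('a) ^ m" "k \<notin> generator_degrees m \<mu>"
  shows "\<Phi> (dp_basis (Suc k)) 0 = 0"
proof (cases "k = 0")
  case True
  then show ?thesis using zero by simp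
next
  case k0: False
  \<comment> \<open>Without constant terms in \<open>f\<close> and \<open>g\<close>, only their
    linear coefficients contribute.\<close>
  have br: "\<Phi> (dp_bracket m f g) 0 = \<mu> * (f 1 * \<Phi> g 0 - g 1 * \<Phi> f 0)"
    if "f \<in> dp_carrier m" "g \<in> dp_carrier m" "f 0 = 0" "g 0 = 0" for f g
    unfolding density_cocycleD(4)[OF c that(1,2)]
    using that density_cocycleD(1)[OF c] char_pos by (simp add: density_apply_0 algebra_simps)
  have scale: "\<Phi> (fun_scale (*) a (dp_basis n)) 0 = a * \<Phi> (dp_basis n) 0" if "n < CHAR('a) ^ m" for a n
    using density_cocycleD(2)[OF c dp_carrier_basis[OF that]] by (simp add: fun_scale_def)
  have rel: "(of_nat ((i + j + 1) choose Suc i) - of_nat ((i + j + 1) choose i)) * \<Phi> (dp_basis (i + j + 1)) 0 =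
    \<mu> * (dp_basis (Suc i) 1 * \<Phi> (dp_basis (Suc j)) 0 - dp_basis (Suc j) 1 * \<Phi> (dp_basis (Suc i)) 0)"
    if "i + j + 1 < CHAR('a) ^ m" for i j
    using br[of "dp_basis (Suc i)" "dp_basis (Suc j)"] that scale[of "i + j + 1"]
    by (simp add: dp_bracket_basis dp_carrier_basis dp_basis_apply del: binomial_Suc_Suc)
  have w: "of_nat k * \<Phi> (dp_basis (Suc k)) 0 = \<mu> * \<Phi> (dp_basis (Suc k)) 0"
    using rel[of 0 k] k k0 zero by (simp add: dp_basis_apply algebra_simps)
  show ?thesis
  proof (cases "of_nat k = \<mu>")
    case False
    then show ?thesis using w by simp
  next
    case True
    then have ng: "k \<noteq> 1" "k \<noteq> 2" "\<And>j. 1 \<le> j \<Longrightarrow> j < m \<Longrightarrow> k \<noteq> CHAR('a) ^ j - 1"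
      using k k0 unfolding generator_degrees_def by auto
    have np: "Suc k \<noteq> CHAR('a) ^ j" if "1 \<le> j" "j < m" for j using ng(3)[OF that] by force
    have "4 \<le> Suc k" using k0 ng(1,2) by simp
    then obtain i where i: "1 \<le> i" "i + 2 \<le> Suc k" "(of_nat (Suc k choose Suc i) - of_nat (Suc k choose i) :: 'a) \<noteq> 0"
      using bracket_coefficient_nonzero[OF p p2 _ k(1), OF _ np] by blast
    \<comment> \<open>Both \<open>i\<close> and \<open>k - i\<close> are at least 1, so the right
      side of \<open>rel\<close> is zero.\<close>
    have "(of_nat (Suc k choose Suc i) - of_nat (Suc k choose i)) * \<Phi> (dp_basis (Suc k)) 0 = 0"
      using rel[of i "k - i"] i k by (simp add: dp_basis_apply del: binomial_Suc_Suc)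
    then show ?thesis using i(3) by simp
  qed
qed

text \<open>The \<open>n\<close>-th coefficient of \<open>\<Phi> f\<close> is the constant term of
  \<open>\<Phi>\<close> at the \<open>n\<close>-th derivative of \<open>f\<close>. That constant
  term is a linear functional, expanded over the basis.\<close>

lemma normalized_cocycle_eq:
  assumes c: "density_cocycle m \<mu> \<Phi>" and zero: "\<Phi> (dp_basis 0) = 0" "\<Phi> (dp_basis 1) = 0"
    and f: "f \<in> dp_carrier m"
  shows "\<Phi> f n = (\<Sum>k\<in>generator_degrees m \<mu>. \<Phi> (dp_basis (Suc k)) 0 * (dp_deriv m ^^ Suc k) f n)"
proof -
  let ?K = "generator_degrees m \<mu>"
  let ?g = "(dp_deriv m ^^ n) f"
  have g: "?g \<in> dp_carrier m" using f by (rule dp_carrier_funpow_deriv)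
  have Kq: "Suc k < CHAR('a) ^ m" if "k \<in> ?K" for k using that by (simp add: generator_degrees_def)
  have "\<Phi> f n = (dp_deriv m ^^ n) (\<Phi> f) 0"
    using density_cocycleD(1)[OF c f] by (simp add: funpow_dp_deriv_apply)
  also have "\<dots> = \<Phi> ?g 0" by (simp add: normalized_cocycle_deriv[OF c zero(1) f])
  also have "\<dots> = (\<Sum>l<CHAR('a) ^ m. ?g l * \<Phi> (dp_basis l) 0)"
  proof (rule dp_linear_expansion[OF vector_space_times])
    show "\<Phi> (f + g) 0 = \<Phi> f 0 + \<Phi> g 0" if "f \<in> dp_carrier m" "g \<in> dp_carrier m" for f g
      unfolding density_cocycleD(3)[OF c that] by simp
    show "\<Phi> (fun_scale (*) a f) 0 = a * \<Phi> f 0" if "f \<in> dp_carrier m" for a f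
      unfolding density_cocycleD(2)[OF c that] by (simp add: fun_scale_def)
  qed (rule g)
  also have "\<dots> = (\<Sum>l\<in>Suc ` ?K. ?g l * \<Phi> (dp_basis l) 0)"
  proof (rule sum.mono_neutral_right)
    show "\<forall>l\<in>{..<CHAR('a) ^ m} - Suc ` ?K. ?g l * \<Phi> (dp_basis l) 0 = 0"
    proof
      fix l assume l: "l \<in> {..<CHAR('a) ^ m} - Suc ` ?K"
      show "?g l * \<Phi> (dp_basis l) 0 = 0"
      proof (cases l)
        case 0
        then show ?thesis using zero by simp
      next
        case (Suc k)
        then show ?thesis using l normalized_cocycle_support[OF c zero, of k] by auto
      qed
    qed
  qed (use Kq in auto)
  also have "\<dots> = (\<Sum>k\<in>?K. \<Phi> (dp_basis (Suc k)) 0 * (dp_deriv m ^^ Suc k) f n)"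
    using f by (subst sum.reindex) (auto simp: funpow_dp_deriv_apply add_ac mult_ac simp del: funpow.simps)
  finally show ?thesis .
qed

text \<open>Integrating the value at \<open>e\<^sub>-\<^sub>1\<close> removes it up to the top
  coefficient. The relation \<open>[e\<^sub>-\<^sub>1, e\<^sub>0] = e\<^sub>-\<^sub>1\<close> kills
  that coefficient and leaves a constant at \<open>e\<^sub>0\<close>, again a coboundary. Non-zero
  weight enters for the top coefficient and for the constant.\<close>

lemma density_cocycle_normalize:
  assumes c: "density_cocycle m \<mu> \<Phi>"
  obtains g where "g \<in> dp_carrier m"
    "\<Phi> (dp_basis 0) = density m \<mu> (dp_basis 0) g" "\<Phi> (dp_basis 1) = density m \<mu> (dp_basis 1) g"
proof -
  define u where "u = \<Phi> (dp_basis 0)"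
  have u: "u \<in> dp_carrier m" using c one_carrier unfolding density_cocycle_def u_def by blast
  \<comment> \<open>The antiderivative of \<open>u\<close>, except that the top coefficient of
    \<open>u\<close> has none in \<open>A(m)\<close>.\<close>
  define h where "h n = (if 0 < n \<and> n < CHAR('a) ^ m then u (n - 1) else 0)" for n
  have h: "h \<in> dp_carrier m" by (simp add: h_def dp_carrier_def)
  define \<Psi> where "\<Psi> f = \<Phi> f - density m \<mu> f h" for f
  have c1: "density_cocycle m \<mu> \<Psi>"
    unfolding \<Psi>_def by (intro density_cocycle_diff c density_cocycle_coboundary p)
  have \<Psi>0: "\<Psi> (dp_basis 0) = fun_scale (*) (u (CHAR('a) ^ m - 1)) (dp_basis (CHAR('a) ^ m - 1))"
  proof
    fix n
    have "\<Psi> (dp_basis 0) n = u n - h (Suc n)"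
      using h by (simp add: \<Psi>_def density_one_left u_def dp_deriv_apply)
    also have "\<dots> = fun_scale (*) (u (CHAR('a) ^ m - 1)) (dp_basis (CHAR('a) ^ m - 1)) n"
    proof -
      consider "Suc n < CHAR('a) ^ m" | "Suc n = CHAR('a) ^ m" | "CHAR('a) ^ m \<le> n" by linarith
      then show ?thesis using u q_gt by cases (auto simp: h_def fun_scale_def dp_basis_apply dp_carrier_def)
    qed
    finally show "\<Psi> (dp_basis 0) n = fun_scale (*) (u (CHAR('a) ^ m - 1)) (dp_basis (CHAR('a) ^ m - 1)) n" .
  qed
  have \<Psi>x: "\<Psi> (dp_basis 1) \<in> dp_carrier m" and \<Psi>1: "\<Psi> (dp_basis 0) \<in> dp_carrier m"
    using c1 one_carrier unfolding density_cocycle_def by auto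
  have "dp_bracket m (dp_basis 0) (dp_basis 1) = (dp_basis 0 :: nat \<Rightarrow> 'a)"
    using q_gt by (simp add: dp_bracket_def dp_deriv_basis_Suc dp_deriv_basis_0 dp_mult_one[OF one_carrier(1)]
        dp_mult_zero_right)
  then have "\<Psi> (dp_basis 0) = density m \<mu> (dp_basis 0) (\<Psi> (dp_basis 1)) - density m \<mu> (dp_basis 1) (\<Psi> (dp_basis 0))"
    using density_cocycleD(4)[OF c1 one_carrier] by simp
  then have rel: "\<Psi> (dp_basis 0) n = \<Psi> (dp_basis 1) (Suc n) - (of_nat n + \<mu>) * \<Psi> (dp_basis 0) n" if "n < CHAR('a) ^ m" for n
    using that q_gt \<Psi>x \<Psi>1 density_x_apply[of m "\<Psi> (dp_basis 0)" n \<mu>]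
    by (simp add: density_one_left dp_deriv_apply fun_eq_iff)
  have last: "of_nat (CHAR('a) ^ m - 1) = (- 1 :: 'a)"
    using q_gt m by (simp add: of_nat_diff)
  have solve: "\<mu> * a = 0" if "a = 0 - (- 1 + \<mu>) * a" for a
    using that by (simp add: algebra_simps)
  \<comment> \<open>In top degree the first term on the right of \<open>rel\<close> vanishes and
    \<open>of_nat n\<close> is -1, which leaves \<open>\<mu>\<close> times the top
    coefficient.\<close>
  have "\<Psi> (dp_basis 1) (Suc (CHAR('a) ^ m - 1)) = 0" using \<Psi>x q_gt by (simp add: dp_carrier_def)
  then have "\<mu> * \<Psi> (dp_basis 0) (CHAR('a) ^ m - 1) = 0"
    using rel[of "CHAR('a) ^ m - 1", unfolded last] q_gt by (intro solve) simp
  then have "u (CHAR('a) ^ m - 1) = 0" using mu by (simp add: \<Psi>0 fun_scale_def dp_basis_apply)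
  then have \<Psi>0': "\<Psi> (dp_basis 0) = 0" by (simp add: \<Psi>0 fun_scale_def fun_eq_iff)
  define b where "b = \<Psi> (dp_basis 1) 0"
  \<comment> \<open>With the value at \<open>e\<^sub>-\<^sub>1\<close> gone, \<open>rel\<close> says
    that the value at \<open>e\<^sub>0\<close> has derivative zero.\<close>
  have \<Psi>x': "\<Psi> (dp_basis 1) = fun_scale (*) b (dp_basis 0)"
  proof
    fix n
    show "\<Psi> (dp_basis 1) n = fun_scale (*) b (dp_basis 0) n"
    proof (cases n)
      case 0
      then show ?thesis by (simp add: b_def fun_scale_def dp_basis_apply)
    next
      case (Suc k)
      then show ?thesis
        using rel[of k] \<Psi>0' \<Psi>x by (cases "k < CHAR('a) ^ m") (auto simp: fun_scale_def dp_basis_apply dp_carrier_def)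
    qed
  qed
  \<comment> \<open>On constants \<open>e\<^sub>0\<close> acts by \<open>\<mu>\<close> and
    \<open>e\<^sub>-\<^sub>1\<close> by zero, hence the correction \<open>b / \<mu>\<close>.\<close>
  define g where "g = h + fun_scale (*) (b / \<mu>) (dp_basis 0)"
  show ?thesis
  proof (rule that[of g])
    show "g \<in> dp_carrier m"
      unfolding g_def using h one_carrier by (intro dp_carrier_add dp_carrier_scale)
    show "\<Phi> (dp_basis 0) = density m \<mu> (dp_basis 0) g"
      using \<Psi>0' unfolding \<Psi>_def g_def density_add_right density_scale_right density_one_right
      by (simp add: dp_deriv_basis_0 fun_scale_def fun_eq_iff)
    show "\<Phi> (dp_basis 1) = density m \<mu> (dp_basis 1) g"
    proof -
      have "\<Phi> (dp_basis 1) = density m \<mu> (dp_basis 1) h + \<Psi> (dp_basis 1)" by (simp add: \<Psi>_def)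
      also have "\<Psi> (dp_basis 1) = fun_scale (*) (b / \<mu>)
          (fun_scale (*) \<mu> (dp_deriv m (dp_basis 1)))"
        unfolding \<Psi>x' using mu q_gt by (simp add: dp_deriv_basis_Suc fun_scale_def fun_eq_iff)
      finally show ?thesis
        unfolding g_def density_add_right density_scale_right density_one_right .
    qed
  qed
qed

lemma density_cocycle_form:
  assumes c: "density_cocycle m \<mu> \<Phi>"
  shows "\<exists>g\<in>dp_carrier m. \<exists>c. \<forall>f\<in>dp_carrier m. \<forall>n. \<Phi> f n = density m \<mu> f g n +
    (\<Sum>k\<in>generator_degrees m \<mu>. c k * (dp_deriv m ^^ Suc k) f n)"
proof -
  obtain g where g: "g \<in> dp_carrier m" "\<Phi> (dp_basis 0) = density m \<mu> (dp_basis 0) g"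
    "\<Phi> (dp_basis 1) = density m \<mu> (dp_basis 1) g"
    using density_cocycle_normalize[OF c] .
  define c where "c k = (\<Phi> (dp_basis (Suc k)) - density m \<mu> (dp_basis (Suc k)) g) 0" for k
  have "density_cocycle m \<mu> (\<lambda>f. \<Phi> f - density m \<mu> f g)"
    by (intro density_cocycle_diff assms density_cocycle_coboundary p)
  from normalized_cocycle_eq[OF this] g
  have "\<Phi> f n = density m \<mu> f g n + (\<Sum>k\<in>generator_degrees m \<mu>. c k * (dp_deriv m ^^ Suc k) f n)"
    if "f \<in> dp_carrier m" for f n
    using that by (simp add: c_def diff_eq_eq add.commute del: funpow.simps)
  with g(1) show ?thesis by blast
qed

text \<open>At \<open>e\<^sub>-\<^sub>1\<close> and \<open>e\<^sub>0\<close> all generator cocycles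
  vanish, being derivatives of order at least 2, so \<open>h = 0\<close>; evaluation at
  \<open>e\<^sub>k\<close> then isolates \<open>c k\<close>. The conclusion \<open>h = 0\<close>
  also serves for the extra class in weight 1.\<close>

lemma generator_cocycles_independent:
  assumes h: "h \<in> dp_carrier m"
    and eq: "\<And>f n. f \<in> dp_carrier m \<Longrightarrow>
      (\<Sum>k\<in>generator_degrees m \<mu>. c k * (dp_deriv m ^^ Suc k) f n) = density m \<mu> f h n"
  shows "h = 0" and "k \<in> generator_degrees m \<mu> \<Longrightarrow> c k = 0"
proof -
  let ?K = "generator_degrees m \<mu>"
  have eq0: "(\<Sum>k\<in>?K. c k * dp_basis a (n + Suc k)) = density m \<mu> (dp_basis a) h n" if "a < CHAR('a) ^ m" for a n
    using eq[OF dp_carrier_basis[OF that], of n]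
    by (simp add: funpow_dp_deriv_apply dp_carrier_basis[OF that] del: funpow.simps)
  have K1: "1 \<le> k" "Suc k < CHAR('a) ^ m" if "k \<in> ?K" for k using that by (auto simp: generator_degrees_def)
  have S: "h (Suc n) = 0" for n
  proof -
    have "(\<Sum>k\<in>?K. c k * dp_basis 0 (n + Suc k)) = 0"
      by (rule sum.neutral) (auto simp: dp_basis_apply)
    then show ?thesis using eq0[of 0 n] q_gt char_pos h by (simp add: density_one_left dp_deriv_apply)
  qed
  moreover have "h 0 = 0"
  proof -
    have "(\<Sum>k\<in>?K. c k * dp_basis 1 (0 + Suc k)) = 0"
      by (rule sum.neutral) (use K1 in \<open>auto simp: dp_basis_apply\<close>)
    then show ?thesis using eq0[of 1 0] q_gt char_pos h mu density_x_apply[of m h 0 \<mu>] by simp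
  qed
  ultimately have "h n = 0" for n by (cases n) auto
  then show h0: "h = 0" by (simp add: fun_eq_iff)
  assume k: "k \<in> ?K"
  have "(\<Sum>l\<in>?K. c l * dp_basis (Suc k) (0 + Suc l)) = (\<Sum>l\<in>{k}. c l)"
    by (rule sum.mono_neutral_cong_right) (use k in \<open>auto simp: dp_basis_apply finite_generator_degrees\<close>)
  then show "c k = 0" using eq0[of "Suc k" 0] K1[OF k] h0 by (simp add: density_zero_right)
qed

end

lemma density_cocycle_generator:
  fixes \<mu> :: "'a::field"
  assumes p: "prime CHAR('a)" and k: "k \<in> generator_degrees m \<mu>"
  shows "density_cocycle m \<mu> (dp_deriv m ^^ Suc k)"
proof -
  have mu: "\<mu> = of_nat k" using k by (simp add: generator_degrees_def)
  consider "k = 1" | "k = 2" | j where "j \<ge> 1" "k = CHAR('a) ^ j - 1"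
    using k unfolding generator_degrees_def by blast
  then show ?thesis
  proof cases
    case 1
    then show ?thesis using density_cocycle_deriv2[OF p] by (simp add: mu eval_nat_numeral del: funpow.simps)
  next
    case 2
    then show ?thesis using density_cocycle_deriv3[OF p] by (simp add: mu eval_nat_numeral del: funpow.simps)
  next
    case 3
    have pos: "1 \<le> CHAR('a) ^ j" using p by (simp add: prime_gt_0_nat Suc_le_eq)
    then have S: "Suc k = CHAR('a) ^ j" using 3 by simp
    have "\<mu> = - 1" unfolding mu 3(2) using pos 3 by (simp add: of_nat_diff)
    then show ?thesis using density_cocycle_prime_power_deriv[OF p, of m j] by (simp only: S)
  qed
qed

section \<open>Modules embedded in tensor densities\<close>

text \<open>The derivative of \<open>x\<close> is 1, so evaluation at \<open>dp_basis 1\<close>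
  inverts \<open>dp_vf m\<close> on \<open>A(m)\<close>.\<close>

lemma dp_vf_apply_x:
  fixes f :: "nat \<Rightarrow> 'a::field"
  assumes "1 < CHAR('a) ^ m" "f \<in> dp_carrier m"
  shows "dp_vf m f (dp_basis 1) = f"
  using assms dp_mult_commute[of m f "dp_basis 0"] by (simp add: dp_vf_def dp_deriv_x[simplified] dp_mult_one)

lemma zass_eq_dp_vf:
  fixes D :: "(nat \<Rightarrow> 'a::field) \<Rightarrow> nat \<Rightarrow> 'a"
  assumes "1 < CHAR('a) ^ m" "D \<in> zass m"
  shows "D (dp_basis 1) \<in> dp_carrier m" and "dp_vf m (D (dp_basis 1)) = D"
  using assms by (auto simp: zass_def dp_vf_apply_x[simplified])

lemma dp_vf_in_zass: "f \<in> dp_carrier m \<Longrightarrow> dp_vf m f \<in> zass m"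
  by (simp add: zass_def)

lemma commutator_dp_vf:
  "prime CHAR('a::field) \<Longrightarrow> commutator (dp_vf m f) (dp_vf m g) = dp_vf m (dp_bracket m f (g :: nat \<Rightarrow> 'a))"
  by (simp add: dp_bracket_def dp_vf_commutator)

lemma zass_add_scale_closed:
  "D \<in> zass m \<Longrightarrow> E \<in> zass m \<Longrightarrow> D + E \<in> zass m"
  "D \<in> zass m \<Longrightarrow> zass_scale c D \<in> zass m"
proof -
  interpret vector_space "zass_scale :: 'a \<Rightarrow> _" by (rule vector_space_zass_scale)
  show "D \<in> zass m \<Longrightarrow> E \<in> zass m \<Longrightarrow> D + E \<in> zass m"
    "D \<in> zass m \<Longrightarrow> zass_scale c D \<in> zass m"
    using subspace_add[OF zass_subspace] subspace_scale[OF zass_subspace] by auto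
qed

context lie_module begin

text \<open>Bridges the record-style sums of the dimension criterion and the pointwise sums of the
  cocycle computations.\<close>

lemma finsum_ce_Z1_space:
  assumes "finite I" "\<And>i. i \<in> I \<Longrightarrow> \<phi> i \<in> ce_Z1 L sL bracket sV act"
  shows "finsum (ce_Z1_space L sL bracket sV act) (\<lambda>i. c i \<odot>\<^bsub>ce_Z1_space L sL bracket sV act\<^esub> \<phi> i) I
    = (\<lambda>x. \<Sum>i\<in>I. sV (c i) (\<phi> i x))"
proof -
  interpret Z: vectorspace class_ring "ce_Z1_space L sL bracket sV act"
    by (rule ce_Z1_space_vectorspace)
  show ?thesis
    using assms
  proof (induction I rule: finite_induct)
    case empty
    show ?case by (simp only: Z.M.finsum_empty) (simp add: ce_Z1_space_def fun_eq_iff)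
  next
    case (insert i I)
    have "finsum (ce_Z1_space L sL bracket sV act) (\<lambda>i. c i \<odot>\<^bsub>ce_Z1_space L sL bracket sV act\<^esub> \<phi> i) (insert i I) =
      c i \<odot>\<^bsub>ce_Z1_space L sL bracket sV act\<^esub> \<phi> i \<oplus>\<^bsub>ce_Z1_space L sL bracket sV act\<^esub>
      finsum (ce_Z1_space L sL bracket sV act) (\<lambda>i. c i \<odot>\<^bsub>ce_Z1_space L sL bracket sV act\<^esub> \<phi> i) I"
      using insert by (intro Z.M.finsum_insert) (auto simp: ce_Z1_space_def ce_Z1_scale)
    also have "\<dots> = (\<lambda>x. \<Sum>i\<in>insert i I. sV (c i) (\<phi> i x))"
      using insert by (simp add: fun_eq_iff) (simp add: ce_Z1_space_def fun_scale_def)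
    finally show ?case .
  qed
qed

end

text \<open>Realises the module as a submodule of the densities of weight \<open>\<mu>\<close>. Its
  cocycles are the density cocycles with values in \<open>range \<iota>\<close>, but its
  coboundaries come only from elements of \<open>range \<iota>\<close>.\<close>

locale zass_density_embedding = lie_module "zass m" zass_scale commutator sV act
  for m :: nat and sV :: "'a::field \<Rightarrow> 'v::ab_group_add \<Rightarrow> 'v"
    and act :: "((nat \<Rightarrow> 'a) \<Rightarrow> (nat \<Rightarrow> 'a)) \<Rightarrow> 'v \<Rightarrow> 'v" +
  fixes \<mu> :: 'a and \<iota> :: "'v \<Rightarrow> nat \<Rightarrow> 'a"
  assumes prime_char: "prime CHAR('a)" and char_gt_2: "CHAR('a) > 2" and m_pos: "m > 0"
    and weight_nonzero: "\<mu> \<noteq> 0"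
    and iota_add: "\<iota> (v + w) = \<iota> v + \<iota> w"
    and iota_scale: "\<iota> (sV c v) = fun_scale (*) c (\<iota> v)"
    and iota_inj: "inj \<iota>"
    and iota_carrier: "\<iota> v \<in> dp_carrier m"
    and iota_act: "f \<in> dp_carrier m \<Longrightarrow> \<iota> (act (dp_vf m f) v) = density m \<mu> f (\<iota> v)"
begin

lemma q_gt_1: "1 < CHAR('a) ^ m"
  using char_gt_2 m_pos one_less_power[of "CHAR('a)" m] by simp

lemma iota_diff: "\<iota> (v - w) = \<iota> v - \<iota> w"
  using iota_add[of "v - w" w] by (metis add_diff_cancel_right' diff_add_cancel)

lemma iota_zero: "\<iota> 0 = 0"
  using iota_diff[of 0 0] by simp

lemma iota_sum: "\<iota> (sum g I) n = (\<Sum>i\<in>I. \<iota> (g i) n)"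
  by (induction I rule: infinite_finite_induct) (auto simp: iota_zero iota_add)

text \<open>\<open>D (dp_basis 1)\<close> is the coefficient function of \<open>D\<close>; the value
  0 outside \<open>W(m)\<close> is the convention for cochains.\<close>

definition cocycle_lift :: "((nat \<Rightarrow> 'a) \<Rightarrow> nat \<Rightarrow> 'a) \<Rightarrow> ((nat \<Rightarrow> 'a) \<Rightarrow> nat \<Rightarrow> 'a) \<Rightarrow> 'v"
  where "cocycle_lift \<Phi> D = (if D \<in> zass m then inv_into UNIV \<iota> (\<Phi> (D (dp_basis 1))) else 0)"

lemma iota_cocycle_lift:
  assumes "D \<in> zass m" "\<And>f. f \<in> dp_carrier m \<Longrightarrow> \<Phi> f \<in> range \<iota>"
  shows "\<iota> (cocycle_lift \<Phi> D) = \<Phi> (D (dp_basis 1))"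
  using assms zass_eq_dp_vf(1)[OF q_gt_1 assms(1)] by (simp add: cocycle_lift_def f_inv_into_f)

text \<open>Each identity is checked after applying \<open>\<iota>\<close>, which is injective,
  linear and equivariant.\<close>

lemma cocycle_lift_in_Z1:
  assumes c: "density_cocycle m \<mu> \<Phi>" and r: "\<And>f. f \<in> dp_carrier m \<Longrightarrow> \<Phi> f \<in> range \<iota>"
  shows "cocycle_lift \<Phi> \<in> ce_Z1 (zass m) zass_scale commutator sV act"
  unfolding ce_Z1_iff
proof (intro conjI ballI allI impI)
  have lift: "\<iota> (cocycle_lift \<Phi> D) = \<Phi> (D (dp_basis 1))" if "D \<in> zass m" for D
    by (rule iota_cocycle_lift[OF that r])
  note crd = zass_eq_dp_vf[OF q_gt_1]
  fix D :: "(nat \<Rightarrow> 'a) \<Rightarrow> nat \<Rightarrow> 'a" assume D: "D \<in> zass m"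
  show "cocycle_lift \<Phi> (zass_scale a D) = sV a (cocycle_lift \<Phi> D)" for a
  proof (rule injD[OF iota_inj])
    have "zass_scale a D (dp_basis 1) = fun_scale (*) a (D (dp_basis 1))"
      by (simp add: zass_scale_def fun_scale_def)
    then show "\<iota> (cocycle_lift \<Phi> (zass_scale a D)) = \<iota> (sV a (cocycle_lift \<Phi> D))"
      unfolding iota_scale lift[OF D] lift[OF zass_add_scale_closed(2)[OF D]]
      using density_cocycleD(2)[OF c crd(1)[OF D]] by metis
  qed
  fix E :: "(nat \<Rightarrow> 'a) \<Rightarrow> nat \<Rightarrow> 'a" assume E: "E \<in> zass m"
  show "cocycle_lift \<Phi> (D + E) = cocycle_lift \<Phi> D + cocycle_lift \<Phi> E"
  proof (rule injD[OF iota_inj])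
    have "(D + E) (dp_basis 1) = D (dp_basis 1) + E (dp_basis 1)" by simp
    then show "\<iota> (cocycle_lift \<Phi> (D + E)) = \<iota> (cocycle_lift \<Phi> D + cocycle_lift \<Phi> E)"
      unfolding iota_add lift[OF D] lift[OF E] lift[OF zass_add_scale_closed(1)[OF D E]]
      using density_cocycleD(3)[OF c crd(1)[OF D] crd(1)[OF E]] by metis
  qed
  show "cocycle_lift \<Phi> (commutator D E) = act D (cocycle_lift \<Phi> E) - act E (cocycle_lift \<Phi> D)"
  proof (rule injD[OF iota_inj])
    have cl: "commutator D E \<in> zass m" by (rule zass_bracket_closed[OF prime_char D E])
    have "commutator D E = dp_vf m (dp_bracket m (D (dp_basis 1)) (E (dp_basis 1)))"
      using commutator_dp_vf[OF prime_char, of m "D (dp_basis 1)" "E (dp_basis 1)"]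
      unfolding crd(2)[OF D] crd(2)[OF E] .
    then have *: "commutator D E (dp_basis 1) = dp_bracket m (D (dp_basis 1)) (E (dp_basis 1))"
      using dp_vf_apply_x[OF q_gt_1 dp_carrier_bracket] by metis
    have a: "\<iota> (act X v) = density m \<mu> (X (dp_basis 1)) (\<iota> v)" if "X \<in> zass m" for X v
      using iota_act[OF crd(1)[OF that], of v] unfolding crd(2)[OF that] .
    show "\<iota> (cocycle_lift \<Phi> (commutator D E)) =
        \<iota> (act D (cocycle_lift \<Phi> E) - act E (cocycle_lift \<Phi> D))"
      unfolding iota_diff a[OF D] a[OF E] lift[OF D] lift[OF E] lift[OF cl] *
      using density_cocycleD(4)[OF c crd(1)[OF D] crd(1)[OF E]] .
  qed
qed (simp add: cocycle_lift_def)

lemma Z1_density_cocycle: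
  assumes \<phi>: "\<phi> \<in> ce_Z1 (zass m) zass_scale commutator sV act"
  shows "density_cocycle m \<mu> (\<lambda>f. \<iota> (\<phi> (dp_vf m f)))"
  unfolding density_cocycle_def
proof (intro conjI ballI allI)
  fix f :: "nat \<Rightarrow> 'a" assume f: "f \<in> dp_carrier m"
  show "\<iota> (\<phi> (dp_vf m f)) \<in> dp_carrier m" by (rule iota_carrier)
  show "\<iota> (\<phi> (dp_vf m (fun_scale (*) c f))) = fun_scale (*) c (\<iota> (\<phi> (dp_vf m f)))" for c
    using \<phi> dp_vf_in_zass[OF f] unfolding ce_Z1_iff dp_vf_scale by (simp add: iota_scale)
  fix g :: "nat \<Rightarrow> 'a" assume g: "g \<in> dp_carrier m"
  show "\<iota> (\<phi> (dp_vf m (f + g))) = \<iota> (\<phi> (dp_vf m f)) + \<iota> (\<phi> (dp_vf m g))"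
  proof -
    have "\<phi> (dp_vf m f + dp_vf m g) = \<phi> (dp_vf m f) + \<phi> (dp_vf m g)"
      using \<phi> dp_vf_in_zass[OF f] dp_vf_in_zass[OF g] unfolding ce_Z1_iff by blast
    then show ?thesis unfolding dp_vf_add by (simp only: iota_add)
  qed
  show "\<iota> (\<phi> (dp_vf m (dp_bracket m f g))) =
      density m \<mu> f (\<iota> (\<phi> (dp_vf m g))) - density m \<mu> g (\<iota> (\<phi> (dp_vf m f)))"
  proof -
    have "\<phi> (commutator (dp_vf m f) (dp_vf m g)) =
        act (dp_vf m f) (\<phi> (dp_vf m g)) - act (dp_vf m g) (\<phi> (dp_vf m f))"
      using \<phi> dp_vf_in_zass[OF f] dp_vf_in_zass[OF g] unfolding ce_Z1_iff by blast
    then show ?thesis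
      unfolding commutator_dp_vf[OF prime_char] by (simp only: iota_diff iota_act f g)
  qed
qed

text \<open>Moves the computation into \<open>A(m)\<close>: classes are given by density cocycles,
  and only coboundaries of elements \<open>\<iota> v\<close> are divided out.\<close>

lemma has_dim_zass_H1:
  assumes I: "finite I"
    and c: "\<And>i. i \<in> I \<Longrightarrow> density_cocycle m \<mu> (\<Theta> i)"
    and r: "\<And>i f. i \<in> I \<Longrightarrow> f \<in> dp_carrier m \<Longrightarrow> \<Theta> i f \<in> range \<iota>"
    and spanning: "\<And>\<Phi>. density_cocycle m \<mu> \<Phi> \<Longrightarrow> (\<And>f. f \<in> dp_carrier m \<Longrightarrow> \<Phi> f \<in> range \<iota>) \<Longrightarrow>
      \<exists>v c. \<forall>f\<in>dp_carrier m. \<forall>n. \<Phi> f n = density m \<mu> f (\<iota> v) n + (\<Sum>i\<in>I. c i * \<Theta> i f n)"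
    and indep: "\<And>v c i. (\<And>f n. f \<in> dp_carrier m \<Longrightarrow>
      (\<Sum>i\<in>I. c i * \<Theta> i f n) = density m \<mu> f (\<iota> v) n) \<Longrightarrow> i \<in> I \<Longrightarrow> c i = 0"
  shows "has_dim (zass_H1 m sV act) (card I)"
proof -
  let ?Z = "ce_Z1 (zass m) zass_scale commutator sV act"
  let ?ZS = "ce_Z1_space (zass m) zass_scale commutator sV act"
  define \<phi> where "\<phi> i = cocycle_lift (\<Theta> i)" for i
  note crd = zass_eq_dp_vf[OF q_gt_1]
  have \<phi>Z: "\<phi> i \<in> ?Z" if "i \<in> I" for i
    unfolding \<phi>_def using that by (intro cocycle_lift_in_Z1 c r)
  have \<phi>: "\<iota> (\<phi> i D) = \<Theta> i (D (dp_basis 1))" if "i \<in> I" "D \<in> zass m" for i D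
    unfolding \<phi>_def by (rule iota_cocycle_lift[OF that(2) r[OF that(1)]])
  have \<phi>0: "\<phi> i D = 0" if "D \<notin> zass m" for i D
    using that by (simp add: \<phi>_def cocycle_lift_def)
  have comb: "finsum ?ZS (\<lambda>i. a i \<odot>\<^bsub>?ZS\<^esub> \<phi> i) I = (\<lambda>D. \<Sum>i\<in>I. sV (a i) (\<phi> i D))" for a
    using I \<phi>Z by (rule finsum_ce_Z1_space)
  have iota_comb: "\<iota> (\<Sum>i\<in>I. sV (a i) (\<phi> i D)) n = (\<Sum>i\<in>I. a i * \<Theta> i (D (dp_basis 1)) n)"
    if "D \<in> zass m" for a D n
    using that by (auto simp: iota_sum iota_scale \<phi> fun_scale_def intro!: sum.cong)
  have a: "\<iota> (act X v) = density m \<mu> (X (dp_basis 1)) (\<iota> v)" if "X \<in> zass m" for X v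
    using iota_act[OF crd(1)[OF that], of v] unfolding crd(2)[OF that] .
  show ?thesis
    unfolding zass_H1_def ce_H1_def
  proof (rule has_dim_quotient_spaceI[where v = \<phi>])
    show "subspace class_ring (ce_B1 (zass m) act) ?ZS"
      by (rule ce_B1_subspace[OF zass_subspace zass_bracket_closed[OF prime_char]])
    show "\<phi> i \<in> carrier ?ZS" if "i \<in> I" for i using \<phi>Z[OF that] by (simp add: ce_Z1_space_def)
  next
    fix \<psi> assume "\<psi> \<in> carrier ?ZS"
    then have \<psi>: "\<psi> \<in> ?Z" by (simp add: ce_Z1_space_def)
    obtain v b where vb: "\<forall>f\<in>dp_carrier m. \<forall>n.
        \<iota> (\<psi> (dp_vf m f)) n = density m \<mu> f (\<iota> v) n + (\<Sum>i\<in>I. b i * \<Theta> i f n)"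
      using spanning[OF Z1_density_cocycle[OF \<psi>]] by blast
    have "\<psi> D = ce_d0 (zass m) act v D + (\<Sum>i\<in>I. sV (b i) (\<phi> i D))" for D
    proof (cases "D \<in> zass m")
      case True
      have "\<iota> (\<psi> D) = \<iota> (act D v + (\<Sum>i\<in>I. sV (b i) (\<phi> i D)))"
      proof
        fix n
        show "\<iota> (\<psi> D) n = \<iota> (act D v + (\<Sum>i\<in>I. sV (b i) (\<phi> i D))) n"
          using vb[rule_format, OF crd(1)[OF True], of n]
          unfolding iota_add plus_fun_apply iota_comb[OF True] a[OF True] crd(2)[OF True] .
      qed
      then show ?thesis using True injD[OF iota_inj] by (simp add: ce_d0_def)
    next
      case False
      then show ?thesis using \<psi> by (simp add: ce_d0_def \<phi>0 ce_Z1_iff)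
    qed
    then have "\<psi> = ce_d0 (zass m) act v \<oplus>\<^bsub>?ZS\<^esub> finsum ?ZS (\<lambda>i. b i \<odot>\<^bsub>?ZS\<^esub> \<phi> i) I"
      unfolding comb by (simp add: ce_Z1_space_def fun_eq_iff)
    then show "\<exists>c. \<exists>u\<in>ce_B1 (zass m) act. \<psi> = u \<oplus>\<^bsub>?ZS\<^esub> finsum ?ZS (\<lambda>i. c i \<odot>\<^bsub>?ZS\<^esub> \<phi> i) I"
      unfolding ce_B1_def by blast
  next
    fix b i assume i: "i \<in> I" and "finsum ?ZS (\<lambda>i. b i \<odot>\<^bsub>?ZS\<^esub> \<phi> i) I \<in> ce_B1 (zass m) act"
    then obtain v where v: "(\<lambda>D. \<Sum>i\<in>I. sV (b i) (\<phi> i D)) = ce_d0 (zass m) act v"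
      unfolding comb ce_B1_def by blast
    show "b i = 0"
    proof (rule indep[OF _ i])
      fix f :: "nat \<Rightarrow> 'a" and n assume f: "f \<in> dp_carrier m"
      have "(\<Sum>i\<in>I. sV (b i) (\<phi> i (dp_vf m f))) = act (dp_vf m f) v"
        using fun_cong[OF v, of "dp_vf m f"] dp_vf_in_zass[OF f] by (simp add: ce_d0_def)
      then show "(\<Sum>i\<in>I. b i * \<Theta> i f n) = density m \<mu> f (\<iota> v) n"
        using iota_comb[OF dp_vf_in_zass[OF f], of b n] iota_act[OF f, of v]
        unfolding dp_vf_apply_x[OF q_gt_1 f] by simp
    qed
  qed (rule I)
qed

lemma has_dim_zass_H1_full:
  assumes range: "range \<iota> = dp_carrier m"
  shows "has_dim (zass_H1 m sV act) (card (generator_degrees m \<mu>))"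
proof (rule has_dim_zass_H1[where \<Theta> = "\<lambda>k. dp_deriv m ^^ Suc k"])
  fix \<Phi> assume "density_cocycle m \<mu> \<Phi>"
  from density_cocycle_form[OF prime_char char_gt_2 m_pos weight_nonzero this]
  obtain g c where g: "g \<in> dp_carrier m" "\<forall>f\<in>dp_carrier m. \<forall>n. \<Phi> f n = density m \<mu> f g n +
      (\<Sum>k\<in>generator_degrees m \<mu>. c k * (dp_deriv m ^^ Suc k) f n)" by blast
  obtain v where "g = \<iota> v" using g(1) range by auto
  then show "\<exists>v c. \<forall>f\<in>dp_carrier m. \<forall>n. \<Phi> f n = density m \<mu> f (\<iota> v) n +
      (\<Sum>k\<in>generator_degrees m \<mu>. c k * (dp_deriv m ^^ Suc k) f n)"
    using g(2) by blast
next
  fix v c k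
  assume "\<And>f n. f \<in> dp_carrier m \<Longrightarrow>
    (\<Sum>k\<in>generator_degrees m \<mu>. c k * (dp_deriv m ^^ Suc k) f n) = density m \<mu> f (\<iota> v) n"
    and "k \<in> generator_degrees m \<mu>"
  then show "c k = 0"
    using generator_cocycles_independent(2)[OF prime_char char_gt_2 m_pos weight_nonzero iota_carrier] by blast
qed (auto simp: range finite_generator_degrees density_cocycle_generator[OF prime_char]
    dp_carrier_funpow_deriv dp_carrier_deriv simp del: funpow.simps)

text \<open>The additional class is the coboundary of the top basis element: its values are
  derivatives, hence in the submodule, but the element itself is not.\<close>

lemma has_dim_zass_H1_derivatives:
  assumes range: "range \<iota> = {h \<in> dp_carrier m. h (CHAR('a) ^ m - 1) = 0}" and mu: "\<mu> = 1"
  shows "has_dim (zass_H1 m sV act) (Suc (card (generator_degrees m \<mu>)))"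
proof -
  let ?q = "CHAR('a) ^ m" and ?K = "generator_degrees m \<mu>"
  let ?top = "dp_basis (?q - 1) :: nat \<Rightarrow> 'a"
  \<comment> \<open>Index 0 is free for the additional class because generator degrees are
    positive.\<close>
  define \<Theta> where "\<Theta> k = (if k = 0 then (\<lambda>f. density m \<mu> f ?top) else dp_deriv m ^^ Suc k)" for k
  have top: "?top \<in> dp_carrier m" using q_gt_1 by (intro dp_carrier_basis) simp
  have K0: "0 \<notin> ?K" by (simp add: generator_degrees_def)
  have sum: "(\<Sum>k\<in>insert 0 ?K. c k * \<Theta> k f n) =
      c 0 * density m \<mu> f ?top n + (\<Sum>k\<in>?K. c k * (dp_deriv m ^^ Suc k) f n)" for c f n
  proof -
    have "(\<Sum>k\<in>?K. c k * \<Theta> k f n) = (\<Sum>k\<in>?K. c k * (dp_deriv m ^^ Suc k) f n)"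
      using K0 by (intro sum.cong refl) (auto simp: \<Theta>_def)
    then show ?thesis using K0 by (simp add: finite_generator_degrees \<Theta>_def del: funpow.simps)
  qed
  have "has_dim (zass_H1 m sV act) (card (insert 0 ?K))"
  proof (rule has_dim_zass_H1[where \<Theta> = \<Theta>])
    show "density_cocycle m \<mu> (\<Theta> k)" if "k \<in> insert 0 ?K" for k
      using that K0 density_cocycle_generator[OF prime_char, of k m \<mu>]
        density_cocycle_coboundary[OF prime_char, of m \<mu> ?top]
      unfolding \<Theta>_def by (cases "k = 0") (simp_all del: funpow.simps)
    show "\<Theta> k f \<in> range \<iota>" if f: "f \<in> dp_carrier m" for k f
      unfolding range using f
      by (auto simp: \<Theta>_def mu density_1_eq_deriv[OF prime_char] dp_carrier_intros)
        (auto simp: dp_deriv_def)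
  next
    fix \<Phi> assume "density_cocycle m \<mu> \<Phi>"
    from density_cocycle_form[OF prime_char char_gt_2 m_pos weight_nonzero this]
  obtain g c where g: "g \<in> dp_carrier m" "\<forall>f\<in>dp_carrier m. \<forall>n. \<Phi> f n = density m \<mu> f g n +
        (\<Sum>k\<in>?K. c k * (dp_deriv m ^^ Suc k) f n)" by blast
    \<comment> \<open>Splits \<open>g\<close> into an element of the submodule and a multiple of the
      top element, whose coboundary is the additional class.\<close>
    define h where "h = g - fun_scale (*) (g (?q - 1)) ?top"
    have "h \<in> dp_carrier m" unfolding h_def by (intro dp_carrier_diff dp_carrier_scale g(1) top)
    moreover have "h (?q - 1) = 0" by (simp add: h_def fun_scale_def dp_basis_apply)
    ultimately have "h \<in> range \<iota>" unfolding range by simp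
    then obtain v where v: "h = \<iota> v" by blast
    have dg: "density m \<mu> f g n = density m \<mu> f (\<iota> v) n + g (?q - 1) * density m \<mu> f ?top n" for f n
    proof -
      have "g = \<iota> v + fun_scale (*) (g (?q - 1)) ?top" by (simp flip: v add: h_def)
      then have "density m \<mu> f g = density m \<mu> f (\<iota> v + fun_scale (*) (g (?q - 1)) ?top)"
        by (rule arg_cong)
      then show ?thesis
        unfolding density_add_right density_scale_right by (simp add: fun_scale_def)
    qed
    have "\<Phi> f n = density m \<mu> f (\<iota> v) n + (\<Sum>k\<in>insert 0 ?K. (c(0 := g (?q - 1))) k * \<Theta> k f n)"
      if "f \<in> dp_carrier m" for f n
    proof -
      have "(\<Sum>k\<in>?K. (c(0 := g (?q - 1))) k * (dp_deriv m ^^ Suc k) f n) =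
          (\<Sum>k\<in>?K. c k * (dp_deriv m ^^ Suc k) f n)"
        using K0 by (intro sum.cong refl) auto
      then show ?thesis unfolding sum g(2)[rule_format, OF that] dg by simp
    qed
    then show "\<exists>v c. \<forall>f\<in>dp_carrier m. \<forall>n. \<Phi> f n = density m \<mu> f (\<iota> v) n +
        (\<Sum>k\<in>insert 0 ?K. c k * \<Theta> k f n)" by blast
  next
    fix v c k
    assume eq: "\<And>f n. f \<in> dp_carrier m \<Longrightarrow>
      (\<Sum>k\<in>insert 0 ?K. c k * \<Theta> k f n) = density m \<mu> f (\<iota> v) n" and k: "k \<in> insert 0 ?K"
    define h where "h = \<iota> v - fun_scale (*) (c 0) ?top"
    have h: "h \<in> dp_carrier m"
      unfolding h_def using iota_carrier top by (intro dp_carrier_diff dp_carrier_scale)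
    have eq': "(\<Sum>k\<in>?K. c k * (dp_deriv m ^^ Suc k) f n) = density m \<mu> f h n" if "f \<in> dp_carrier m" for f n
      using eq[OF that, of n] unfolding sum h_def density_diff_right density_scale_right
      by (simp add: fun_scale_def algebra_simps del: funpow.simps)
    note ind = generator_cocycles_independent[OF prime_char char_gt_2 m_pos weight_nonzero h eq']
    \<comment> \<open>Since \<open>h = 0\<close> and \<open>\<iota> v\<close> has no top
      coefficient, the multiple of the top element is zero.\<close>
    have "\<iota> v (?q - 1) = 0" using rangeI[of \<iota> v] unfolding range by simp
    moreover have "h (?q - 1) = 0" using ind(1) by simp
    ultimately have "c 0 = 0" by (simp add: h_def fun_scale_def dp_basis_apply)
    then show "c k = 0" using k ind(2) by auto
  qed (simp add: finite_generator_degrees)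
  then show ?thesis using K0 by (simp add: finite_generator_degrees)
qed

end

section \<open>The simple modules\<close>

text \<open>\<open>q\<close> is a parameter tied to the power of the characteristic by a simp rule,
  so that the simplifier treats it as an atom.\<close>

locale zass_highest_weight = simple_lie_module "zass m" zass_scale commutator sV act
  for m :: nat and sV :: "'a::field \<Rightarrow> 'v::ab_group_add \<Rightarrow> 'v"
    and act :: "((nat \<Rightarrow> 'a) \<Rightarrow> (nat \<Rightarrow> 'a)) \<Rightarrow> 'v \<Rightarrow> 'v" +
  fixes lam :: 'a and v0 :: 'v and q :: nat
  assumes prime_char: "prime CHAR('a)" and char_gt_2: "CHAR('a) > 2" and m_pos: "m > 0"
    and char_power [simp]: "CHAR('a) ^ m = q"
    and v0_nonzero: "v0 \<noteq> 0"
    and v0_nilpotent: "(act (zass_e m (-1)) ^^ q) v0 = 0"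
    and v0_weight: "act (zass_e m 0) v0 = sV lam v0"
    and v0_highest: "1 \<le> i \<Longrightarrow> i \<le> int q - 2 \<Longrightarrow> act (zass_e m i) v0 = 0"
begin

abbreviation top_elt :: "nat \<Rightarrow> 'a" where "top_elt \<equiv> dp_basis (q - 1)"

lemma of_nat_q: "of_nat q = (0 :: 'a)"
proof -
  have "of_nat (CHAR('a) ^ m) = (0 :: 'a)" using m_pos by (simp del: char_power)
  then show ?thesis by simp
qed

lemma q_gt_2: "2 < q"
  using char_gt_2 m_pos self_le_power[of "CHAR('a)" m] by simp

lemma of_nat_q_minus_1: "of_nat (q - 1) = (- 1 :: 'a)"
  using of_nat_q q_gt_2 by (simp add: of_nat_diff)

lemma basis_carrier: "a < q \<Longrightarrow> (dp_basis a :: nat \<Rightarrow> 'a) \<in> dp_carrier m"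
  by (rule dp_carrier_basis) simp

lemma one_in_carrier: "(dp_basis 0 :: nat \<Rightarrow> 'a) \<in> dp_carrier m"
  using q_gt_2 by (intro basis_carrier) linarith

lemma top_in_carrier: "top_elt \<in> dp_carrier m"
  using q_gt_2 by (intro basis_carrier) linarith

lemma zass_e_basis: "zass_e m (int a - 1) = (dp_vf m (dp_basis a) :: (nat \<Rightarrow> 'a) \<Rightarrow> _)"
  by (simp add: zass_e_def)

section \<open>\<open>S(\<lambda>)\<close> as a quotient of the densities of weight
  \<open>\<lambda> + 1\<close>\<close>

lemma act_dp_vf_add:
  "f \<in> dp_carrier m \<Longrightarrow> g \<in> dp_carrier m \<Longrightarrow> act (dp_vf m (f + g)) v = act (dp_vf m f) v + act (dp_vf m g) v"
  unfolding dp_vf_add by (intro act_add_left dp_vf_in_zass)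

lemma act_dp_vf_scale:
  "f \<in> dp_carrier m \<Longrightarrow> act (dp_vf m (fun_scale (*) c f)) v = sV c (act (dp_vf m f) v)"
  unfolding dp_vf_scale by (intro act_scale_left dp_vf_in_zass)

lemma act_dp_vf_bracket:
  "f \<in> dp_carrier m \<Longrightarrow> g \<in> dp_carrier m \<Longrightarrow>
    act (dp_vf m (dp_bracket m f g)) v = act (dp_vf m f) (act (dp_vf m g) v) - act (dp_vf m g) (act (dp_vf m f) v)"
  unfolding commutator_dp_vf[OF prime_char, symmetric] by (intro act_bracket dp_vf_in_zass)

text \<open>Since \<open>\<partial>\<close> lowers the degree by one, \<open>e\<^sub>-\<^sub>1\<^sup>k v0\<close> has to be the image of \<open>x\<^sup>(\<^sup>q\<^sup>-\<^sup>1\<^sup>-\<^sup>k\<^sup>)\<close>.\<close>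

definition present :: "(nat \<Rightarrow> 'a) \<Rightarrow> 'v"
  where "present h = (\<Sum>a<q. sV (h a) ((act (zass_e m (-1)) ^^ (q - 1 - a)) v0))"

lemma present_add: "present (g + h) = present g + present h"
  by (simp add: present_def V.scale_left_distrib sum.distrib)

lemma present_scale: "present (fun_scale (*) c h) = sV c (present h)"
  by (simp add: present_def fun_scale_def V.scale_sum_right)

lemma present_diff: "present (g - h) = present g - present h"
  by (simp add: present_def V.scale_left_diff_distrib sum_subtractf)

lemma present_zero: "present 0 = 0"
  by (simp add: present_def)

lemma present_top: "present top_elt = v0"
proof -
  have "present top_elt = (\<Sum>a\<in>{q - 1}. sV (top_elt a) ((act (zass_e m (-1)) ^^ (q - 1 - a)) v0))"
    unfolding present_def using q_gt_2 by (intro sum.mono_neutral_right) (auto simp: dp_basis_apply)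
  then show ?thesis by (simp add: dp_basis_apply)
qed

text \<open>Shifting coefficients matches raising the power of \<open>e\<^sub>-\<^sub>1\<close>
  except at the constant term, where the \<open>q\<close>-th power appears; it kills
  \<open>v0\<close>.\<close>

lemma present_deriv:
  assumes h: "h \<in> dp_carrier m"
  shows "present (dp_deriv m h) = act (dp_vf m (dp_basis 0)) (present h)"
proof -
  let ?E = "act (zass_e m (-1))"
  let ?w = "\<lambda>k. (?E ^^ k) v0"
  have E: "zass_e m (-1) = (dp_vf m (dp_basis 0) :: (nat \<Rightarrow> 'a) \<Rightarrow> _)" by (simp add: zass_e_def)
  have Ez: "(zass_e m (-1) :: (nat \<Rightarrow> 'a) \<Rightarrow> _) \<in> zass m" unfolding E by (rule dp_vf_in_zass[OF one_in_carrier])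
  obtain r where r: "q = Suc r" using q_gt_2 by (cases q) auto
  have sumE: "?E (\<Sum>a\<in>A. g a) = (\<Sum>a\<in>A. ?E (g a))" for g and A :: "nat set"
    using Ez by (induction A rule: infinite_finite_induct) (auto simp: act_add_right)
  have "?E (present h) = (\<Sum>a<q. sV (h a) (?w (Suc (q - 1 - a))))"
    unfolding present_def sumE using Ez by (simp add: act_scale_right)
  also have "\<dots> = sV (h 0) (?w q) + (\<Sum>a<r. sV (h (Suc a)) (?w (Suc (q - 1 - Suc a))))"
    unfolding r by (subst sum.lessThan_Suc_shift) simp
  also have "(\<Sum>a<r. sV (h (Suc a)) (?w (Suc (q - 1 - Suc a)))) = (\<Sum>a<r. sV (h (Suc a)) (?w (q - 1 - a)))"
    unfolding r by (intro sum.cong refl) (simp add: Suc_diff_Suc del: funpow.simps)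
  also have "\<dots> = (\<Sum>a<q. sV (h (Suc a)) (?w (q - 1 - a)))"
  proof -
    have "h (Suc r) = 0" using h r by (simp add: dp_carrier_def)
    then show ?thesis unfolding r by simp
  qed
  also have "\<dots> = present (dp_deriv m h)"
    unfolding present_def using h by (simp add: dp_deriv_apply)
  finally show ?thesis using v0_nilpotent unfolding E by simp
qed

lemma dp_linear_eqI:
  assumes "\<And>f g. f \<in> dp_carrier m \<Longrightarrow> g \<in> dp_carrier m \<Longrightarrow> \<Phi> (f + g) = \<Phi> f + \<Phi> g"
    and "\<And>c f. f \<in> dp_carrier m \<Longrightarrow> \<Phi> (fun_scale (*) c f) = sV c (\<Phi> f)"
    and "\<And>f g. f \<in> dp_carrier m \<Longrightarrow> g \<in> dp_carrier m \<Longrightarrow> \<Psi> (f + g) = \<Psi> f + \<Psi> g"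
    and "\<And>c f. f \<in> dp_carrier m \<Longrightarrow> \<Psi> (fun_scale (*) c f) = sV c (\<Psi> f)"
    and "\<And>k. k < q \<Longrightarrow> \<Phi> (dp_basis k) = \<Psi> (dp_basis k)" and f: "f \<in> dp_carrier m"
  shows "\<Phi> f = \<Psi> f"
proof -
  have "\<Phi> f = (\<Sum>k<q. sV (f k) (\<Phi> (dp_basis k)))"
    using dp_linear_expansion[OF V.vector_space_axioms assms(1,2) f] unfolding char_power .
  also have "\<dots> = (\<Sum>k<q. sV (f k) (\<Psi> (dp_basis k)))" using assms(5) by simp
  also have "\<dots> = \<Psi> f"
    using dp_linear_expansion[OF V.vector_space_axioms assms(3,4) f] unfolding char_power by (rule sym)
  finally show ?thesis .
qed

text \<open>By linearity \<open>f\<close> is tested on the basis. The weight is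
  \<open>lam + 1\<close> because the top element has degree \<open>q - 1\<close>, which is -1 in the
  field.\<close>

lemma act_present_top:
  assumes f: "f \<in> dp_carrier m"
  shows "act (dp_vf m f) (present top_elt) = present (density m (lam + 1) f top_elt)"
proof (rule dp_linear_eqI[OF _ _ _ _ _ f])
  note top = top_in_carrier
  fix k assume k: "k < q"
  consider "k = 0" | "k = 1" | "2 \<le> k" by linarith
  then show "act (dp_vf m (dp_basis k)) (present top_elt) =
      present (density m (lam + 1) (dp_basis k) top_elt)"
  proof cases
    case 1
    show ?thesis unfolding 1 density_one_left present_deriv[OF top] ..
  next
    case 2
    have "density m (lam + 1) (dp_basis 1) top_elt = fun_scale (*) lam top_elt"
    proof
      fix n
      show "density m (lam + 1) (dp_basis 1) top_elt n = fun_scale (*) lam top_elt n"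
      proof (cases "n < q")
        case True
        then have "density m (lam + 1) (dp_basis 1) top_elt n = (of_nat n + (lam + 1)) * top_elt n"
          using q_gt_2 by (intro density_x_apply top) auto
        then show ?thesis using of_nat_q_minus_1 by (cases "n = q - 1") (simp_all add: fun_scale_def dp_basis_apply)
      next
        case False
        then show ?thesis using dp_carrier_density[of m "lam + 1" "dp_basis 1" top_elt] q_gt_2
          by (auto simp: dp_carrier_def fun_scale_def dp_basis_apply)
      qed
    qed
    then show ?thesis
      using v0_weight zass_e_basis[of 1] 2 by (simp add: present_scale present_top del: One_nat_def)
  next
    case 3
    obtain j where j: "k = Suc j" "j \<ge> 1" using 3 by (cases k) auto
    obtain r where r: "q - 1 = Suc r" using q_gt_2 by (cases "q - 1") auto
    \<comment> \<open>Both products have degree \<open>k + q - 2\<close>, out of range for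
      \<open>k \<ge> 2\<close>; on the module side \<open>v0\<close> is killed.\<close>
    have "dp_mult m (dp_basis k) (dp_deriv m top_elt) = 0" "dp_mult m (dp_deriv m (dp_basis k)) top_elt = 0"
      using j r k q_gt_2 by (simp_all add: dp_deriv_basis_Suc dp_mult_basis)
    then have "density m (lam + 1) (dp_basis k) top_elt = 0"
      by (simp add: density_def fun_scale_def fun_eq_iff)
    moreover have "act (zass_e m (int k - 1)) v0 = 0" using 3 k by (intro v0_highest) linarith+
    ultimately show ?thesis by (simp add: present_top present_zero zass_e_basis del: One_nat_def)
  qed
qed (auto simp only: act_dp_vf_add act_dp_vf_scale density_add_left density_scale_left present_add present_scale)

text \<open>Descends from the top degree: \<open>dp_basis a\<close> is the derivative of
  \<open>dp_basis (Suc a)\<close>, and moving \<open>f\<close> past \<open>e\<^sub>-\<^sub>1\<close>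
  costs a bracket. The induction hypothesis is needed for that bracket too, so \<open>f\<close>
  stays arbitrary.\<close>

lemma act_present_basis:
  assumes "a < q" "f \<in> dp_carrier m"
  shows "act (dp_vf m f) (present (dp_basis a)) = present (density m (lam + 1) f (dp_basis a))"
proof -
  have "a \<le> q - 1" using assms(1) by simp
  then show ?thesis
    using assms(2)
  proof (induction a arbitrary: f rule: inc_induct)
    case base
    then show ?case by (rule act_present_top)
  next
    case (step a)
    let ?h = "dp_basis (Suc a) :: nat \<Rightarrow> 'a" and ?\<mu> = "lam + 1"
    let ?d = "dp_basis 0 :: nat \<Rightarrow> 'a"
    have Sa: "Suc a < q" using step by simp
    have h: "?h \<in> dp_carrier m" using Sa by (rule basis_carrier)
    have d: "dp_basis a = dp_deriv m ?h" using Sa by (simp add: dp_deriv_basis_Suc)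
    have "act (dp_vf m f) (act (dp_vf m ?d) (present ?h)) =
        act (dp_vf m ?d) (act (dp_vf m f) (present ?h)) - act (dp_vf m (dp_bracket m ?d f)) (present ?h)"
      using act_dp_vf_bracket[OF one_in_carrier step.prems, of "present ?h"] by simp
    also have "\<dots> = act (dp_vf m ?d) (present (density m ?\<mu> f ?h)) - present (density m ?\<mu> (dp_bracket m ?d f) ?h)"
      by (simp only: step.IH[OF step.prems] step.IH[OF dp_carrier_bracket])
    also have "\<dots> = present (density m ?\<mu> ?d (density m ?\<mu> f ?h) - density m ?\<mu> (dp_bracket m ?d f) ?h)"
      by (simp only: present_diff density_one_left present_deriv[OF dp_carrier_density])
    also have "density m ?\<mu> ?d (density m ?\<mu> f ?h) - density m ?\<mu> (dp_bracket m ?d f) ?h =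
        density m ?\<mu> f (dp_deriv m ?h)"
      unfolding density_bracket[OF prime_char] by (simp add: density_one_left)
    finally show ?case unfolding d present_deriv[OF h] .
  qed
qed

lemma act_present:
  assumes f: "f \<in> dp_carrier m" and h: "h \<in> dp_carrier m"
  shows "act (dp_vf m f) (present h) = present (density m (lam + 1) f h)"
proof (rule dp_linear_eqI[OF _ _ _ _ _ h])
  fix k assume "k < q"
  then show "act (dp_vf m f) (present (dp_basis k)) = present (density m (lam + 1) f (dp_basis k))"
    using f by (rule act_present_basis)
qed (simp_all only: present_add present_scale act_add_right[OF dp_vf_in_zass[OF f]]
    act_scale_right[OF dp_vf_in_zass[OF f]] density_add_right density_scale_right)

text \<open>An equivariant image of a submodule is a submodule of a simple module. This is applied
  to all densities, to the constants and to the derivatives.\<close>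

lemma present_image_trivial_or_all:
  assumes N: "N \<subseteq> dp_carrier m" "0 \<in> N" "\<And>g h. g \<in> N \<Longrightarrow> h \<in> N \<Longrightarrow> g + h \<in> N"
    "\<And>c h. h \<in> N \<Longrightarrow> fun_scale (*) c h \<in> N"
    "\<And>f h. f \<in> dp_carrier m \<Longrightarrow> h \<in> N \<Longrightarrow> density m (lam + 1) f h \<in> N"
  shows "present ` N = {0} \<or> present ` N = UNIV"
proof (rule irreducible)
  show "V.subspace (present ` N)"
    unfolding V.subspace_def
  proof (intro conjI ballI allI)
    show "0 \<in> present ` N" using N(2) present_zero by force
    show "x + y \<in> present ` N" if "x \<in> present ` N" "y \<in> present ` N" for x y
      using that N(3) by (auto simp flip: present_add)
    show "sV c x \<in> present ` N" if "x \<in> present ` N" for c x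
      using that N(4) by (auto simp flip: present_scale)
  qed
  show "act D u \<in> present ` N" if D: "D \<in> zass m" and u: "u \<in> present ` N" for D u
  proof -
    obtain f where "f \<in> dp_carrier m" "D = dp_vf m f" using D unfolding zass_def by blast
    moreover obtain h where "h \<in> N" "u = present h" using u by blast
    ultimately show ?thesis using act_present[of f h] N(1,5) by auto
  qed
qed

lemma present_surj: "present ` dp_carrier m = UNIV"
proof -
  have "v0 \<in> present ` dp_carrier m"
    by (rule image_eqI[OF _ top_in_carrier]) (simp only: present_top)
  moreover have "present ` dp_carrier m = {0} \<or> present ` dp_carrier m = UNIV"
    by (intro present_image_trivial_or_all order_refl dp_carrier_zero dp_carrier_add dp_carrier_scale
        dp_carrier_density)
  ultimately show ?thesis using v0_nonzero by blast
qed

section \<open>The kernel of the presentation\<close>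

definition kernel :: "(nat \<Rightarrow> 'a) set"
  where "kernel = {h \<in> dp_carrier m. present h = 0}"

lemma kernel_diff: "g \<in> kernel \<Longrightarrow> h \<in> kernel \<Longrightarrow> g - h \<in> kernel"
  by (simp add: kernel_def dp_carrier_diff present_diff)

lemma kernel_scale: "h \<in> kernel \<Longrightarrow> fun_scale (*) c h \<in> kernel"
  by (simp add: kernel_def dp_carrier_scale present_scale)

lemma kernel_density:
  assumes f: "f \<in> dp_carrier m" and h: "h \<in> kernel"
  shows "density m (lam + 1) f h \<in> kernel"
proof -
  have "h \<in> dp_carrier m" "present h = 0" using h by (simp_all add: kernel_def)
  then have "present (density m (lam + 1) f h) = 0"
    using act_present[OF f, of h] dp_vf_in_zass[OF f] by simp
  then show ?thesis by (simp add: kernel_def dp_carrier_density)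
qed

lemma kernel_scaleD:
  assumes "fun_scale (*) c h \<in> kernel" "c \<noteq> 0"
  shows "h \<in> kernel"
proof -
  have "fun_scale (*) (1 / c) (fun_scale (*) c h) = h" using assms(2) by (simp add: fun_scale_def)
  with kernel_scale[OF assms(1), of "1 / c"] show ?thesis by simp
qed

lemma kernel_funpow_deriv: "h \<in> kernel \<Longrightarrow> (dp_deriv m ^^ n) h \<in> kernel"
proof (induction n)
  case (Suc n)
  then show ?case using kernel_density[OF one_in_carrier] by (simp add: density_one_left)
qed simp

lemma top_not_in_kernel: "top_elt \<notin> kernel"
  using present_top v0_nonzero by (simp add: kernel_def)

text \<open>The kernel is closed under the derivation, so a leading term can be lowered to any
  smaller degree.\<close>

lemma kernel_leading:
  assumes h: "h \<in> kernel" "h n \<noteq> 0" "j \<le> n"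
  shows "\<exists>g\<in>kernel. (\<forall>i>j. g i = 0) \<and> g j \<noteq> 0"
proof -
  have hc: "h \<in> dp_carrier m" using h(1) by (simp add: kernel_def)
  have bd: "i < q" if "h i \<noteq> 0" for i
    by (rule ccontr) (use that hc in \<open>auto simp: dp_carrier_def\<close>)
  define a where "a = Max {i. h i \<noteq> 0}"
  have fin: "finite {i. h i \<noteq> 0}" by (rule finite_subset[of _ "{..<q}"]) (use bd in auto)
  have "a \<in> {i. h i \<noteq> 0}" unfolding a_def using h(2) by (intro Max_in fin) blast
  then have a1: "h a \<noteq> 0" by simp
  have a2: "n \<le> a" unfolding a_def using h(2) by (intro Max_ge fin) simp
  have above: "h i = 0" if "a < i" for i
  proof (rule ccontr)
    assume "h i \<noteq> 0"
    then have "i \<le> a" unfolding a_def by (intro Max_ge fin) simp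
    with that show False by simp
  qed
  show ?thesis
  proof (intro bexI conjI allI impI)
    show "(dp_deriv m ^^ (a - j)) h i = 0" if "j < i" for i
    proof -
      have "a < i + (a - j)" using that h(3) a2 by linarith
      then show ?thesis unfolding funpow_dp_deriv_apply[OF hc] by (rule above)
    qed
    show "(dp_deriv m ^^ (a - j)) h j \<noteq> 0"
      using a1 a2 h(3) unfolding funpow_dp_deriv_apply[OF hc] by simp
  qed (rule kernel_funpow_deriv[OF h(1)])
qed

lemma one_in_kernel:
  assumes "h \<in> kernel" "h \<noteq> 0"
  shows "dp_basis 0 \<in> kernel"
proof -
  have "\<exists>n. h n \<noteq> 0"
  proof (rule ccontr)
    assume "\<nexists>n. h n \<noteq> 0"
    then have "h = 0" by (intro ext) simp
    with assms(2) show False by contradiction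
  qed
  then obtain n where n: "h n \<noteq> 0" ..
  from kernel_leading[OF assms(1) n le0] show ?thesis
  proof (elim bexE conjE)
    fix g assume g: "g \<in> kernel" "\<forall>i>0. g i = 0" "g 0 \<noteq> 0"
    have "fun_scale (*) (g 0) (dp_basis 0) = g"
    proof
      fix i
      show "fun_scale (*) (g 0) (dp_basis 0) i = g i"
        using g(2) by (cases "i = 0") (simp_all add: fun_scale_def dp_basis_apply)
    qed
    with g(1) have "fun_scale (*) (g 0) (dp_basis 0) \<in> kernel" by simp
    then show "dp_basis 0 \<in> kernel" using g(3) by (rule kernel_scaleD)
  qed
qed

text \<open>A non-zero kernel contains 1, then \<open>x\<close> by the action of
  \<open>e\<^sub>1\<close>, then the top element by that of the top vector field, contradicting
  \<open>v0 \<noteq> 0\<close>. The scalars to be divided out are \<open>lam + 1\<close> and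
  \<open>- lam\<close>.\<close>

lemma kernel_trivial:
  assumes "lam \<noteq> 0" "lam \<noteq> - 1"
  shows "kernel = {0}"
proof (rule ccontr)
  assume "kernel \<noteq> {0}"
  moreover have "0 \<in> kernel" by (simp add: kernel_def dp_carrier_zero present_zero)
  ultimately have "\<exists>h. h \<in> kernel \<and> h \<noteq> 0" by blast
  then obtain h where "h \<in> kernel" "h \<noteq> 0" by blast
  then have one: "dp_basis 0 \<in> kernel" by (rule one_in_kernel)
  have mu: "lam + 1 \<noteq> 0" using assms(2) by (simp add: eq_neg_iff_add_eq_0)
  have "density m (lam + 1) (dp_basis 2) (dp_basis 0) = fun_scale (*) (lam + 1) (dp_basis 1)"
    unfolding density_one_right using q_gt_2 dp_deriv_basis_Suc[of 1 m, where 'a = 'a] by (simp add: numeral_2_eq_2)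
  then have "fun_scale (*) (lam + 1) (dp_basis 1) \<in> kernel"
    using kernel_density[OF basis_carrier one, of 2] q_gt_2 by simp
  then have "dp_basis 1 \<in> kernel" by (rule kernel_scaleD) (rule mu)
  then have "density m (lam + 1) top_elt (dp_basis 1) \<in> kernel"
    using q_gt_2 by (intro kernel_density basis_carrier) auto
  moreover have "density m (lam + 1) top_elt (dp_basis 1) = fun_scale (*) (- lam) top_elt"
  proof -
    have "q = Suc (Suc (q - 2))" using q_gt_2 by linarith
    then obtain r where r: "q = Suc (Suc r)" by blast
    \<comment> \<open>The scalar is \<open>1 + (lam + 1) (q - 1)\<close>, which is
      \<open>- lam\<close> because \<open>q\<close> is zero in the field.\<close>
    have "(of_nat r :: 'a) = - 2" using of_nat_q unfolding r by (simp add: eq_neg_iff_add_eq_0 add.commute)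
    then show ?thesis
      using dp_mult_commute[of m top_elt "dp_basis 0"] q_gt_2 r basis_carrier[of "q - 1"]
      by (simp add: density_def dp_deriv_basis_Suc dp_mult_basis dp_mult_one)
        (simp add: fun_scale_def fun_eq_iff algebra_simps)
  qed
  ultimately have "fun_scale (*) (- lam) top_elt \<in> kernel" by simp
  then have "top_elt \<in> kernel" by (rule kernel_scaleD) (use assms(1) in simp)
  then show False using top_not_in_kernel by contradiction
qed

text \<open>An intertwiner \<open>T\<close> with the same kernel as \<open>present\<close> factors
  through the module and embeds it. The section \<open>s\<close> may be arbitrary, since
  \<open>T\<close> agrees on all preimages of a vector.\<close>

lemma embedding_through_present:
  assumes mu: "\<mu> \<noteq> 0"
    and T_carrier: "\<And>h. h \<in> dp_carrier m \<Longrightarrow> T h \<in> dp_carrier m"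
    and T_add: "\<And>g h. T (g + h) = T g + T h"
    and T_scale: "\<And>c h. T (fun_scale (*) c h) = fun_scale (*) c (T h)"
    and T_kernel: "\<And>h. h \<in> dp_carrier m \<Longrightarrow> T h = 0 \<longleftrightarrow> present h = 0"
    and T_density: "\<And>f h. density m \<mu> f (T h) = T (density m (lam + 1) f h)"
  shows "\<exists>\<iota>. zass_density_embedding m sV act \<mu> \<iota> \<and> range \<iota> = T ` dp_carrier m"
proof -
  define s where "s w = inv_into (dp_carrier m) present w" for w
  have s: "s w \<in> dp_carrier m" "present (s w) = w" for w
    unfolding s_def using present_surj inv_into_into[of w present] f_inv_into_f[of w present] by auto
  have T_diff: "T (g - h) = T g - T h" for g h
    using T_add[of "g - h" h] by (simp add: algebra_simps)
  have eqI: "T g = T h" if "g \<in> dp_carrier m" "h \<in> dp_carrier m" "present g = present h" for g h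
  proof -
    have "T (g - h) = 0"
      using that by (subst T_kernel) (simp_all only: dp_carrier_diff present_diff diff_self)
    then show ?thesis using T_diff[of g h] by simp
  qed
  let ?i = "\<lambda>w. T (s w)"
  have "zass_density_embedding m sV act \<mu> ?i"
  proof
    show "?i (v + w) = ?i v + ?i w" for v w
      unfolding T_add[symmetric]
      by (rule eqI) (simp_all only: s dp_carrier_add present_add)
    show "?i (sV c v) = fun_scale (*) c (?i v)" for c v
      unfolding T_scale[symmetric]
      by (rule eqI) (simp_all only: s dp_carrier_scale present_scale)
    show "inj ?i"
    proof (rule injI)
      fix v w assume "?i v = ?i w"
      then have "T (s v - s w) = 0" using T_diff[of "s v" "s w"] by simp
      then have "present (s v - s w) = 0" using T_kernel[OF dp_carrier_diff[OF s(1) s(1)]] by blast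
      then show "v = w" by (simp add: present_diff s(2))
    qed
    show "?i v \<in> dp_carrier m" for v by (rule T_carrier[OF s(1)])
    show "?i (act (dp_vf m f) v) = density m \<mu> f (?i v)" if f: "f \<in> dp_carrier m" for f v
      unfolding T_density
    proof (rule eqI)
      show "present (s (act (dp_vf m f) v)) = present (density m (lam + 1) f (s v))"
        using act_present[OF f s(1)[of v]] by (simp add: s(2))
    qed (simp_all only: s dp_carrier_density)
  qed (rule prime_char char_gt_2 m_pos mu)+
  moreover have "range ?i = T ` dp_carrier m"
  proof (intro equalityI subsetI)
    show "y \<in> T ` dp_carrier m" if "y \<in> range ?i" for y using that s(1) by blast
    show "y \<in> range ?i" if y: "y \<in> T ` dp_carrier m" for y
    proof -
      obtain h where h: "h \<in> dp_carrier m" "y = T h" using y by blast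
      have "T (s (present h)) = T h" by (rule eqI) (simp_all only: s h)
      with h(2) have "y = T (s (present h))" by simp
      then show ?thesis by (rule range_eqI)
    qed
  qed
  ultimately show ?thesis by blast
qed

section \<open>Cohomology for each kind of weight\<close>

lemma has_dim_H1_generic:
  assumes "lam \<noteq> 0" "lam \<noteq> - 1"
  shows "has_dim (zass_H1 m sV act) (card (generator_degrees m (lam + 1)))"
proof -
  have mu: "lam + 1 \<noteq> 0" using assms(2) by (simp add: eq_neg_iff_add_eq_0)
  have ker: "h = 0 \<longleftrightarrow> present h = 0" if "h \<in> dp_carrier m" for h
    using kernel_trivial[OF assms] that present_zero unfolding kernel_def by auto
  have "\<exists>\<iota>. zass_density_embedding m sV act (lam + 1) \<iota> \<and> range \<iota> = (\<lambda>h. h) ` dp_carrier m"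
    by (rule embedding_through_present[OF mu]) (simp_all only: ker)
  then obtain \<iota> where emb: "zass_density_embedding m sV act (lam + 1) \<iota>"
    and range: "range \<iota> = (\<lambda>h. h) ` dp_carrier m" by blast
  interpret zass_density_embedding m sV act "lam + 1" \<iota> by (rule emb)
  show ?thesis using has_dim_zass_H1_full range by simp
qed

text \<open>In weight 0 the constants form a trivial submodule, with image zero or everything. The
  image cannot contain \<open>v0\<close>, on which \<open>e\<^sub>0\<close> acts by -1.\<close>

lemma one_in_kernel_minus_one:
  assumes lam: "lam = - 1"
  shows "dp_basis 0 \<in> kernel"
proof -
  have z: "density m (lam + 1) f (dp_basis 0) = 0" for f
    unfolding density_one_right lam by (simp add: fun_scale_def fun_eq_iff)
  let ?N = "range (\<lambda>c. fun_scale (*) c (dp_basis 0 :: nat \<Rightarrow> 'a))"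
  have "present ` ?N = {0} \<or> present ` ?N = UNIV"
  proof (rule present_image_trivial_or_all)
    show "?N \<subseteq> dp_carrier m" using one_in_carrier dp_carrier_scale by blast
    have "(0 :: nat \<Rightarrow> 'a) = fun_scale (*) 0 (dp_basis 0)" by (simp add: fun_scale_def fun_eq_iff)
    then show zero: "0 \<in> ?N" by blast
    show "g + h \<in> ?N" if g: "g \<in> ?N" and h: "h \<in> ?N" for g h
    proof -
      obtain a where "g = fun_scale (*) a (dp_basis 0)" using g by (rule imageE)
      moreover obtain b where "h = fun_scale (*) b (dp_basis 0)" using h by (rule imageE)
      ultimately have "g + h = fun_scale (*) (a + b) (dp_basis 0)"
        by (simp add: fun_scale_def fun_eq_iff algebra_simps)
      then show ?thesis by blast
    qed
    show "fun_scale (*) c h \<in> ?N" if h: "h \<in> ?N" for c h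
    proof -
      obtain a where "h = fun_scale (*) a (dp_basis 0)" using h by (rule imageE)
      then have "fun_scale (*) c h = fun_scale (*) (c * a) (dp_basis 0)"
        by (simp add: fun_scale_def fun_eq_iff)
      then show ?thesis by blast
    qed
    show "density m (lam + 1) f h \<in> ?N" if h: "h \<in> ?N" for f h
    proof -
      obtain a where "h = fun_scale (*) a (dp_basis 0)" using h by (rule imageE)
      then have "density m (lam + 1) f h = 0"
        by (simp add: density_scale_right z) (simp add: fun_scale_def fun_eq_iff)
      then show ?thesis using zero by simp
    qed
  qed
  moreover have "present ` ?N \<noteq> UNIV"
  proof
    assume "present ` ?N = UNIV"
    then have "v0 \<in> range (\<lambda>c. sV c (present (dp_basis 0)))"
      by (simp only: image_image present_scale UNIV_I)
    then obtain c where c: "v0 = sV c (present (dp_basis 0))" by (rule imageE)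
    have x: "(dp_basis 1 :: nat \<Rightarrow> 'a) \<in> dp_carrier m" using q_gt_2 by (intro basis_carrier) linarith
    have "act (dp_vf m (dp_basis 1)) v0 = act (dp_vf m (dp_basis 1)) (sV c (present (dp_basis 0)))"
      by (rule arg_cong[OF c])
    also have "\<dots> = 0"
      unfolding act_scale_right[OF dp_vf_in_zass[OF x]] act_present[OF x one_in_carrier] z present_zero
      by simp
    finally have "sV lam v0 = 0" using v0_weight zass_e_basis[of 1] by simp
    then show False using v0_nonzero by (simp add: lam)
  qed
  ultimately have "present ` ?N = {0}" by blast
  moreover have "dp_basis 0 \<in> ?N"
  proof
    show "dp_basis 0 = fun_scale (*) 1 (dp_basis 0 :: nat \<Rightarrow> 'a)" by (simp add: fun_scale_def)
  qed simp
  ultimately have "present (dp_basis 0) = 0" by blast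
  then show ?thesis using one_in_carrier by (simp add: kernel_def)
qed

text \<open>A non-constant kernel element yields \<open>x\<close> in the kernel after a constant is
  subtracted, and in weight 0 the top vector field sends \<open>x\<close> to the top
  element.\<close>

lemma kernel_minus_one_constant:
  assumes lam: "lam = - 1" and h: "h \<in> kernel" and n: "0 < n"
  shows "h n = 0"
proof (rule ccontr)
  assume hn: "h n \<noteq> 0"
  have "1 \<le> n" using n by simp
  from kernel_leading[OF h hn this] show False
  proof (elim bexE conjE)
    fix g assume g: "g \<in> kernel" "\<forall>i>1. g i = 0" "g 1 \<noteq> 0"
    let ?k = "g - fun_scale (*) (g 0) (dp_basis 0)"
    have "?k \<in> kernel" by (intro kernel_diff g(1) kernel_scale one_in_kernel_minus_one lam)
    moreover have "?k = fun_scale (*) (g 1) (dp_basis 1)"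
    proof
      fix i :: nat
      consider "i = 0" | "i = 1" | "i > 1" by linarith
      then show "?k i = fun_scale (*) (g 1) (dp_basis 1) i"
        by cases (use g(2) in \<open>simp_all add: fun_scale_def dp_basis_apply\<close>)
    qed
    ultimately have "fun_scale (*) (g 1) (dp_basis 1) \<in> kernel" by simp
    then have x: "dp_basis 1 \<in> kernel" using g(3) by (rule kernel_scaleD)
    have "density m (lam + 1) top_elt (dp_basis 1) = dp_mult m top_elt (dp_deriv m (dp_basis 1))"
      unfolding density_def lam by (simp add: fun_scale_def fun_eq_iff)
    also have "\<dots> = dp_mult m (dp_basis 0) top_elt"
      using q_gt_2 dp_mult_commute[of m top_elt] by (subst dp_deriv_x) simp_all
    also have "\<dots> = top_elt" by (rule dp_mult_one[OF top_in_carrier])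
    finally have "top_elt \<in> kernel" using kernel_density[OF top_in_carrier x] by simp
    then show False using top_not_in_kernel by contradiction
  qed
qed

text \<open>The intertwiner is the derivation from weight 0 to weight 1: like \<open>present\<close>
  it kills exactly the constants, and its image consists of the functions without top
  coefficient.\<close>

lemma has_dim_H1_minus_one:
  assumes lam: "lam = - 1"
  shows "has_dim (zass_H1 m sV act) (Suc (card (generator_degrees m (1 :: 'a))))"
proof -
  have ker: "dp_deriv m h = 0 \<longleftrightarrow> present h = 0" if h: "h \<in> dp_carrier m" for h
  proof
    assume d: "dp_deriv m h = 0"
    have "h = fun_scale (*) (h 0) (dp_basis 0)"
    proof
      fix i
      show "h i = fun_scale (*) (h 0) (dp_basis 0) i"
        using fun_cong[OF d, of "i - 1"] h
        by (cases i) (simp_all add: dp_deriv_apply fun_scale_def dp_basis_apply)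
    qed
    then have "present h = sV (h 0) (present (dp_basis 0))" by (metis present_scale)
    then show "present h = 0" using one_in_kernel_minus_one[OF lam] by (simp add: kernel_def)
  next
    assume "present h = 0"
    then have "h \<in> kernel" using h by (simp add: kernel_def)
    then show "dp_deriv m h = 0"
      using kernel_minus_one_constant[OF lam] h by (simp add: fun_eq_iff dp_deriv_apply)
  qed
  have dens: "density m 1 f (dp_deriv m h) = dp_deriv m (density m (lam + 1) f h)" for f h
    unfolding dp_deriv_density_1[OF prime_char] lam by simp
  have "\<exists>\<iota>. zass_density_embedding m sV act 1 \<iota> \<and> range \<iota> = dp_deriv m ` dp_carrier m"
    by (rule embedding_through_present[OF one_neq_zero dp_carrier_deriv dp_deriv_add
          dp_deriv_scale ker dens])
  then obtain \<iota> where emb: "zass_density_embedding m sV act 1 \<iota>"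
    and range: "range \<iota> = dp_deriv m ` dp_carrier m" by blast
  interpret zass_density_embedding m sV act 1 \<iota> by (rule emb)
  have "dp_deriv m ` dp_carrier m = {h \<in> dp_carrier m. h (q - 1) = (0 :: 'a)}"
  proof (intro equalityI subsetI)
    show "h \<in> {h \<in> dp_carrier m. h (q - 1) = 0}" if "h \<in> dp_deriv m ` dp_carrier m" for h :: "nat \<Rightarrow> 'a"
      using that by (auto simp: dp_carrier_deriv) (simp add: dp_deriv_def)
    show "h \<in> dp_deriv m ` dp_carrier m" if h: "h \<in> {h \<in> dp_carrier m. h (q - 1) = 0}" for h :: "nat \<Rightarrow> 'a"
    proof
      let ?g = "\<lambda>n. if 0 < n \<and> n < q then h (n - 1) else 0"
      show g: "?g \<in> dp_carrier m" by (simp add: dp_carrier_def)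
      show "h = dp_deriv m ?g"
      proof
        fix n
        consider "Suc n < q" | "n = q - 1" | "q \<le> n" using q_gt_2 by linarith
        then show "h n = dp_deriv m ?g n"
          using h unfolding dp_deriv_apply[OF g] by cases (auto simp: dp_carrier_def)
      qed
    qed
  qed
  then show ?thesis using has_dim_zass_H1_derivatives range by simp
qed

text \<open>In weight 1 the action lands in the derivatives, so it is enough that
  \<open>present\<close> kills these. By simplicity the alternative is that they already cover
  \<open>v0\<close>.\<close>

lemma act_trivial:
  assumes lam: "lam = 0" and D: "D \<in> zass m"
  shows "act D v = 0"
proof -
  let ?N = "dp_deriv m ` dp_carrier m"
  have dens: "density m (lam + 1) f h \<in> ?N" for f h
    using density_1_eq_deriv[OF prime_char, of m f h] dp_carrier_mult[of m f h] lam by simp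
  have "present ` ?N = {0} \<or> present ` ?N = UNIV"
  proof (rule present_image_trivial_or_all)
    show "?N \<subseteq> dp_carrier m" using dp_carrier_deriv by blast
    show "0 \<in> ?N" using dp_deriv_zero[of m] dp_carrier_zero[of m] by (metis image_eqI)
    show "g + h \<in> ?N" if "g \<in> ?N" "h \<in> ?N" for g h
      using that dp_carrier_add by (auto simp only: dp_deriv_add[symmetric] intro!: imageI)
    show "fun_scale (*) c h \<in> ?N" if "h \<in> ?N" for c h
      using that dp_carrier_scale by (auto simp only: dp_deriv_scale[symmetric] intro!: imageI)
  qed (rule dens)
  moreover have "present ` ?N \<noteq> UNIV"
  proof
    assume "present ` ?N = UNIV"
    then obtain g where g: "g \<in> dp_carrier m" "present (dp_deriv m g) = v0" by (metis UNIV_I imageE)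
    \<comment> \<open>Its top coefficient is 1, so the kernel is non-zero and contains 1. Acting on
      1 with \<open>g\<close> puts the derivative of \<open>g\<close>, a preimage of
      \<open>v0\<close>, into the kernel.\<close>
    let ?k = "top_elt - dp_deriv m g"
    have k: "?k \<in> kernel"
      unfolding kernel_def using top_in_carrier g(2) present_top
      by (simp only: mem_Collect_eq present_diff diff_self dp_carrier_diff dp_carrier_deriv)
    have "?k (q - 1) \<noteq> 0" using g(1) q_gt_2 by (simp add: dp_deriv_apply dp_carrier_def dp_basis_apply)
    then have "?k \<noteq> 0" by (metis zero_fun_apply)
    then have one: "dp_basis 0 \<in> kernel" by (rule one_in_kernel[OF k])
    have "fun_scale (*) 1 (dp_deriv m g) \<in> kernel"
      using kernel_density[OF g(1) one] unfolding density_one_right lam by simp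
    then have "dp_deriv m g \<in> kernel" by (rule kernel_scaleD) simp
    then show False using g(2) v0_nonzero by (simp add: kernel_def)
  qed
  ultimately have N: "present ` ?N = {0}" by blast
  obtain f where f: "f \<in> dp_carrier m" "D = dp_vf m f" using D unfolding zass_def by blast
  obtain h where h: "h \<in> dp_carrier m" "v = present h" using present_surj by blast
  have "act D v \<in> present ` ?N"
    unfolding f(2) h(2) act_present[OF f(1) h(1)] by (rule imageI[OF dens])
  then show ?thesis unfolding N by simp
qed

text \<open>With zero action a cocycle kills brackets, and each basis element is a multiple of one:
  of a bracket with \<open>e\<^sub>-\<^sub>1\<close> below the top degree, with
  \<open>e\<^sub>0\<close> in it.\<close>

lemma Z1_trivial:
  assumes lam: "lam = 0" and \<phi>: "\<phi> \<in> ce_Z1 (zass m) zass_scale commutator sV act"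
  shows "\<phi> = 0"
proof
  fix D
  note Z = \<phi>[unfolded ce_Z1_iff]
  have br: "\<phi> (dp_vf m (dp_bracket m f g)) = 0" if "f \<in> dp_carrier m" "g \<in> dp_carrier m" for f g
  proof -
    have "\<phi> (commutator (dp_vf m f) (dp_vf m g)) =
        act (dp_vf m f) (\<phi> (dp_vf m g)) - act (dp_vf m g) (\<phi> (dp_vf m f))"
      using Z dp_vf_in_zass[OF that(1)] dp_vf_in_zass[OF that(2)] by blast
    then show ?thesis
      unfolding commutator_dp_vf[OF prime_char]
      by (simp add: act_trivial[OF lam] dp_vf_in_zass[OF that(1)] dp_vf_in_zass[OF that(2)])
  qed
  have add: "\<phi> (dp_vf m (f + g)) = \<phi> (dp_vf m f) + \<phi> (dp_vf m g)"
    if "f \<in> dp_carrier m" "g \<in> dp_carrier m" for f g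
    using Z dp_vf_in_zass[OF that(1)] dp_vf_in_zass[OF that(2)] unfolding dp_vf_add by blast
  have scale: "\<phi> (dp_vf m (fun_scale (*) c f)) = sV c (\<phi> (dp_vf m f))" if "f \<in> dp_carrier m" for c f
    using Z dp_vf_in_zass[OF that] unfolding dp_vf_scale by blast
  have basis: "\<phi> (dp_vf m (dp_basis k)) = 0" if k: "k < q" for k
  proof (cases "Suc k < q")
    case True
    have "dp_bracket m (dp_basis 0) (dp_basis (Suc k)) = (dp_basis k :: nat \<Rightarrow> 'a)"
      using True k by (simp add: dp_bracket_def dp_deriv_basis_Suc dp_deriv_basis_0 dp_mult_zero_right
          dp_mult_one basis_carrier)
    then show ?thesis using br[OF one_in_carrier basis_carrier[OF True]] by simp
  next
    case False
    have top: "k = q - 1" using k False by simp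
    then have "k = Suc (Suc (k - 2))" using q_gt_2 by linarith
    then obtain r where r: "k = Suc (Suc r)" by blast
    \<comment> \<open>The factor is -2 in the field, invertible in odd characteristic.\<close>
    have "dp_bracket m (dp_basis 1) (dp_basis k) =
        fun_scale (*) (of_nat k - 1) (dp_basis k :: nat \<Rightarrow> 'a)"
      using dp_bracket_basis[of 0 "Suc r" m, where 'a = 'a] k r by simp
    moreover have "(dp_basis 1 :: nat \<Rightarrow> 'a) \<in> dp_carrier m" using q_gt_2 by (intro basis_carrier) linarith
    ultimately have "sV (of_nat k - 1) (\<phi> (dp_vf m (dp_basis k))) = 0"
      using br[OF _ basis_carrier[OF k]] scale[OF basis_carrier[OF k]] by metis
    moreover have "(of_nat k - 1 :: 'a) \<noteq> 0"
      using two_nonzero[OF char_gt_2] unfolding top of_nat_q_minus_1 by simp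
    ultimately show ?thesis by simp
  qed
  show "\<phi> D = 0 D"
  proof (cases "D \<in> zass m")
    case True
    then obtain f where f: "f \<in> dp_carrier m" "D = dp_vf m f" unfolding zass_def by blast
    have "\<phi> (dp_vf m f) = (\<Sum>k<q. sV (f k) (\<phi> (dp_vf m (dp_basis k))))"
      using dp_linear_expansion[OF V.vector_space_axioms add scale f(1)] unfolding char_power .
    then show ?thesis using basis f(2) by simp
  next
    case False
    then show ?thesis using Z by simp
  qed
qed

lemma has_dim_H1_zero:
  assumes lam: "lam = 0"
  shows "has_dim (zass_H1 m sV act) 0"
proof -
  let ?ZS = "ce_Z1_space (zass m) zass_scale commutator sV act"
  interpret Z: vectorspace class_ring ?ZS by (rule ce_Z1_space_vectorspace)
  have sub: "subspace class_ring (ce_B1 (zass m) act) ?ZS"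
    by (rule ce_B1_subspace[OF zass_subspace zass_bracket_closed[OF prime_char]])
  have "(0 :: _ \<Rightarrow> 'v) = ce_d0 (zass m) act 0" by (auto simp: fun_eq_iff ce_d0_def)
  then have B: "0 \<in> ce_B1 (zass m) act" unfolding ce_B1_def by blast
  have "has_dim (zass_H1 m sV act) (card ({} :: nat set))"
    unfolding zass_H1_def ce_H1_def
  proof (rule has_dim_quotient_spaceI[OF sub, where v = "\<lambda>_. 0"])
    fix \<psi> assume "\<psi> \<in> carrier ?ZS"
    then have "\<psi> = 0" using Z1_trivial[OF lam] by (simp add: ce_Z1_space_def)
    then have "\<psi> = 0 \<oplus>\<^bsub>?ZS\<^esub> finsum ?ZS (\<lambda>i. c i \<odot>\<^bsub>?ZS\<^esub> 0) ({} :: nat set)" for c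
      by (simp only: Z.M.finsum_empty) (simp add: ce_Z1_space_def)
    with B show "\<exists>c. \<exists>u\<in>ce_B1 (zass m) act. \<psi> = u \<oplus>\<^bsub>?ZS\<^esub> finsum ?ZS (\<lambda>i. c i \<odot>\<^bsub>?ZS\<^esub> 0) ({} :: nat set)"
      by blast
  qed simp_all
  then show ?thesis by simp
qed

end

section \<open>The dimensions\<close>

lemma of_nat_prime_power_minus_1:
  assumes "prime CHAR('a::field)" "1 \<le> j"
  shows "of_nat (CHAR('a) ^ j - 1) = (- 1 :: 'a)"
  using assms by (simp add: of_nat_diff prime_gt_0_nat Suc_le_eq)

lemma two_neq_one: "(2 :: 'a::field) \<noteq> 1"
  using add_left_cancel[of "1 :: 'a" 1 0] by (simp add: one_add_one)

lemma three_eq_zero_iff: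
  assumes "prime CHAR('a::field)"
  shows "(3 :: 'a) = 0 \<longleftrightarrow> CHAR('a) = 3"
proof -
  have "(of_nat 3 :: 'a) = 0 \<longleftrightarrow> CHAR('a) dvd 3" by (rule of_nat_eq_0_iff_char_dvd)
  also have "\<dots> \<longleftrightarrow> CHAR('a) = 3" using primes_dvd_imp_eq[OF assms, of 3] by auto
  finally show ?thesis by simp
qed

text \<open>Degree 1 would need \<open>p = 2\<close>. Degree 2 needs \<open>p = 3\<close>, where it
  equals \<open>3^1 - 1\<close> and is already among the degrees \<open>p^j - 1\<close>.\<close>

lemma card_generator_degrees_minus_1:
  assumes p: "prime CHAR('a::field)" and p2: "CHAR('a) > 2"
  shows "card (generator_degrees m (- 1 :: 'a)) = m - 1"
proof -
  let ?p = "CHAR('a)"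
  have two: "(2 :: 'a) \<noteq> 0" using two_nonzero[OF p2] .
  have p1: "1 < ?p" using p2 by simp
  have pos: "1 \<le> ?p ^ j" for j using p1 by simp
  have "generator_degrees m (- 1 :: 'a) = (\<lambda>j. ?p ^ j - 1) ` {1..<m}"
  proof (intro equalityI subsetI)
    fix k assume "k \<in> generator_degrees m (- 1 :: 'a)"
    then have k: "Suc k < ?p ^ m" "of_nat k = (- 1 :: 'a)" "k = 1 \<or> k = 2 \<or> (\<exists>j\<ge>1. j < m \<and> k = ?p ^ j - 1)"
      by (auto simp: generator_degrees_def)
    have "k \<noteq> 1"
    proof
      assume "k = 1"
      then have "(1 :: 'a) + 1 = 0" using k(2) by (simp only: of_nat_1) simp
      then show False using two by simp
    qed
    moreover have "\<exists>j\<ge>1. j < m \<and> k = ?p ^ j - 1" if "k = 2"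
    proof -
      have "(of_nat (Suc k) :: 'a) = 0" using k(2) by simp
      then have "?p = 3" using three_eq_zero_iff[OF p] that by simp
      \<comment> \<open>The degree bound in \<open>generator_degrees\<close> excludes
        \<open>m = 1\<close>, so the exponent 1 is admissible.\<close>
      then have "3 ^ 1 < (3 :: nat) ^ m" using k(1) that by simp
      then have "1 < m" by (rule power_less_imp_less_exp[rotated]) simp
      then show ?thesis using \<open>?p = 3\<close> that by (intro exI[of _ 1]) simp
    qed
    ultimately obtain j where "j \<ge> 1" "j < m" "k = ?p ^ j - 1" using k(3) by blast
    then show "k \<in> (\<lambda>j. ?p ^ j - 1) ` {1..<m}" by auto
  next
    fix k assume "k \<in> (\<lambda>j. ?p ^ j - 1) ` {1..<m}"
    then obtain j where j: "1 \<le> j" "j < m" "k = ?p ^ j - 1" by auto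
    have "?p \<le> ?p ^ j" using j(1) p1 by (simp add: self_le_power)
    then have "1 \<le> k" using j(3) p2 by linarith
    moreover have "Suc k < ?p ^ m" using j p1 pos[of j] by simp
    moreover have "of_nat k = (- 1 :: 'a)" unfolding j(3) by (rule of_nat_prime_power_minus_1[OF p j(1)])
    ultimately show "k \<in> generator_degrees m (- 1 :: 'a)" unfolding generator_degrees_def using j by blast
  qed
  moreover have "inj_on (\<lambda>j. ?p ^ j - 1) {1..<m}"
  proof (rule inj_onI)
    fix i j assume "?p ^ i - 1 = ?p ^ j - 1"
    then have "?p ^ i = ?p ^ j" using pos[of i] pos[of j] by linarith
    then show "i = j" using p1 by simp
  qed
  ultimately show ?thesis by (simp add: card_image)
qed

lemma generator_degrees_1:
  assumes p: "prime CHAR('a::field)" and p2: "CHAR('a) > 2" and m: "m > 0"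
  shows "generator_degrees m (1 :: 'a) = {1}"
proof (intro equalityI subsetI)
  have two: "(2 :: 'a) \<noteq> 0" using two_nonzero[OF p2] .
  fix k assume "k \<in> generator_degrees m (1 :: 'a)"
  then have k: "of_nat k = (1 :: 'a)" "k = 1 \<or> k = 2 \<or> (\<exists>j\<ge>1. j < m \<and> k = CHAR('a) ^ j - 1)"
    by (auto simp: generator_degrees_def)
  have "k \<noteq> 2"
  proof
    assume "k = 2"
    then show False using k(1) two_neq_one[where 'a = 'a] by simp
  qed
  moreover have "\<not> (\<exists>j\<ge>1. j < m \<and> k = CHAR('a) ^ j - 1)"
  proof
    assume "\<exists>j\<ge>1. j < m \<and> k = CHAR('a) ^ j - 1"
    then have "(1 :: 'a) = - 1" using of_nat_prime_power_minus_1[OF p] k(1) by metis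
    then have "(1 :: 'a) + 1 = 0" by (simp only: eq_neg_iff_add_eq_0)
    then show False using two by simp
  qed
  ultimately show "k \<in> {1}" using k(2) by blast
next
  fix k :: nat assume "k \<in> {1}"
  moreover have "2 < CHAR('a) ^ m" using p2 m self_le_power[of "CHAR('a)" m] by simp
  ultimately show "k \<in> generator_degrees m (1 :: 'a)" by (simp add: generator_degrees_def)
qed

text \<open>In characteristic 3 weight 2 is weight -1, counted above, hence the bound
  \<open>p > 3\<close>.\<close>

lemma generator_degrees_2:
  assumes p: "prime CHAR('a::field)" and p3: "CHAR('a) > 3" and m: "m > 0"
  shows "generator_degrees m (2 :: 'a) = {2}"
proof (intro equalityI subsetI)
  have three: "(3 :: 'a) \<noteq> 0" using three_eq_zero_iff[OF p] p3 by simp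
  fix k assume "k \<in> generator_degrees m (2 :: 'a)"
  then have k: "of_nat k = (2 :: 'a)" "k = 1 \<or> k = 2 \<or> (\<exists>j\<ge>1. j < m \<and> k = CHAR('a) ^ j - 1)"
    by (auto simp: generator_degrees_def)
  have "k \<noteq> 1"
  proof
    assume "k = 1"
    then show False using k(1) two_neq_one[where 'a = 'a] by simp
  qed
  moreover have "\<not> (\<exists>j\<ge>1. j < m \<and> k = CHAR('a) ^ j - 1)"
  proof
    assume "\<exists>j\<ge>1. j < m \<and> k = CHAR('a) ^ j - 1"
    then have "(2 :: 'a) = - 1" using of_nat_prime_power_minus_1[OF p] k(1) by metis
    then have "(2 :: 'a) + 1 = 0" by (simp only: eq_neg_iff_add_eq_0)
    then show False using three by simp
  qed
  ultimately show "k \<in> {2}" using k(2) by blast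
next
  fix k :: nat assume "k \<in> {2}"
  moreover have "3 < CHAR('a) ^ m" using p3 m self_le_power[of "CHAR('a)" m] by simp
  ultimately show "k \<in> generator_degrees m (2 :: 'a)" by (simp add: generator_degrees_def)
qed

lemma generator_degrees_empty:
  assumes p: "prime CHAR('a::field)" and "\<mu> \<noteq> 1" "\<mu> \<noteq> 2" "\<mu> \<noteq> (- 1 :: 'a)"
  shows "generator_degrees m \<mu> = {}"
  using assms of_nat_prime_power_minus_1[OF p] by (force simp: generator_degrees_def)

lemma zass_simple_highest_weight:
  fixes lam :: "'a::field"
  assumes p: "prime CHAR('a)" and p2: "CHAR('a) > 2" and m: "m > 0" and "zass_simple m lam sV act"
  obtains v0 where "zass_highest_weight m sV act lam v0 (CHAR('a) ^ m)"
proof -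
  obtain v where v: "v \<noteq> 0" "(act (zass_e m (-1)) ^^ (CHAR('a) ^ m)) v = 0"
    "act (zass_e m 0) v = sV lam v"
    "\<forall>i. 1 \<le> i \<and> i \<le> int (CHAR('a) ^ m) - 2 \<longrightarrow> act (zass_e m i) v = 0"
    and simp: "simple_lie_module (zass m) zass_scale commutator sV act"
    using assms(4) unfolding zass_simple_def by blast
  have "zass_highest_weight m sV act lam v (CHAR('a) ^ m)"
    by (intro zass_highest_weight.intro zass_highest_weight_axioms.intro simp p p2 m v refl)
      (use v(4) in blast)
  then show ?thesis by (rule that)
qed

theorem theorem5p14:
  fixes p m :: nat
    and lam :: "'a::field"
    and scale :: "'a \<Rightarrow> 'v::ab_group_add \<Rightarrow> 'v"
    and act :: "((nat \<Rightarrow> 'a) \<Rightarrow> (nat \<Rightarrow> 'a)) \<Rightarrow> 'v \<Rightarrow> 'v"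
  assumes "prime p" and "p > 2" and "CHAR('a) = p"
    and "m > 0"
    and "lam \<in> range (of_int :: int \<Rightarrow> 'a)"
    and "zass_simple m lam scale act"
  shows "(p = 3 \<longrightarrow>
      (lam = 0 \<longrightarrow> has_dim (zass_H1 m scale act) 0) \<and>
      (lam = 1 \<longrightarrow> has_dim (zass_H1 m scale act) (m - 1)) \<and>
      (lam = 2 \<longrightarrow> has_dim (zass_H1 m scale act) 2)) \<and>
    (p > 3 \<longrightarrow>
      (lam = 1 \<longrightarrow> has_dim (zass_H1 m scale act) 1) \<and>
      (lam = of_nat (p - 2) \<longrightarrow> has_dim (zass_H1 m scale act) (m - 1)) \<and>
      (lam = of_nat (p - 1) \<longrightarrow> has_dim (zass_H1 m scale act) 2) \<and>
      (lam \<noteq> 1 \<and> lam \<noteq> of_nat (p - 2) \<and> lam \<noteq> of_nat (p - 1) \<longrightarrow>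
        has_dim (zass_H1 m scale act) 0))"
proof -
  have p: "prime CHAR('a)" and p2: "CHAR('a) > 2" using assms by simp_all
  obtain v0 where hw: "zass_highest_weight m scale act lam v0 (CHAR('a) ^ m)"
    by (rule zass_simple_highest_weight[OF p p2 assms(4,6)])
  note has_dim_H1_generic = zass_highest_weight.has_dim_H1_generic[OF hw]
  let ?H = "zass_H1 m scale act"
  have "(of_nat p :: 'a) = 0" using assms(3) by (metis of_nat_CHAR)
  \<comment> \<open>In the form -1 and -2 the same case distinctions serve \<open>p = 3\<close> and
    \<open>p > 3\<close>.\<close>
  then have sub1: "of_nat (p - 1) = (- 1 :: 'a)" and sub2: "of_nat (p - 2) = (- 2 :: 'a)"
    using assms(2) by (simp_all add: of_nat_diff)
  have two: "(2 :: 'a) \<noteq> 0" by (rule two_nonzero[OF p2])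
  have three: "(3 :: 'a) = 0 \<longleftrightarrow> p = 3" using three_eq_zero_iff[OF p] assms(3) by simp
  have dim_0: "has_dim ?H 0" if "lam = 0" using zass_highest_weight.has_dim_H1_zero[OF hw that] .
  have dim_m1: "has_dim ?H 2" if "lam = - 1"
    using zass_highest_weight.has_dim_H1_minus_one[OF hw that] generator_degrees_1[OF p p2 assms(4)] by (simp add: numeral_2_eq_2)
  have dim_m2: "has_dim ?H (m - 1)" if lam: "lam = - 2"
  proof -
    have "lam \<noteq> - 1" using lam two_neq_one[where 'a = 'a] by simp
    moreover have "lam + 1 = - 1" using lam by simp
    ultimately show ?thesis
      using has_dim_H1_generic lam two card_generator_degrees_minus_1[OF p p2, of m] by simp
  qed
  have dim_1: "has_dim ?H 1" if lam: "lam = 1" and p3: "p > 3"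
  proof -
    have "lam \<noteq> - 1"
      using lam two by (simp add: eq_neg_iff_add_eq_0)
    moreover have "lam + 1 = 2" using lam by simp
    ultimately show ?thesis
      using has_dim_H1_generic lam generator_degrees_2[OF p _ assms(4)] p3 assms(3) by simp
  qed
  have dim_other: "has_dim ?H 0" if "lam \<noteq> 1" "lam \<noteq> - 2" "lam \<noteq> - 1"
  proof (cases "lam = 0")
    case False
    \<comment> \<open>The only weights with generators are 1, 2 and -1; weight 1 belongs to
      \<open>lam = 0\<close>, which is treated apart.\<close>
    have "lam + 1 \<noteq> 1" "lam + 1 \<noteq> 2" "lam + 1 \<noteq> - 1"
      using False that by (simp_all add: eq_neg_iff_add_eq_0 add.assoc)
    then show ?thesis
      using has_dim_H1_generic[OF False that(3)] generator_degrees_empty[OF p] by simp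
  qed (rule dim_0)
  show ?thesis
    unfolding sub1 sub2
  proof (intro conjI impI)
    assume "p = 3"
    then have "(3 :: 'a) = 0" using three by simp
    \<comment> \<open>In characteristic 3 the case \<open>lam = 1\<close> is the case
      \<open>lam = -2\<close>, and \<open>lam = 2\<close> is \<open>lam = -1\<close>.\<close>
    then have "(1 :: 'a) = - 2" "(2 :: 'a) = - 1" by (simp_all add: eq_neg_iff_add_eq_0)
    then show "lam = 1 \<Longrightarrow> has_dim ?H (m - 1)" "lam = 2 \<Longrightarrow> has_dim ?H 2"
      using dim_m1 dim_m2 by simp_all
  qed (use dim_0 dim_1 dim_m1 dim_m2 dim_other in simp_all)
qed

end
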